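(* Let $q\in\mathbb{C}$ with $0<|q|<1$, let $v\in\mathbb{C}\setminus\{0\}$, and define the modified generators $$\tilde{x}^+_v(z)=\mathcal{P}\,x^+_v(z)\,\mathcal{P}+\frac{z}{v},\qquad \tilde{x}^-_v(z)=\mathcal{P}\,x^-_v(z)\,\mathcal{P}+\frac{v}{z},\qquad \tilde{h}_m=-\frac{v^m}{m}\,\frac{\mathcal{P}a_m\mathcal{P}}{1-q^{-m}}\quad(m\in\mathbb{Z}\setminus\{0\}),$$ together with the central values $\hat l_1=0$, $\hat l_2=1$. Then they act on the S-dual basis as the vertical $(0,1)_v$ representation; that is, for every partition $\lambda$, $$\tilde{x}_v^+(z)|\lambda\rangle_{\mathcal S}=(1-q)\sum_{x\in A(\lambda)}\delta(z/\chi_x)\,|\lambda+x\rangle_{\mathcal S},$$ $$\tilde{x}_v^-(z)|\lambda\rangle_{\mathcal S}=(1-q^{-1})\sum_{x\in R(\lambda)}\delta(z/\chi_x)\,|\lambda-x\rangle_{\mathcal S},$$ $$\tilde h_m|\lambda\rangle_{\mathcal S}=\frac{v^m}{m}\,\frac{p_m(q^{-\lambda'-\rho-1/2})}{1-q^{-m}}\,|\lambda\rangle_{\mathcal S}\quad(m>0),$$ $$\tilde h_m|\lambda\rangle_{\mathcal S}=-\frac{v^m}{m}\,\frac{p_{-m}(q^{-\lambda-\rho+1/2})}{1-q^{-m}}\,|\lambda\rangle_{\mathcal S}\quad(m<0).$$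
   Context: Fix $q\in\mathbb C$ with $0<|q|<1$. Bosonic oscillators $a_n$ ($n\in\mathbb Z$) satisfy $[a_m,a_n]=m\delta_{m+n,0}$. $\mathcal F$ is the Fock space with vacuum $|0\rangle$, $a_n|0\rangle=0$ for $n\ge 0$, and dual vacuum $\langle 0|$, $\langle 0|a_{-n}=0$ for $n\ge 0$, $\langle 0|0\rangle=1$. $\mathcal F$ is graded by $\deg(a_{-n_1}\cdots a_{-n_k}|0\rangle)=\sum n_i$. Infinite kets lie in the product completion $\prod_d\mathcal F_d$, infinite bras in $\prod_d\mathcal F_d^*$. $:\ :$ puts $a_n$ with $n<0$ to the left of $a_n$ with $n\ge0$. For a partition $\lambda$: $\lambda'$ is the conjugate, $|\lambda|$ the size, $\kappa_\lambda=\sum_i\lambda_i(\lambda_i-2i+1)$, $\rho=(-\tfrac12,-\tfrac32,\dots)$, $p_n(x)=\sum_i x_i^n$, so $p_n(q^{-\lambda'-\rho-1/2})=\sum_{l>0}q^{(-\lambda'_l+l-1)n}$ and $p_n(q^{-\lambda-\rho+1/2})=\sum_{l>0}q^{(-\lambda_l+l)n}$ ($\lambda_l=0$ beyond the length). S-dual basis: $$|\lambda\rangle_{\mathcal S}=\mathcal N_\lambda\exp\Big[-\sum_{n>0}\tfrac{a_{-n}}{n}p_n(q^{-\lambda'-\rho-1/2})\Big]|0\rangle,\quad {}_{\mathcal S}\langle\lambda|=\mathcal N'_\lambda\langle0|\exp\Big[\sum_{n>0}\tfrac{a_n}{n}p_n(q^{-\lambda-\rho+1/2})\Big],$$ $$\mathcal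 N_\lambda=\Big[(-1)^{|\lambda|}q^{\frac12\kappa_\lambda-|\lambda|}\prod_{i,j>0}(1-q^{-\lambda_i-\lambda'_j+i+j-1})^{-1}\Big]^{1/2},$$ $$\mathcal N'_\lambda=(-1)^{|\lambda|}\Big[(-1)^{|\lambda|}q^{-\frac12\kappa_\lambda+|\lambda|}\prod_{i,j>0}(1-q^{-\lambda_i-\lambda'_j+i+j-1})^{-1}\Big]^{1/2}.$$ The square roots are the holomorphic ones in $|q|<1$ that are positive for $0<q<1$. Currents (formal series in $z^{\pm1}$): $x^+_v(z)=q^{a_0}:\exp\big(-\sum_{n\ne0}\frac{1-q^n}{n}a_n(z/v)^{-n}\big):$ and $x^-_v(z)=q^{-a_0}:\exp\big(\sum_{n\ne0}\frac{1-q^n}{n}a_n(z/v)^{-n}\big):$. Matrix elements between S-dual bras and kets are regularized: for an operator $X$ (a product of $a_n$'s or a coefficient of $x^\pm_v(z)$), ${}_{\mathcal S}\langle\lambda|X|\mu\rangle_{\mathcal S}$ means the value at $t=1$ of the analytic continuation of the power series ${}_{\mathcal S}\langle\lambda|t^{L}X|\mu\rangle_{\mathcal S}$ (convergent for small $|t|$), where $t^{L}$ multiplies the degree-$d$ component by $t^d$. In particular ${}_{\mathcal S}\langle\lambda|\mu\rangle_{\mathcal S}=\mathcal N'_\lambda\mathcal N_\mu\prod_{i,j>0}(1-q^{-\lambda_i-\mu'_j+i+j-1})=\delta_{\lambda\mu}$. The projection operator is $\mathcal P=\sum_\lambda|\lambda\rangle_{\mathcal S}\,{}_{\mathcal S}\langle\lambda|$,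 with all pairings regularized in this sense; thus $\mathcal P|\lambda\rangle_{\mathcal S}=|\lambda\rangle_{\mathcal S}$ and $\mathcal PX\mathcal P|\lambda\rangle_{\mathcal S}=\sum_\mu|\mu\rangle_{\mathcal S}\;{}_{\mathcal S}\langle\mu|X|\lambda\rangle_{\mathcal S}$. $\delta(z)=\sum_{n\in\mathbb Z}z^n$. $A(\lambda)$ (resp. $R(\lambda)$) is the set of boxes that can be added to (resp. removed from) the Young diagram $\lambda$, with result $\lambda+x$ (resp. $\lambda-x$); for a box $x=(i,j)$ (row $i$, column $j$), $\chi_x=vq^{j-i}$. *)

theory Defs
  imports "HOL-Complex_Analysis.Complex_Analysis" "HOL-Library.Multiset"
begin

section \<open>Partitions\<close>

text \<open>Partitions are given by their Young diagrams: boxes \<open>(i, j)\<close> in row_len \<open>i \<ge> 1\<close> and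
  column \<open>j \<ge> 1\<close>.  Then \<open>\<Lambda>\<^sub>i = row_len \<Lambda> i\<close>, \<open>\<Lambda>'\<^sub>j = col_len \<Lambda> j\<close> (both are \<open>0\<close> beyond the
  length) and \<open>|\<Lambda>| = card \<Lambda>\<close>.\<close>

type_synonym diagram = "(nat \<times> nat) set"

definition is_partition :: "diagram \<Rightarrow> bool" where
  "is_partition \<Lambda> \<longleftrightarrow> finite \<Lambda> \<and> (\<forall>(i, j) \<in> \<Lambda>. 1 \<le> i \<and> 1 \<le> j \<and> {1..i} \<times> {1..j} \<subseteq> \<Lambda>)"

definition row_len :: "diagram \<Rightarrow> nat \<Rightarrow> nat" where
  "row_len \<Lambda> i = card {j. (i, j) \<in> \<Lambda>}"

definition col_len :: "diagram \<Rightarrow> nat \<Rightarrow> nat" where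
  "col_len \<Lambda> j = card {i. (i, j) \<in> \<Lambda>}"

definition addable :: "diagram \<Rightarrow> (nat \<times> nat) set" where
  "addable \<Lambda> = {x. x \<notin> \<Lambda> \<and> is_partition (insert x \<Lambda>)}"

definition removable :: "diagram \<Rightarrow> (nat \<times> nat) set" where
  "removable \<Lambda> = {x \<in> \<Lambda>. is_partition (\<Lambda> - {x})}"

definition box_weight :: "complex \<Rightarrow> complex \<Rightarrow> nat \<times> nat \<Rightarrow> complex" where
  "box_weight q v x = v * q powi (int (snd x) - int (fst x))"

definition kappa :: "diagram \<Rightarrow> int" where
  "kappa \<Lambda> = (\<Sum>i \<in> fst ` \<Lambda>. int (row_len \<Lambda> i) * (int (row_len \<Lambda> i) - 2 * int i + 1))"

section \<open>Fock space\<close>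

text \<open>The vectors \<open>a\<^bsub>-n\<^sub>1\<^esub> \<cdots> a\<^bsub>-n\<^sub>k\<^esub>|0\<rangle>\<close> with all \<open>n\<^sub>i \<ge> 1\<close> form a basis of the Fock space.  They are
  indexed by the multisets of the numbers \<open>n\<^sub>i - 1\<close>, so that every multiset over \<^typ>\<open>nat\<close> is an
  index.  Each graded piece is finite-dimensional, so an element of the product completion is an
  arbitrary family of coefficients in this basis (a ket), and an element of the product of the dual
  pieces is an arbitrary family of values on the basis vectors (a bra).\<close>

type_synonym ket = "nat multiset \<Rightarrow> complex"
type_synonym bra = "nat multiset \<Rightarrow> complex"
type_synonym fock_op = "ket \<Rightarrow> ket"

definition fock_degree :: "nat multiset \<Rightarrow> nat" where
  "fock_degree M = (\<Sum>i\<in>#M. Suc i)"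

definition basis_ket :: "nat multiset \<Rightarrow> ket" where
  "basis_ket M = (\<lambda>K. if K = M then 1 else 0)"

definition vacuum :: ket where
  "vacuum = basis_ket {#}"

text \<open>The pairing of the dual vacuum \<open>\<langle>0|\<close> with a ket.\<close>

definition dual_vacuum :: "ket \<Rightarrow> complex" where
  "dual_vacuum f = f {#}"

text \<open>The oscillators: \<open>a\<^bsub>-n\<^esub>\<close> with \<open>n > 0\<close> adds a part \<open>n\<close>, and \<open>a\<^sub>n\<close> with \<open>n > 0\<close> is \<open>n\<close> times the
  derivative with respect to \<open>a\<^bsub>-n\<^esub>\<close>.\<close>

definition osc :: "int \<Rightarrow> fock_op" where
  "osc n f = (\<lambda>M.
     if n < 0 then (let i = nat (- n) - 1 in if i \<in># M then f (M - {#i#}) else 0)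
     else if n = 0 then 0
     else (let i = nat n - 1 in of_int n * of_nat (count M i + 1) * f (add_mset i M)))"

lemma osc_commutator:
  "osc m (osc n f) M - osc n (osc m f) M = (if m + n = 0 then of_int m * f M else 0)"
proof -
  have neg: "osc k g K = (let i = nat (- k) - 1 in if i \<in># K then g (K - {#i#}) else 0)"
    if "k < 0" for k g K using that by (simp add: osc_def)
  have pos: "osc k g K = (let i = nat k - 1 in of_int k * of_nat (count K i + 1) * g (add_mset i K))"
    if "k > 0" for k g K using that by (simp add: osc_def)
  have zero: "osc 0 g K = 0" for g K by (simp add: osc_def)
  have z': "osc k (osc 0 g) K = 0" for k g K by (simp add: osc_def Let_def)
  have mixed: "osc a (osc b g) K - osc b (osc a g) K = (if a + b = 0 then of_int a * g K else 0)"
    if a: "a > 0" and b: "b < 0" for a b g K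
  proof (cases "a + b = 0")
    case True
    then have "nat (- b) - 1 = nat a - 1" by simp
    then show ?thesis using True a b
      by (auto simp: neg pos Let_def algebra_simps not_in_iff)
  next
    case False
    then have "nat (- b) - 1 \<noteq> nat a - 1" using a b by linarith
    then show ?thesis using False a b
      by (auto simp: neg pos Let_def algebra_simps diff_add_mset_swap add_mset_remove_trivial_If)
  qed
  consider "m = 0 \<or> n = 0" | "m > 0" "n > 0" | "m < 0" "n < 0" | "m > 0" "n < 0" | "m < 0" "n > 0"
    by linarith
  then show ?thesis
  proof cases
    case 1 then show ?thesis by (auto simp: zero z')
  next
    case 2 then show ?thesis by (auto simp: pos Let_def add_mset_commute)
  next
    case 3 then show ?thesis by (auto simp: neg Let_def in_diff_count add_mset_commute)
  next
    case 4 then show ?thesis by (rule mixed)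
  next
    case 5
    then have "osc n (osc m f) M - osc m (osc n f) M = (if n + m = 0 then of_int n * f M else 0)"
      by (intro mixed)
    moreover have "of_int n = - (of_int m :: complex)" if "m + n = 0"
      using that by (metis add.commute eq_neg_iff_add_eq_0 of_int_minus)
    ultimately show ?thesis by (auto simp: algebra_simps split: if_splits)
  qed
qed

section \<open>Exponentials of oscillators\<close>

text \<open>\<open>op_power A k m\<close> is the coefficient of \<open>w\<^sup>m\<close> in \<open>(\<Sum>n>0. A n w\<^sup>n)\<^sup>k\<close>, and \<open>op_exp A m\<close> is the
  coefficient of \<open>w\<^sup>m\<close> in \<open>exp (\<Sum>n>0. A n w\<^sup>n)\<close>; powers \<open>k > m\<close> do not contribute to the latter.\<close>

fun op_power :: "(nat \<Rightarrow> fock_op) \<Rightarrow> nat \<Rightarrow> nat \<Rightarrow> fock_op" where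
  "op_power A 0 m f = (if m = 0 then f else (\<lambda>M. 0))"
| "op_power A (Suc k) m f = (\<lambda>M. \<Sum>n = 1..m. A n (op_power A k (m - n) f) M)"

definition op_exp :: "(nat \<Rightarrow> fock_op) \<Rightarrow> nat \<Rightarrow> fock_op" where
  "op_exp A m f = (\<lambda>M. \<Sum>k\<le>m. op_power A k m f M / fact k)"

definition scaled_osc :: "(int \<Rightarrow> complex) \<Rightarrow> int \<Rightarrow> fock_op" where
  "scaled_osc c n f = (\<lambda>M. c n * osc n f M)"

section \<open>The S-dual basis\<close>

text \<open>\<open>col_spec q \<Lambda>\<close> and \<open>row_spec q \<Lambda>\<close> are the sequences (indexed by \<open>l \<ge> 1\<close>)
  \<open>q\<^bsup>-\<Lambda>'-\<rho>-1/2\<^esup>\<close> and \<open>q\<^bsup>-\<Lambda>-\<rho>+1/2\<^esup>\<close>, where \<open>\<rho>\<^sub>l = 1/2 - l\<close>.\<close>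

definition col_spec :: "complex \<Rightarrow> diagram \<Rightarrow> nat \<Rightarrow> complex" where
  "col_spec q \<Lambda> l = q powi (- int (col_len \<Lambda> l) + int l - 1)"

definition row_spec :: "complex \<Rightarrow> diagram \<Rightarrow> nat \<Rightarrow> complex" where
  "row_spec q \<Lambda> l = q powi (- int (row_len \<Lambda> l) + int l)"

definition power_sum :: "nat \<Rightarrow> (nat \<Rightarrow> complex) \<Rightarrow> complex" where
  "power_sum n x = (\<Sum>\<^sub>\<infinity>l\<in>{1..}. x l ^ n)"

text \<open>The square root of \<open>F\<close> that is holomorphic in the unit disc and positive on \<open>(0, 1)\<close>.  The
  functions \<open>F\<close> below are given by formulas with negative powers of \<open>q\<close>, hence only for \<open>q \<noteq> 0\<close>.\<close>

definition holo_sqrt :: "(complex \<Rightarrow> complex) \<Rightarrow> complex \<Rightarrow> complex" where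
  "holo_sqrt F q = (THE w. \<exists>g. g holomorphic_on ball 0 1
     \<and> (\<forall>z \<in> ball 0 1 - {0}. g z ^ 2 = F z)
     \<and> (\<forall>x::real. 0 < x \<and> x < 1 \<longrightarrow> (\<exists>y>0. g (of_real x) = of_real y))
     \<and> w = g q)"

text \<open>The product over all \<open>i, j > 0\<close>; the library's infinite products start at index \<open>0\<close>.\<close>

definition hook_prod :: "diagram \<Rightarrow> complex \<Rightarrow> complex" where
  "hook_prod \<Lambda> q = (\<Prod>i. \<Prod>j. 1 - q powi
     (- int (row_len \<Lambda> (Suc i)) - int (col_len \<Lambda> (Suc j)) + int (Suc i) + int (Suc j) - 1))"

text \<open>The number \<open>\<kappa>\<^sub>\<Lambda>\<close> is always even, so the integer division below is exact.\<close>

definition norm_ket :: "complex \<Rightarrow> diagram \<Rightarrow> complex" where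
  "norm_ket q \<Lambda> = holo_sqrt (\<lambda>z. (-1) ^ card \<Lambda>
     * z powi (kappa \<Lambda> div 2 - int (card \<Lambda>)) * inverse (hook_prod \<Lambda> z)) q"

definition norm_bra :: "complex \<Rightarrow> diagram \<Rightarrow> complex" where
  "norm_bra q \<Lambda> = (-1) ^ card \<Lambda> * holo_sqrt (\<lambda>z. (-1) ^ card \<Lambda>
     * z powi (- (kappa \<Lambda> div 2) + int (card \<Lambda>)) * inverse (hook_prod \<Lambda> z)) q"

text \<open>In the next two definitions the sum over \<open>m\<close> adds up the homogeneous parts of the exponential;
  at a given basis vector only \<open>m = fock_degree M\<close> contributes.\<close>

definition S_ket :: "complex \<Rightarrow> diagram \<Rightarrow> ket" where
  "S_ket q \<Lambda> = (\<lambda>M. norm_ket q \<Lambda> *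
     (\<Sum>m. op_exp (\<lambda>n f K. - (power_sum n (col_spec q \<Lambda>) / of_nat n) * osc (- int n) f K)
              m vacuum M))"

definition S_bra :: "complex \<Rightarrow> diagram \<Rightarrow> bra" where
  "S_bra q \<Lambda> = (\<lambda>M. norm_bra q \<Lambda> *
     (\<Sum>m. dual_vacuum
        (op_exp (\<lambda>n f K. power_sum n (row_spec q \<Lambda>) / of_nat n * osc (int n) f K)
              m (basis_ket M))))"

section \<open>Regularized pairings and the projection operator\<close>

definition graded_pairing :: "bra \<Rightarrow> ket \<Rightarrow> nat \<Rightarrow> complex" where
  "graded_pairing \<phi> f d = (\<Sum>M | fock_degree M = d. \<phi> M * f M)"

text \<open>The value at \<open>t = 1\<close> of the analytic continuation of \<open>\<Sum>d. c d t\<^sup>d\<close>.  The continuation may have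
  to avoid poles on the segment from \<open>0\<close> to \<open>1\<close>.\<close>

definition continued_value :: "(nat \<Rightarrow> complex) \<Rightarrow> complex" where
  "continued_value c = (THE w. \<exists>U F. open U \<and> connected U \<and> 0 \<in> U \<and> 1 \<in> U \<and> F holomorphic_on U
     \<and> (\<forall>\<^sub>F t in nhds 0. (\<lambda>d. c d * t ^ d) sums F t) \<and> w = F 1)"

text \<open>\<open>reg_pairing \<phi> (X f)\<close> is the regularized value of \<open>\<langle>\<phi>|t\<^sup>L X|f\<rangle>\<close>.\<close>

definition reg_pairing :: "bra \<Rightarrow> ket \<Rightarrow> complex" where
  "reg_pairing \<phi> f = continued_value (graded_pairing \<phi> f)"

definition proj :: "complex \<Rightarrow> fock_op" where
  "proj q f = (\<lambda>M. \<Sum>\<^sub>\<infinity>\<mu> \<in> Collect is_partition. S_ket q \<mu> M * reg_pairing (S_bra q \<mu>) f)"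

definition sandwich :: "complex \<Rightarrow> fock_op \<Rightarrow> fock_op" where
  "sandwich q X f = proj q (X (proj q f))"

section \<open>Currents and modified generators\<close>

text \<open>\<open>exp (s a\<^sub>0)\<close>, used for \<open>q\<^bsup>\<plusminus>a\<^sub>0\<^esup>\<close> with \<open>s = \<plusminus>Ln q\<close>.  As \<open>a\<^sub>0\<close> vanishes on the Fock space, the
  branch of the logarithm does not matter.\<close>

definition exp_zero_mode :: "complex \<Rightarrow> fock_op" where
  "exp_zero_mode s f = (\<lambda>M. \<Sum>k. s ^ k / fact k * (osc 0 ^^ k) f M)"

text \<open>The coefficient of \<open>w\<^sup>k\<close> in the normally ordered exponential
  \<open>:exp (\<Sum>n\<noteq>0. c n a\<^sub>n w\<^bsup>-n\<^esup>):\<close>.  The creation part contributes \<open>w\<^bsup>k+m\<^esup>\<close> and the annihilation part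
  \<open>w\<^bsup>-m\<^esup>\<close>; at a given basis vector only finitely many \<open>m\<close> contribute.\<close>

definition vertex_coeff :: "(int \<Rightarrow> complex) \<Rightarrow> int \<Rightarrow> fock_op" where
  "vertex_coeff c k f = (\<lambda>M. \<Sum>m. if k + int m < 0 then 0 else
     op_exp (\<lambda>n. scaled_osc c (- int n)) (nat (k + int m))
       (op_exp (\<lambda>n. scaled_osc c (int n)) m f) M)"

text \<open>A formal series in \<open>z\<close> and \<open>1/z\<close> is given by its coefficients: the argument \<open>k\<close> below selects
  the coefficient of \<open>z\<^sup>k\<close>.  The factor \<open>v powi (- k)\<close> arises from \<open>w = z/v\<close>.\<close>

definition x_plus :: "complex \<Rightarrow> complex \<Rightarrow> int \<Rightarrow> fock_op" where
  "x_plus q v k f = exp_zero_mode (Ln q)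
     (\<lambda>M. v powi (- k) * vertex_coeff (\<lambda>n. - ((1 - q powi n) / of_int n)) k f M)"

definition x_minus :: "complex \<Rightarrow> complex \<Rightarrow> int \<Rightarrow> fock_op" where
  "x_minus q v k f = exp_zero_mode (- Ln q)
     (\<lambda>M. v powi (- k) * vertex_coeff (\<lambda>n. (1 - q powi n) / of_int n) k f M)"

definition x_plus_mod :: "complex \<Rightarrow> complex \<Rightarrow> int \<Rightarrow> fock_op" where
  "x_plus_mod q v k f =
     (\<lambda>M. sandwich q (x_plus q v k) f M + (if k = 1 then 1 / v else 0) * f M)"

definition x_minus_mod :: "complex \<Rightarrow> complex \<Rightarrow> int \<Rightarrow> fock_op" where
  "x_minus_mod q v k f =
     (\<lambda>M. sandwich q (x_minus q v k) f M + (if k = - 1 then v else 0) * f M)"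

definition h_mod :: "complex \<Rightarrow> complex \<Rightarrow> int \<Rightarrow> fock_op" where
  "h_mod q v m f =
     (\<lambda>M. - (v powi m / of_int m) * (sandwich q (osc m) f M / (1 - q powi (- m))))"

text \<open>The central generators act by their values.\<close>

definition l1_mod :: fock_op where
  "l1_mod f = (\<lambda>M. 0 * f M)"

definition l2_mod :: fock_op where
  "l2_mod f = (\<lambda>M. 1 * f M)"

text \<open>\<open>delta_coeff c k\<close> is the coefficient of \<open>z\<^sup>k\<close> in \<open>\<delta>(c z) = (\<Sum>n\<in>\<int>. (c z)\<^sup>n)\<close>.\<close>

definition delta_coeff :: "complex \<Rightarrow> int \<Rightarrow> complex" where
  "delta_coeff c k = c powi k"

end

theory Submission
  imports Defs
begin

text \<open>The S-dual vectors are coherent states, so every regularized matrix element is the value at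
  \<open>t = 1\<close> of an explicit function.  A current acts on \<open>|\<mu>\<rangle>\<close> through the rational function with simple
  poles at the contents of the addable boxes of \<open>\<mu>\<close> and zeros at those of the removable boxes, and on
  \<open>\<langle>\<Lambda>|\<close> through the inverse of the corresponding function of the transposed diagram.  Expanding the
  former in partial fractions, the term of an addable box \<open>a\<close> multiplies \<open>\<langle>\<Lambda>|t\<^sup>L|\<mu>\<rangle>\<close> by exactly the factor
  that turns it into \<open>\<langle>\<Lambda>|t\<^sup>L|\<mu> + a\<rangle>\<close>.  By orthogonality only \<open>\<Lambda> = \<mu> + a\<close> survives at \<open>t = 1\<close>, together
  with a diagonal term that the shift by \<open>z/v\<close> removes.  The residue is the ratio of the normalization
  factors of \<open>\<mu> + a\<close> and \<open>\<mu>\<close>, because the square roots are holomorphic in \<open>q\<close> and positive on \<open>(0, 1)\<close>.\<close>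

section \<open>Exponentials of formal power series\<close>

text \<open>In the regulator t a matrix element is an entire function times a rational one, and at t
  = 1 zeros of the former meet poles of the latter. All cancellations are therefore carried out
  between formal power series, and numbers are taken only afterwards. The diagonal term comes from
  the range of summation: the coefficient of z^k involves only created degrees j \<ge> k, while the
  partial fractions produce a series over all j \<ge> 0. The difference is a polynomial weighted by
  \<langle>\<Lambda>|\<mu>\<rangle>, so it survives only for \<Lambda> = \<mu>. The normalization
  poses a problem of sign, since its squares fix the residue only up to sign. Divided by 1 - q, the
  residue is rewritten as a product over the columns that is visibly holomorphic in the disc and
  positive on (0, 1). For the empty partition the square of the ket factor is MacMahon's generating
  function of plane partitions, whose logarithm provides the root. The current x^- needs no second
  computation, since transposition of diagrams reduces it to x^+.\<close>

definition exp_fps :: "(nat \<Rightarrow> complex) \<Rightarrow> complex fps" where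
  "exp_fps a = fps_exp 1 oo Abs_fps (\<lambda>n. if n = 0 then 0 else a n)"

lemma exp_fps_nth_0 [simp]: "fps_nth (exp_fps a) 0 = 1"
  by (simp add: exp_fps_def)

lemma fps_deriv_exp_fps:
  "fps_deriv (exp_fps a) = exp_fps a * Abs_fps (\<lambda>n. of_nat (Suc n) * a (Suc n))"
proof -
  have "fps_deriv (Abs_fps (\<lambda>n. if n = 0 then 0 else a n)) = Abs_fps (\<lambda>n. of_nat (Suc n) * a (Suc n))"
    by (rule fps_ext) simp
  then show ?thesis
    by (simp add: exp_fps_def fps_compose_deriv)
qed

text \<open>Comparing coefficients of t^m turns F' = F H into a recursion for the coefficient m + 1,
  which can be solved in characteristic 0.\<close>

lemma fps_linear_ode_unique:
  fixes F G H :: "complex fps"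
  assumes "fps_deriv F = F * H" "fps_deriv G = G * H" "fps_nth F 0 = fps_nth G 0"
  shows "F = G"
proof (rule fps_ext)
  fix n show "fps_nth F n = fps_nth G n"
  proof (induction n rule: less_induct)
    case (less n)
    show ?case
    proof (cases n)
      case (Suc m)
      have "fps_nth (fps_deriv F) m = fps_nth (fps_deriv G) m"
        unfolding assms by (auto simp: fps_mult_nth less Suc intro!: sum.cong)
      then have "of_nat (Suc m) * fps_nth F (Suc m) = of_nat (Suc m) * fps_nth G (Suc m)"
        by (simp del: of_nat_Suc)
      then show ?thesis
        unfolding Suc mult_cancel_left of_nat_eq_0_iff by blast
    qed (use assms in simp)
  qed
qed

lemma exp_fps_eqI:
  assumes "fps_nth F 0 = 1" "fps_deriv F = F * Abs_fps (\<lambda>n. of_nat (Suc n) * a (Suc n))"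
  shows "F = exp_fps a"
  using assms by (intro fps_linear_ode_unique[OF _ fps_deriv_exp_fps]) auto

lemma exp_fps_cong: "(\<And>n. n > 0 \<Longrightarrow> a n = b n) \<Longrightarrow> exp_fps a = exp_fps b"
  unfolding exp_fps_def by (rule arg_cong[where f = "\<lambda>F. fps_exp 1 oo F"], rule fps_ext) simp

lemma exp_fps_add: "exp_fps (\<lambda>n. a n + b n) = exp_fps a * exp_fps b"
proof (rule exp_fps_eqI[symmetric])
  show "fps_deriv (exp_fps a * exp_fps b) =
        exp_fps a * exp_fps b * Abs_fps (\<lambda>n. of_nat (Suc n) * (a (Suc n) + b (Suc n)))"
  proof -
    have "Abs_fps (\<lambda>n. of_nat (Suc n) * (a (Suc n) + b (Suc n)))
      = Abs_fps (\<lambda>n. of_nat (Suc n) * a (Suc n)) + Abs_fps (\<lambda>n. of_nat (Suc n) * b (Suc n))"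
      by (rule fps_ext) (simp add: algebra_simps)
    then show ?thesis
      by (simp add: fps_deriv_exp_fps algebra_simps)
  qed
qed simp

lemma exp_fps_zero: "exp_fps (\<lambda>_. 0) = 1"
  by (rule exp_fps_eqI[symmetric]) (auto simp: fps_eq_iff)

lemma exp_fps_sum: "finite A \<Longrightarrow> exp_fps (\<lambda>n. \<Sum>x\<in>A. f x n) = (\<Prod>x\<in>A. exp_fps (f x))"
  by (induction A rule: finite_induct) (simp_all add: exp_fps_zero exp_fps_add)

lemma exp_fps_minus: "exp_fps (\<lambda>n. - a n) = inverse (exp_fps a)"
proof -
  have "exp_fps (\<lambda>n. - a n) * exp_fps a = 1"
    unfolding exp_fps_add[symmetric] by (simp add: exp_fps_zero)
  then show ?thesis
    by (metis mult.commute fps_inverse_unique)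
qed

text \<open>The coefficientwise form of F' = F A'. When n a(n) is a power sum this is Newton's
  identity for complete symmetric functions.\<close>

lemma exp_fps_nth_rec:
  "of_nat n * fps_nth (exp_fps a) n = (\<Sum>i = 1..n. of_nat i * a i * fps_nth (exp_fps a) (n - i))"
proof (cases n)
  case (Suc m)
  have "fps_nth (fps_deriv (exp_fps a)) m
     = (\<Sum>i=0..m. of_nat (Suc i) * a (Suc i) * fps_nth (exp_fps a) (m - i))"
    unfolding fps_deriv_exp_fps by (subst mult.commute) (simp add: fps_mult_nth)
  moreover have "(\<Sum>i=0..m. of_nat (Suc i) * a (Suc i) * fps_nth (exp_fps a) (m - i))
     = (\<Sum>i = 1..n. of_nat i * a i * fps_nth (exp_fps a) (n - i))"
    by (rule sum.reindex_bij_witness[of _ "\<lambda>i. i - 1" Suc]) (auto simp: Suc)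
  ultimately show ?thesis by (simp add: Suc)
qed simp

text \<open>The degree operator of the Fock space yields exactly this recursion, which is how graded
  pairings are recognized as exponentials.\<close>

lemma exp_fps_nth_uniqueI:
  assumes "g 0 = c"
    and "\<And>n. of_nat n * g n = (\<Sum>i = 1..n. of_nat i * a i * g (n - i))"
  shows "g n = c * fps_nth (exp_fps a) n"
proof (induction n rule: less_induct)
  case (less n)
  show ?case
  proof (cases "n = 0")
    case False
    have "of_nat n * g n = (\<Sum>i = 1..n. of_nat i * a i * (c * fps_nth (exp_fps a) (n - i)))"
      unfolding assms(2)[of n] using less by (intro sum.cong) auto
    also have "\<dots> = c * (of_nat n * fps_nth (exp_fps a) n)"
      unfolding exp_fps_nth_rec sum_distrib_left by (simp add: algebra_simps)
    finally show ?thesis using False by simp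
  qed (use assms in simp)
qed

text \<open>By the recursion each coefficient is a polynomial in finitely many of the a(i), so
  limits in the exponent may be taken coefficientwise.\<close>

lemma tendsto_exp_fps_nth:
  assumes "\<And>i. i > 0 \<Longrightarrow> ((\<lambda>x. a x i) \<longlongrightarrow> b i) F"
  shows "((\<lambda>x. fps_nth (exp_fps (a x)) n) \<longlongrightarrow> fps_nth (exp_fps b) n) F"
proof (induction n rule: less_induct)
  case (less n)
  show ?case
  proof (cases "n = 0")
    case False
    have eq: "fps_nth (exp_fps c) n = (\<Sum>i = 1..n. of_nat i * c i * fps_nth (exp_fps c) (n - i)) / of_nat n"
      for c using exp_fps_nth_rec[of n c] False by (simp add: field_simps)
    show ?thesis
      unfolding eq using assms less False by (intro tendsto_intros) auto
  qed simp
qed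

section \<open>Rescaling of the variable and linear factors\<close>

definition dilate :: "complex \<Rightarrow> complex fps \<Rightarrow> complex fps" where
  "dilate s F = Abs_fps (\<lambda>n. s ^ n * fps_nth F n)"

lemma dilate_nth [simp]: "fps_nth (dilate s F) n = s ^ n * fps_nth F n"
  by (simp add: dilate_def)

lemma dilate_compose: "dilate s F = F oo (fps_const s * fps_X)"
  by (simp add: dilate_def fps_compose_linear)

lemma dilate_mult: "dilate s (F * G) = dilate s F * dilate s G"
  unfolding dilate_compose by (rule fps_compose_mult_distrib) simp

lemma dilate_prod: "dilate s (prod F A) = (\<Prod>x\<in>A. dilate s (F x))"
  unfolding dilate_compose by (rule fps_compose_prod_distrib) simp

lemma dilate_exp_fps: "dilate s (exp_fps a) = exp_fps (\<lambda>n. s ^ n * a n)"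
proof -
  have "fps_nth (dilate s (exp_fps a)) n = 1 * fps_nth (exp_fps (\<lambda>n. s ^ n * a n)) n" for n
  proof (rule exp_fps_nth_uniqueI)
    fix n
    have "of_nat n * fps_nth (dilate s (exp_fps a)) n
      = (\<Sum>i = 1..n. s ^ n * (of_nat i * a i * fps_nth (exp_fps a) (n - i)))"
      using exp_fps_nth_rec[of n a] by (simp add: sum_distrib_left[symmetric])
    also have "\<dots> = (\<Sum>i = 1..n. of_nat i * (s ^ i * a i) * fps_nth (dilate s (exp_fps a)) (n - i))"
    proof (rule sum.cong[OF refl])
      fix i assume "i \<in> {1..n}"
      then have "s ^ n = s ^ i * s ^ (n - i)" by (simp flip: power_add)
      then show "s ^ n * (of_nat i * a i * fps_nth (exp_fps a) (n - i))
         = of_nat i * (s ^ i * a i) * fps_nth (dilate s (exp_fps a)) (n - i)"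
        by simp
    qed
    finally show "of_nat n * fps_nth (dilate s (exp_fps a)) n
      = (\<Sum>i = 1..n. of_nat i * (s ^ i * a i) * fps_nth (dilate s (exp_fps a)) (n - i))" .
  qed simp
  then show ?thesis by (intro fps_ext) simp
qed

definition lin :: "complex \<Rightarrow> complex fps" where
  "lin u = 1 - fps_const u * fps_X"

lemma lin_nth_0 [simp]: "fps_nth (lin u) 0 = 1"
  by (simp add: lin_def)

lemma lin_nonzero [simp]: "lin u \<noteq> 0"
  by (metis lin_nth_0 fps_zero_nth zero_neq_one)

lemma dilate_lin: "dilate s (lin u) = lin (u * s)"
  by (rule fps_ext) (simp add: lin_def fps_X_def)

lemma inverse_lin: "inverse (lin u) = Abs_fps (\<lambda>n. u ^ n)"
proof -
  have "lin u * Abs_fps (\<lambda>n. u ^ n) = 1"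
  proof (rule fps_ext)
    fix n show "fps_nth (lin u * Abs_fps (\<lambda>n. u ^ n)) n = fps_nth 1 n"
      by (cases n) (simp_all add: lin_def left_diff_distrib mult.assoc)
  qed
  then show ?thesis by (metis fps_inverse_unique)
qed

lemma dilate_inverse_lin: "dilate s (inverse (lin u)) = inverse (lin (u * s))"
  by (rule fps_ext) (simp add: inverse_lin power_mult_distrib mult.commute)

lemma lin_mult_inverse [simp]: "lin u * inverse (lin u) = 1"
  by (simp add: inverse_mult_eq_1')

lemma exp_fps_lin: "exp_fps (\<lambda>n. - (u ^ n) / of_nat n) = lin u"
proof (rule exp_fps_eqI[symmetric])
  have "lin u * (Abs_fps (\<lambda>n. u ^ n) * fps_const (- u)) = - fps_const u"
    by (simp add: mult.assoc[symmetric] flip: inverse_lin)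
  moreover have "Abs_fps (\<lambda>n. of_nat (Suc n) * (- (u ^ Suc n) / of_nat (Suc n)))
     = Abs_fps (\<lambda>n. u ^ n) * fps_const (- u)"
    by (rule fps_ext) (simp del: of_nat_Suc)
  ultimately show "fps_deriv (lin u) = lin u * Abs_fps (\<lambda>n. of_nat (Suc n) * (- (u ^ Suc n) / of_nat (Suc n)))"
    by (simp add: lin_def)
qed simp

lemma exp_fps_inverse_lin: "exp_fps (\<lambda>n. u ^ n / of_nat n) = inverse (lin u)"
  using exp_fps_minus[of "\<lambda>n. - (u ^ n) / of_nat n"] by (simp flip: exp_fps_lin)

text \<open>Termwise log (1 - u t) = - \<Sum> u^n t^n / n, so a difference of two finite power sums
  in the exponent gives a rational function.\<close>

lemma exp_fps_lin_ratio:
  assumes "finite A" "finite B"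
  shows "exp_fps (\<lambda>n. ((\<Sum>x\<in>A. u x ^ n) - (\<Sum>y\<in>B. w y ^ n)) / of_nat n)
    = (\<Prod>y\<in>B. lin (w y)) * (\<Prod>x\<in>A. inverse (lin (u x)))"
proof -
  have "exp_fps (\<lambda>n. ((\<Sum>x\<in>A. u x ^ n) - (\<Sum>y\<in>B. w y ^ n)) / of_nat n)
    = exp_fps (\<lambda>n. (\<Sum>x\<in>A. u x ^ n / of_nat n) + (\<Sum>y\<in>B. - (w y ^ n) / of_nat n))"
    by (simp add: diff_divide_distrib sum_divide_distrib sum_negf)
  also have "\<dots> = (\<Prod>x\<in>A. inverse (lin (u x))) * (\<Prod>y\<in>B. lin (w y))"
    by (simp only: exp_fps_add exp_fps_sum[OF assms(1)] exp_fps_sum[OF assms(2)]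
        exp_fps_lin exp_fps_inverse_lin)
  finally show ?thesis by (simp add: mult.commute)
qed

section \<open>Values at 1 of analytic continuations\<close>

text \<open>\<open>cval\<close> is a partial ring homomorphism from power series to numbers, which lets all
  regularized pairings be computed by algebra with formal power series.\<close>

definition cval :: "complex fps \<Rightarrow> complex \<Rightarrow> bool" where
  "cval F w \<longleftrightarrow> (\<exists>S f. finite S \<and> 0 \<notin> S \<and> 1 \<notin> S \<and> f holomorphic_on - S \<and>
     f has_fps_expansion F \<and> f 1 = w)"

lemma cvalI:
  assumes "finite S" "0 \<notin> S" "1 \<notin> S" "f holomorphic_on - S" "f has_fps_expansion F" "f 1 = w"
  shows "cval F w"
  using assms unfolding cval_def by blast

text \<open>Removing the finite exceptional set of \<open>f\<close> leaves \<open>U - S\<close> open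
  and connected, so the identity theorem compares \<open>f\<close> with any continuation
  \<open>g\<close> on any admissible domain. Poles between 0 and 1 thus never make the value depend
  on the path.\<close>

lemma cval_unique_aux:
  assumes "cval F w" "open U" "connected U" "0 \<in> U" "1 \<in> U" "g holomorphic_on U"
    "g has_fps_expansion F"
  shows "g 1 = w"
proof -
  obtain S f where f: "finite S" "0 \<notin> S" "1 \<notin> S" "f holomorphic_on - S"
    "f has_fps_expansion F" "f 1 = w"
    using assms(1) unfolding cval_def by blast
  have "(\<lambda>t. g t - f t) has_fps_expansion F - F"
    by (intro fps_expansion_intros assms f)
  then have "g 1 - f 1 = 0"
  proof (intro has_fps_expansion_0_analytic_continuation[of "\<lambda>t. g t - f t" "U - S"])
    show "(\<lambda>t. g t - f t) holomorphic_on U - S"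
      by (intro holomorphic_intros holomorphic_on_subset[OF assms(6)] holomorphic_on_subset[OF f(4)]) auto
    show "open (U - S)" using assms f by (simp add: open_Diff finite_imp_closed)
    show "connected (U - S)" using assms f by (simp add: connected_open_delete_finite)
  qed (use assms f in auto)
  then show ?thesis using f by simp
qed

lemma cval_continued_value:
  assumes "cval F w"
  shows "continued_value (fps_nth F) = w"
  unfolding continued_value_def
proof (rule the_equality)
  obtain S f where f: "finite S" "0 \<notin> S" "1 \<notin> S" "f holomorphic_on - S"
    "f has_fps_expansion F" "f 1 = w"
    using assms unfolding cval_def by blast
  have op: "open (- S)" using f by (simp add: finite_imp_closed open_Compl)
  obtain r where r: "r > 0" "ball 0 r \<subseteq> - S"
    using op f(2) by (meson ComplI open_contains_ball)
  have "\<forall>\<^sub>F t in nhds 0. (\<lambda>d. fps_nth F d * t ^ d) sums f t"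
  proof -
    have "\<forall>\<^sub>F t in nhds 0. t \<in> ball (0::complex) r"
      using r by (intro eventually_nhds_in_open) auto
    then show ?thesis
    proof eventually_elim
      case (elim t)
      have "f holomorphic_on eball 0 (ereal r)"
        using holomorphic_on_subset[OF f(4) r(2)] by simp
      then show ?case
        using elim by (intro has_fps_expansion_imp_sums_complex[OF f(5), of "ereal r"]) auto
    qed
  qed
  moreover have "connected (- S)"
    using f connected_open_delete_finite[of "UNIV::complex set" S]
    by (simp add: Compl_eq_Diff_UNIV connected_UNIV)
  ultimately show "\<exists>U G. open U \<and> connected U \<and> 0 \<in> U \<and> 1 \<in> U \<and> G holomorphic_on U \<and>
      (\<forall>\<^sub>F t in nhds 0. (\<lambda>d. fps_nth F d * t ^ d) sums G t) \<and> w = G 1"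
    using f op by (intro exI[of _ "- S"] exI[of _ f]) auto
next
  fix w' assume "\<exists>U G. open U \<and> connected U \<and> 0 \<in> U \<and> 1 \<in> U \<and> G holomorphic_on U \<and>
      (\<forall>\<^sub>F t in nhds 0. (\<lambda>d. fps_nth F d * t ^ d) sums G t) \<and> w' = G 1"
  then obtain U G where "open U" "connected U" "0 \<in> U" "1 \<in> U" "G holomorphic_on U"
    "\<forall>\<^sub>F t in nhds 0. (\<lambda>d. fps_nth F d * t ^ d) sums G t" "w' = G 1"
    by blast
  then show "w' = w"
    using cval_unique_aux[OF assms] has_fps_expansionI by metis
qed

lemma cval_unique: "cval F w \<Longrightarrow> cval F w' \<Longrightarrow> w = w'"
  using cval_continued_value by metis

lemma cval_entire: "f holomorphic_on UNIV \<Longrightarrow> f has_fps_expansion F \<Longrightarrow> cval F (f 1)"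
  by (rule cvalI[of "{}" f]) auto

lemma cval_const: "cval (fps_const c) c"
  using cval_entire[of "\<lambda>_. c" "fps_const c"] by simp

lemma cval_X: "cval fps_X 1"
  using cval_entire[OF holomorphic_on_ident has_fps_expansion_fps_X] .

lemma cval_add:
  assumes "cval F w" "cval G u" shows "cval (F + G) (w + u)"
proof -
  obtain S f where f: "finite S" "0 \<notin> S" "1 \<notin> S" "f holomorphic_on - S"
    "f has_fps_expansion F" "f 1 = w"
    using assms(1) unfolding cval_def by blast
  obtain T g where g: "finite T" "0 \<notin> T" "1 \<notin> T" "g holomorphic_on - T"
    "g has_fps_expansion G" "g 1 = u"
    using assms(2) unfolding cval_def by blast
  have "(\<lambda>t. f t + g t) holomorphic_on - (S \<union> T)"
    by (intro holomorphic_intros holomorphic_on_subset[OF f(4)] holomorphic_on_subset[OF g(4)]) auto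
  moreover have "(\<lambda>t. f t + g t) has_fps_expansion F + G"
    by (intro fps_expansion_intros f g)
  ultimately show ?thesis using f g by (intro cvalI[of "S \<union> T" "\<lambda>t. f t + g t"]) auto
qed

lemma cval_mult:
  assumes "cval F w" "cval G u" shows "cval (F * G) (w * u)"
proof -
  obtain S f where f: "finite S" "0 \<notin> S" "1 \<notin> S" "f holomorphic_on - S"
    "f has_fps_expansion F" "f 1 = w"
    using assms(1) unfolding cval_def by blast
  obtain T g where g: "finite T" "0 \<notin> T" "1 \<notin> T" "g holomorphic_on - T"
    "g has_fps_expansion G" "g 1 = u"
    using assms(2) unfolding cval_def by blast
  have "(\<lambda>t. f t * g t) holomorphic_on - (S \<union> T)"
    by (intro holomorphic_intros holomorphic_on_subset[OF f(4)] holomorphic_on_subset[OF g(4)]) auto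
  moreover have "(\<lambda>t. f t * g t) has_fps_expansion F * G"
    by (intro fps_expansion_intros f g)
  ultimately show ?thesis using f g by (intro cvalI[of "S \<union> T" "\<lambda>t. f t * g t"]) auto
qed

lemma cval_1: "cval 1 1"
  using cval_const[of 1] by simp

lemma cval_cmult: "cval F w \<Longrightarrow> cval (fps_const c * F) (c * w)"
  by (intro cval_mult cval_const)

lemma cval_diff: assumes "cval F w" "cval G u" shows "cval (F - G) (w - u)"
  using cval_add[OF assms(1) cval_cmult[OF assms(2), of "-1"]] by (simp flip: fps_const_neg)

lemma cval_sum: "(\<And>x. x \<in> A \<Longrightarrow> cval (F x) (w x)) \<Longrightarrow> cval (\<Sum>x\<in>A. F x) (\<Sum>x\<in>A. w x)"
  by (induction A rule: infinite_finite_induct) (use cval_const[of 0] in \<open>auto intro: cval_add\<close>)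

lemma cval_prod: "(\<And>x. x \<in> A \<Longrightarrow> cval (F x) (w x)) \<Longrightarrow> cval (\<Prod>x\<in>A. F x) (\<Prod>x\<in>A. w x)"
  by (induction A rule: infinite_finite_induct) (auto intro: cval_mult cval_1)

lemma cval_X_power: "cval F w \<Longrightarrow> cval (fps_X ^ n * F) w"
proof -
  assume F: "cval F w"
  have "cval (\<Prod>i<n. fps_X) (\<Prod>i<n. 1)" by (intro cval_prod cval_X)
  from cval_mult[OF this F] show ?thesis by simp
qed

text \<open>A polynomial is its own continuation. The terms cut off at the beginning of a current
  are evaluated in this way.\<close>

lemma cval_truncated: "cval (Abs_fps (\<lambda>n. if n < N then g n else 0)) (\<Sum>n<N. g n)"
proof -
  have "cval (\<Sum>n<N. fps_X ^ n * fps_const (g n)) (\<Sum>n<N. g n)"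
    by (intro cval_sum cval_X_power cval_const)
  moreover have "(\<Sum>n<N. fps_X ^ n * fps_const (g n)) = Abs_fps (\<lambda>n. if n < N then g n else 0)"
    by (rule fps_ext) (auto simp: fps_sum_nth fps_X_power_iff if_distrib if_distribR sum.delta cong: if_cong)
  ultimately show ?thesis by simp
qed

lemma cval_lin: "cval (lin u) (1 - u)"
  using cval_diff[OF cval_1 cval_cmult[OF cval_X, of u]] by (simp add: lin_def)

lemma cval_inverse_lin:
  assumes "u \<noteq> 1" shows "cval (inverse (lin u)) (1 / (1 - u))"
\<comment> \<open>For u = 0 there is no pole, and \<open>1 / u\<close> would be 0, which the
  exceptional set must not contain.\<close>
proof (rule cvalI[of "if u = 0 then {} else {1 / u}" "\<lambda>t. inverse (1 - u * t)"])
  show "(\<lambda>t. inverse (1 - u * t)) holomorphic_on - (if u = 0 then {} else {1 / u})"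
    by (intro holomorphic_intros) (auto simp: field_simps split: if_splits)
  have "(\<lambda>t. inverse (1 - u * t)) has_fps_expansion inverse (1 - fps_const u * fps_X)"
    by (intro fps_expansion_intros) auto
  then show "(\<lambda>t. inverse (1 - u * t)) has_fps_expansion inverse (lin u)"
    by (simp add: lin_def)
qed (use assms in \<open>auto simp: field_simps\<close>)

text \<open>Dividing the continuation by t leaves a removable singularity at 0. The negative modes
  of \<open>x_minus\<close> need this, since there the power of the regulator has to be cancelled
  rather than multiplied in.\<close>

lemma cval_fps_X_cancel:
  assumes "cval (fps_X * F) w" shows "cval F w"
proof -
  obtain S f where f: "finite S" "0 \<notin> S" "1 \<notin> S" "f holomorphic_on - S"
    "f has_fps_expansion fps_X * F" "f 1 = w"
    using assms(1) unfolding cval_def by blast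
  have f0: "f 0 = 0"
    using has_fps_expansion_imp_0_eq_fps_nth_0[OF f(5)] by simp
  have op: "open (- S)" using f by (simp add: finite_imp_closed open_Compl)
  have F0: "fps_nth F 0 = deriv f 0"
    using fps_nth_fps_expansion[OF f(5), of 1] by simp
  have "(\<lambda>z. if z = 0 then deriv f 0 else (f z - f 0) / (z - 0)) holomorphic_on - S"
    by (rule pole_lemma_open[OF f(4) op])
  then have *: "(\<lambda>z. if z = 0 then deriv f 0 else f z / z) holomorphic_on - S"
    unfolding f0 diff_zero .
  have "(\<lambda>x. if x = 0 then deriv f 0 else f x / x) has_fps_expansion F"
  \<comment> \<open>The rule for shifting an expansion asks for subdegree at least 1, and the zero
    series has subdegree 0.\<close>
  proof (cases "F = 0")
    case True
    have "\<forall>\<^sub>F t in nhds 0. f t = 0"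
      using f(5) True by (simp add: has_fps_expansion_0_iff)
    then have "\<forall>\<^sub>F t in nhds 0. (if t = 0 then deriv f 0 else f t / t) = 0"
      by eventually_elim (use F0 True in auto)
    then show ?thesis using True by (simp add: has_fps_expansion_0_iff)
  next
    case False
    have "(\<lambda>x. if x = 0 then deriv f 0 else f x / x ^ 1) has_fps_expansion fps_shift 1 (fps_X * F)"
      by (rule has_fps_expansion_shift[OF f(5)]) (use False F0 in \<open>simp_all add: subdegree_mult\<close>)
    moreover have "fps_shift 1 (fps_X * F) = F" by (rule fps_ext) simp
    ultimately show ?thesis by (simp only: power_one_right)
  qed
  with * show ?thesis
    using f by (intro cvalI[of S "\<lambda>x. if x = 0 then deriv f 0 else f x / x"]) auto
qed

section \<open>Infinite products of entire functions\<close>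

lemma has_fps_expansion_dilate:
  assumes "C has_fps_expansion F" shows "(\<lambda>t. C (t * s)) has_fps_expansion dilate s F"
proof -
  have "(\<lambda>t. s * t) has_fps_expansion fps_const s * fps_X"
    by (intro fps_expansion_intros)
  from has_fps_expansion_compose[OF assms this]
  show ?thesis by (simp add: o_def dilate_compose mult.commute)
qed

text \<open>The difference quotient of C at 0 extends to an entire function, which is bounded on a
  compact disc. The linear bound feeds the Weierstrass test for products of C (t s_i) with summable
  s_i.\<close>

lemma entire_minus_one_bound:
  fixes C :: "complex \<Rightarrow> complex"
  assumes "C holomorphic_on UNIV" "C 0 = 1"
  obtains K where "K \<ge> 0" "\<And>x. norm x \<le> R \<Longrightarrow> norm (C x - 1) \<le> K * norm x"
proof -
  define g where "g = (\<lambda>z. if z = 0 then deriv C 0 else (C z - C 0) / (z - 0))"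
  have g: "C x - 1 = g x * x" for x
    by (simp add: g_def assms)
  have "g holomorphic_on UNIV"
    unfolding g_def by (rule pole_lemma_open[OF assms(1) open_UNIV])
  then have "continuous_on (cball 0 R) g"
    by (rule holomorphic_on_imp_continuous_on[OF holomorphic_on_subset]) simp
  then have "bounded (g ` cball 0 R)"
    by (intro compact_imp_bounded compact_continuous_image compact_cball)
  then obtain K where K: "K > 0" "\<And>z. z \<in> cball 0 R \<Longrightarrow> norm (g z) \<le> K"
    unfolding bounded_pos by blast
  have "norm (C x - 1) \<le> K * norm x" if "norm x \<le> R" for x
    using K(2)[of x] that by (simp add: g norm_mult mult_right_mono)
  then show ?thesis using that[of K] K(1) by simp
qed

context
  fixes C :: "complex \<Rightarrow> complex" and s :: "nat \<Rightarrow> complex" and a :: "nat \<Rightarrow> complex"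
  assumes holo: "C holomorphic_on UNIV" and expn: "C has_fps_expansion exp_fps a"
    and summ: "summable (\<lambda>i. norm (s i))"
begin

lemma C_0: "C 0 = 1"
  using has_fps_expansion_imp_0_eq_fps_nth_0[OF expn] by simp

lemma s_le: "norm (s i) \<le> (\<Sum>i. norm (s i))"
  using sum_le_suminf[OF summ, of "{i}"] by simp

lemma scaled_factor_bound:
  obtains K where "K \<ge> 0" "\<And>t i. norm t \<le> R \<Longrightarrow> norm (C (t * s i) - 1) \<le> K * norm (s i)"
proof -
  define S where "S = (\<Sum>i. norm (s i))"
  obtain K where K: "K \<ge> 0" "\<And>x. norm x \<le> \<bar>R\<bar> * S \<Longrightarrow> norm (C x - 1) \<le> K * norm x"
    using entire_minus_one_bound[OF holo C_0] by blast
  have "norm (C (t * s i) - 1) \<le> (K * \<bar>R\<bar>) * norm (s i)" if "norm t \<le> R" for t i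
  proof -
    have *: "norm (t * s i) \<le> \<bar>R\<bar> * norm (s i)"
      using that by (auto simp: norm_mult intro!: mult_right_mono)
    also have "\<dots> \<le> \<bar>R\<bar> * S"
      using s_le by (auto simp: S_def intro: mult_left_mono)
    finally have "norm (C (t * s i) - 1) \<le> K * norm (t * s i)" by (rule K(2))
    also have "\<dots> \<le> K * (\<bar>R\<bar> * norm (s i))"
      by (intro mult_left_mono * K)
    finally show ?thesis by simp
  qed
  then show ?thesis using that[of "K * \<bar>R\<bar>"] K by simp
qed

lemma convergent_scaled_prod: "convergent_prod (\<lambda>i. C (t * s i))"
proof -
  obtain K where K: "\<And>u i. norm u \<le> norm t \<Longrightarrow> norm (C (u * s i) - 1) \<le> K * norm (s i)"
    using scaled_factor_bound[of "norm t"] by blast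
  have "summable (\<lambda>i. norm (C (t * s i) - 1))"
    by (rule summable_comparison_test'[OF summable_mult[OF summ, of K]]) (use K[of t] in auto)
  then show ?thesis
    by (intro abs_convergent_prod_imp_convergent_prod) (simp add: abs_convergent_prod_conv_summable)
qed

lemma scaled_prod_eq_0_iff: "(\<Prod>i. C (t * s i)) = 0 \<longleftrightarrow> (\<exists>i. C (t * s i) = 0)"
  using has_prod_eq_0_iff[OF convergent_prod_has_prod[OF convergent_scaled_prod[of t]]] by (auto simp: image_iff)

lemma uniform_limit_scaled_prod:
  "uniform_limit (cball 0 R) (\<lambda>N t. \<Prod>i<N. C (t * s i)) (\<lambda>t. \<Prod>i. C (t * s i)) sequentially"
proof -
  obtain K where K: "\<And>u i. norm u \<le> R \<Longrightarrow> norm (C (u * s i) - 1) \<le> K * norm (s i)"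
    using scaled_factor_bound[of R] by blast
  have "uniformly_convergent_on (cball 0 R) (\<lambda>N t. \<Prod>i<N. C (t * s i))"
  proof (rule uniformly_convergent_on_prod')
    show "uniformly_convergent_on (cball 0 R) (\<lambda>N t. \<Sum>n<N. norm (C (t * s n) - 1))"
      by (rule Weierstrass_m_test'[OF _ summable_mult[OF summ, of K]]) (use K in auto)
    show "continuous_on (cball 0 R) (\<lambda>t. C (t * s n))" for n
      by (intro holomorphic_on_imp_continuous_on holomorphic_on_compose_gen[OF _ holo, unfolded o_def]
          holomorphic_intros) auto
  qed auto
  then have "uniform_limit (cball 0 R) (\<lambda>N t. \<Prod>i<N. C (t * s i))
      (\<lambda>t. lim (\<lambda>N. \<Prod>i<N. C (t * s i))) sequentially"
    by (simp add: uniformly_convergent_uniform_limit_iff)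
  moreover have "lim (\<lambda>N. \<Prod>i<N. C (t * s i)) = (\<Prod>i. C (t * s i))" for t
    using convergent_prod_LIMSEQ[OF convergent_scaled_prod[of t]] LIMSEQ_lessThan_iff_atMost
    by (intro limI) blast
  ultimately show ?thesis by simp
qed

lemma scaled_prod_partial_holomorphic: "(\<lambda>t. \<Prod>i<N. C (t * s i)) holomorphic_on A"
  by (intro holomorphic_intros holomorphic_on_compose_gen[OF _ holo, unfolded o_def]) auto

lemma scaled_prod_holomorphic: "(\<lambda>t. \<Prod>i. C (t * s i)) holomorphic_on UNIV"
proof (rule holomorphic_uniform_sequence)
  fix x :: complex
  have "cball x 1 \<subseteq> cball 0 (norm x + 1)"
    by (auto simp: dist_norm) (smt (verit) norm_minus_commute norm_triangle_sub)
  then show "\<exists>d>0. cball x d \<subseteq> UNIV \<and>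
      uniform_limit (cball x d) (\<lambda>N t. \<Prod>i<N. C (t * s i)) (\<lambda>t. \<Prod>i. C (t * s i)) sequentially"
    using uniform_limit_scaled_prod by (intro exI[of _ 1]) (auto intro: uniform_limit_on_subset)
qed (auto intro: scaled_prod_partial_holomorphic)

text \<open>The partial products converge locally uniformly, so their Taylor coefficients converge,
  while in the exponent only the partial power sums of s vary; both limits are compared. The product
  is again entire with an exponential expansion, so the construction can be applied to its own
  result, which yields double products.\<close>

lemma scaled_prod_expansion:
  "(\<lambda>t. \<Prod>i. C (t * s i)) has_fps_expansion exp_fps (\<lambda>n. a n * (\<Sum>i. s i ^ n))"
proof -
  let ?P = "\<lambda>t. \<Prod>i. C (t * s i)" and ?PN = "\<lambda>N t. \<Prod>i<N. C (t * s i)"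
  have expand: "?P has_fps_expansion fps_expansion ?P 0"
    using scaled_prod_holomorphic by (intro has_fps_expansion_fps_expansion) auto
  have partial: "?PN N has_fps_expansion exp_fps (\<lambda>n. a n * (\<Sum>i<N. s i ^ n))" for N
  proof -
    have "?PN N has_fps_expansion (\<Prod>i<N. dilate (s i) (exp_fps a))"
      by (intro fps_expansion_intros has_fps_expansion_dilate expn)
    then show ?thesis
      by (simp add: dilate_exp_fps sum_distrib_left mult.commute flip: exp_fps_sum)
  qed
  have "fps_nth (fps_expansion ?P 0) n = fps_nth (exp_fps (\<lambda>n. a n * (\<Sum>i. s i ^ n))) n" for n
  proof (rule LIMSEQ_unique)
    have "(\<lambda>N. (deriv ^^ n) (?PN N) 0) \<longlonglongrightarrow> (deriv ^^ n) ?P 0"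
      by (rule higher_deriv_complex_uniform_limit[where A = "ball 0 1"])
        (auto intro: uniform_limit_on_subset[OF uniform_limit_scaled_prod[of 1]] always_eventually
          scaled_prod_partial_holomorphic)
    then have "(\<lambda>N. (deriv ^^ n) (?PN N) 0 / fact n) \<longlonglongrightarrow> (deriv ^^ n) ?P 0 / fact n"
      by (intro tendsto_intros) auto
    then show "(\<lambda>N. fps_nth (exp_fps (\<lambda>n. a n * (\<Sum>i<N. s i ^ n))) n)
        \<longlonglongrightarrow> fps_nth (fps_expansion ?P 0) n"
      by (simp add: fps_nth_fps_expansion[OF partial] fps_nth_fps_expansion[OF expand])
    show "(\<lambda>N. fps_nth (exp_fps (\<lambda>n. a n * (\<Sum>i<N. s i ^ n))) n)
        \<longlonglongrightarrow> fps_nth (exp_fps (\<lambda>n. a n * (\<Sum>i. s i ^ n))) n"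
    proof (intro tendsto_exp_fps_nth tendsto_mult_left summable_LIMSEQ)
      fix m :: nat assume "m > 0"
      \<comment> \<open>Eventually s i has norm below 1, so its positive powers are dominated by the
        summable sequence itself.\<close>
      have "eventually (\<lambda>i. norm (s i) < 1) sequentially"
        using summable_LIMSEQ_zero[OF summ] by (rule order_tendstoD) simp
      then have "eventually (\<lambda>i. norm (s i ^ m) \<le> norm (s i)) sequentially"
      proof eventually_elim
        case (elim i)
        then show ?case using \<open>m > 0\<close> power_decreasing[of 1 m "norm (s i)"] by (simp add: norm_power)
      qed
      then show "summable (\<lambda>i. s i ^ m)"
        by (rule summable_comparison_test_ev[OF _ summ])
    qed
  qed
  then have "fps_expansion ?P 0 = exp_fps (\<lambda>n. a n * (\<Sum>i. s i ^ n))" by (rule fps_ext)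
  with expand show ?thesis by simp
qed

end

section \<open>Fock space\<close>

lemma fock_degree_empty [simp]: "fock_degree {#} = 0"
  by (simp add: fock_degree_def)

lemma fock_degree_add [simp]: "fock_degree (add_mset i M) = Suc i + fock_degree M"
  by (simp add: fock_degree_def)

lemma fock_degree_remove: "i \<in># M \<Longrightarrow> fock_degree M = Suc i + fock_degree (M - {#i#})"
  by (metis fock_degree_add insert_DiffM)

text \<open>The left side is the eigenvalue of \<Sum> a_{-n} a_n on the basis vector M, the mode n =
  i + 1 contributing n times its multiplicity.\<close>

lemma fock_degree_count: "set_mset M \<subseteq> {..<d} \<Longrightarrow> (\<Sum>i<d. count M i * Suc i) = fock_degree M"
proof (induction M)
  case (add j M)
  have "(\<Sum>i<d. count (add_mset j M) i * Suc i) = (\<Sum>i<d. (if i = j then Suc i else 0) + count M i * Suc i)"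
    by (intro sum.cong) auto
  also have "\<dots> = Suc j + fock_degree M"
    using add by (simp only: sum.distrib) simp
  finally show ?case by simp
qed simp

lemma size_le_fock_degree: "size M \<le> fock_degree M"
  by (induction M) auto

lemma member_less_fock_degree: "i \<in># M \<Longrightarrow> i < fock_degree M"
  by (drule fock_degree_remove) simp

text \<open>Both the parts and their number are bounded by the degree. Without finiteness the sum in
  \<open>graded_pairing\<close> would take the default value 0.\<close>

lemma finite_fock_degree: "finite {M. fock_degree M = d}"
proof (rule finite_subset)
  show "{M. fock_degree M = d} \<subseteq> mset ` {xs. set xs \<subseteq> {..<d} \<and> length xs \<le> d}"
  proof
    fix M assume "M \<in> {M. fock_degree M = d}"
    moreover obtain xs where "mset xs = M" using ex_mset by blast
    ultimately show "M \<in> mset ` {xs. set xs \<subseteq> {..<d} \<and> length xs \<le> d}"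
      using size_le_fock_degree[of M] member_less_fock_degree[of _ M]
      by (intro image_eqI[of _ _ xs]) auto
  qed
qed (simp add: finite_lists_length_le)

lemma osc_creation:
  "osc (- int (Suc i)) f M = (if i \<in># M then f (M - {#i#}) else 0)"
proof -
  have "nat (- (- int (Suc i))) - 1 = i" by simp
  then show ?thesis unfolding osc_def Let_def by simp
qed

lemma osc_annihilation:
  "osc (int (Suc i)) f M = of_nat (Suc i) * of_nat (count M i + 1) * f (add_mset i M)"
proof -
  have "nat (int (Suc i)) - 1 = i" by simp
  then show ?thesis unfolding osc_def Let_def by simp
qed

lemma osc_scale: "osc n (\<lambda>M. c * f M) = (\<lambda>M. c * osc n f M)"
  by (rule ext) (simp add: osc_def Let_def)

section \<open>Coherent kets and bras in the multiset basis\<close>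

definition mset_fact :: "nat multiset \<Rightarrow> complex" where
  "mset_fact M = (\<Prod>i\<in>set_mset M. fact (count M i))"

lemma mset_fact_superset: "finite A \<Longrightarrow> set_mset M \<subseteq> A \<Longrightarrow> mset_fact M = (\<Prod>i\<in>A. fact (count M i))"
  unfolding mset_fact_def by (intro prod.mono_neutral_left) (auto simp: not_in_iff)

lemma mset_fact_add: "mset_fact (add_mset i M) = of_nat (count M i + 1) * mset_fact M"
proof -
  let ?A = "insert i (set_mset M)"
  have "mset_fact (add_mset i M) = fact (count M i + 1) * (\<Prod>j\<in>?A - {i}. fact (count M j))"
    by (subst mset_fact_superset[of ?A]) (auto simp: prod.remove[of ?A i] intro!: prod.cong)
  moreover have "mset_fact M = fact (count M i) * (\<Prod>j\<in>?A - {i}. fact (count M j))"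
    by (subst mset_fact_superset[of ?A]) (auto simp: prod.remove[of ?A i])
  ultimately show ?thesis by simp
qed

lemma mset_fact_nonzero [simp]: "mset_fact M \<noteq> 0"
  by (simp add: mset_fact_def)

text \<open>The coefficient of \<open>a\<^bsub>-n\<^sub>1\<^esub> \<cdots> a\<^bsub>-n\<^sub>k\<^esub>|0\<rangle>\<close> in \<open>exp (\<Sum>n>0. x (n - 1) a\<^bsub>-n\<^esub>)|0\<rangle>\<close>.\<close>

definition mset_weight :: "(nat \<Rightarrow> complex) \<Rightarrow> nat multiset \<Rightarrow> complex" where
  "mset_weight x M = (\<Prod>i\<in>#M. x i) / mset_fact M"

lemma mset_weight_add: "of_nat (count M i + 1) * mset_weight x (add_mset i M) = x i * mset_weight x M"
proof -
  have "of_nat (count M i + 1) \<noteq> (0::complex)" by (metis add_is_0 of_nat_eq_0_iff one_neq_zero)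
  then show ?thesis
    unfolding mset_weight_def mset_fact_add by (simp del: of_nat_add)
qed

lemma mset_weight_remove:
  assumes "i \<in># M" shows "x i * mset_weight x (M - {#i#}) = of_nat (count M i) * mset_weight x M"
  using mset_weight_add[of "M - {#i#}" i x] assms by (simp add: Suc_le_eq)

lemma mset_weight_sum:
  assumes "set_mset M \<subseteq> {..<m}"
  shows "(\<Sum>i<m. x i * (if i \<in># M then mset_weight x (M - {#i#}) else 0)) = of_nat (size M) * mset_weight x M"
proof -
  have "(\<Sum>i<m. x i * (if i \<in># M then mset_weight x (M - {#i#}) else 0))
      = (\<Sum>i<m. of_nat (count M i) * mset_weight x M)"
    by (intro sum.cong) (auto simp: mset_weight_remove not_in_iff)
  also have "\<dots> = of_nat (\<Sum>i<m. count M i) * mset_weight x M"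
    by (simp add: sum_distrib_right)
  also have "(\<Sum>i<m. count M i) = size M"
    unfolding size_multiset_overloaded_eq using assms
    by (intro sum.mono_neutral_right) (auto simp: not_in_iff)
  finally show ?thesis .
qed

text \<open>A multiset of size k arises from k! / \<open>mset_fact M\<close> orderings of its parts.
  In the induction the last operator removes one part, and the multiplicities of the candidates add
  up to the size. The shift \<open>n - 1\<close> reflects that the part n is stored as n -
  1.\<close>

lemma op_power_creation_vacuum:
  "op_power (\<lambda>n f K. x (n - 1) * osc (- int n) f K) k m vacuum M =
     (if fock_degree M = m \<and> size M = k then fact k * mset_weight x M else 0)"
proof (induction k arbitrary: m M)
  case 0
  then show ?case
    by (auto simp: vacuum_def basis_ket_def mset_weight_def mset_fact_def)
next
  case (Suc k)
  let ?A = "\<lambda>n f K. x (n - 1) * osc (- int n) f K"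
  have "op_power ?A (Suc k) m vacuum M
    = (\<Sum>i<m. x i * osc (- int (Suc i)) (op_power ?A k (m - Suc i) vacuum) M)"
    unfolding op_power.simps
    by (rule sum.reindex_bij_witness[of _ Suc "\<lambda>n. n - 1"]) auto
  also have "\<dots> = (\<Sum>i<m. x i * (if i \<in># M then
      (if fock_degree M = m \<and> size M = Suc k then fact k * mset_weight x (M - {#i#}) else 0) else 0))"
  proof (intro sum.cong refl)
    fix i assume "i \<in> {..<m}"
    then have "i \<in># M \<Longrightarrow> fock_degree (M - {#i#}) = m - Suc i \<longleftrightarrow> fock_degree M = m"
      using fock_degree_remove[of i M] by auto
    moreover have "i \<in># M \<Longrightarrow> size (M - {#i#}) = k \<longleftrightarrow> size M = Suc k"
      by (metis Suc_inject insert_DiffM size_add_mset)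
    ultimately show "x i * osc (- int (Suc i)) (op_power ?A k (m - Suc i) vacuum) M
      = x i * (if i \<in># M then
      (if fock_degree M = m \<and> size M = Suc k then fact k * mset_weight x (M - {#i#}) else 0) else 0)"
      unfolding osc_creation Suc.IH by auto
  qed
  also have "\<dots> = (if fock_degree M = m \<and> size M = Suc k then
      fact k * (\<Sum>i<m. x i * (if i \<in># M then mset_weight x (M - {#i#}) else 0)) else 0)"
    by (cases "fock_degree M = m \<and> size M = Suc k")
       (simp_all only: sum_distrib_left if_True if_False if_cancel mult_zero_right sum.neutral_const,
        auto intro!: sum.cong)
  also have "\<dots> = (if fock_degree M = m \<and> size M = Suc k then fact (Suc k) * mset_weight x M else 0)"
  proof (intro if_cong refl)
    assume a: "fock_degree M = m \<and> size M = Suc k"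
    then have "set_mset M \<subseteq> {..<m}" using member_less_fock_degree[of _ M] by auto
    then show "fact k * (\<Sum>i<m. x i * (if i \<in># M then mset_weight x (M - {#i#}) else 0))
       = fact (Suc k) * mset_weight x M"
      using a by (simp add: mset_weight_sum)
  qed
  finally show ?case .
qed

lemma op_exp_creation_vacuum:
  "op_exp (\<lambda>n f K. x (n - 1) * osc (- int n) f K) m vacuum M =
     (if fock_degree M = m then mset_weight x M else 0)"
proof -
  have "op_exp (\<lambda>n f K. x (n - 1) * osc (- int n) f K) m vacuum M
    = (\<Sum>k\<le>m. if k = size M then (if fock_degree M = m then mset_weight x M else 0) else 0)"
    unfolding op_exp_def op_power_creation_vacuum by (intro sum.cong) auto
  then show ?thesis
    using size_le_fock_degree[of M] by auto
qed

text \<open>Only K = {#} is wanted in the end, but the induction passes through all submultisets of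
  M. The factor \<open>mset_fact K\<close> on the left absorbs the multiplicities produced by the
  annihilators, so that no division by them occurs.\<close>

lemma op_power_annihilation_basis:
  "mset_fact K * op_power (\<lambda>n f K. p n / of_nat n * osc (int n) f K) k m (basis_ket M) K =
     (if K \<subseteq># M \<and> fock_degree M = m + fock_degree K \<and> size M = k + size K
      then fact k * mset_weight (\<lambda>i. p (Suc i)) (M - K) * mset_fact M else 0)"
proof (induction k arbitrary: m K)
  case 0
  have "K \<subseteq># M \<Longrightarrow> size M = size K \<Longrightarrow> K = M"
    by (metis mset_subset_size nless_le subset_mset.nless_le)
  then show ?case
    by (auto simp: basis_ket_def mset_weight_def mset_fact_def)
next
  case (Suc k)
  let ?A = "\<lambda>n f K. p n / of_nat n * osc (int n) f K"
  let ?C = "K \<subseteq># M \<and> fock_degree M = m + fock_degree K \<and> size M = Suc k + size K"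
  let ?x = "\<lambda>i. p (Suc i)"
  have "mset_fact K * op_power ?A (Suc k) m (basis_ket M) K
    = (\<Sum>i<m. ?x i * (mset_fact (add_mset i K) * op_power ?A k (m - Suc i) (basis_ket M) (add_mset i K)))"
    unfolding op_power.simps sum_distrib_left osc_annihilation
    by (rule sum.reindex_bij_witness[of _ Suc "\<lambda>n. n - 1"])
       (auto simp: mset_fact_add osc_def Let_def field_simps simp del: of_nat_Suc)
  also have "\<dots> = (\<Sum>i<m. ?x i * (if i \<in># M - K then
      (if ?C then fact k * mset_weight ?x (M - K - {#i#}) * mset_fact M else 0) else 0))"
  proof (intro sum.cong refl)
    fix i assume "i \<in> {..<m}"
    moreover have "add_mset i K \<subseteq># M \<longleftrightarrow> K \<subseteq># M \<and> i \<in># M - K"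
    proof
      assume "add_mset i K \<subseteq># M"
      then have "count (add_mset i K) j \<le> count M j" for j by (simp add: subseteq_mset_def)
      from this this[of i] show "K \<subseteq># M \<and> i \<in># M - K"
        by (auto simp: subseteq_mset_def in_diff_count Suc_le_eq)
           (metis Suc_leD)
    next
      assume "K \<subseteq># M \<and> i \<in># M - K"
      then show "add_mset i K \<subseteq># M"
        by (auto simp: subseteq_mset_def in_diff_count Suc_le_eq)
    qed
    ultimately show "?x i * (mset_fact (add_mset i K) * op_power ?A k (m - Suc i) (basis_ket M) (add_mset i K))
      = ?x i * (if i \<in># M - K then
      (if ?C then fact k * mset_weight ?x (M - K - {#i#}) * mset_fact M else 0) else 0)"
      unfolding Suc.IH by auto
  qed
  also have "\<dots> = (if ?C then
      fact k * mset_fact M * (\<Sum>i<m. ?x i * (if i \<in># M - K then mset_weight ?x (M - K - {#i#}) else 0)) else 0)"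
    by (cases "?C")
       (simp_all only: sum_distrib_left if_True if_False if_cancel mult_zero_right sum.neutral_const,
        auto intro!: sum.cong)
  also have "\<dots> = (if ?C
      then fact (Suc k) * mset_weight ?x (M - K) * mset_fact M else 0)"
  proof (intro if_cong refl)
    assume a: "?C"
    have "fock_degree M = fock_degree (M - K) + fock_degree K"
      using a by (metis fock_degree_def image_mset_union subset_mset.diff_add sum_mset.union)
    then have "set_mset (M - K) \<subseteq> {..<m}"
      using member_less_fock_degree[of _ "M - K"] a by auto
    moreover have "size (M - K) = Suc k" using a by (simp add: size_Diff_submset)
    ultimately show "fact k * mset_fact M * (\<Sum>i<m. ?x i * (if i \<in># M - K then mset_weight ?x (M - K - {#i#}) else 0))
       = fact (Suc k) * mset_weight ?x (M - K) * mset_fact M"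
      by (simp add: mset_weight_sum)
  qed
  finally show ?case .
qed

text \<open>At K = {#} the symmetry factor inside \<open>mset_weight\<close> cancels against
  \<open>mset_fact M\<close>. A coherent bra is therefore multiplicative in M, which makes it a left
  eigenvector of the creation operators.\<close>

lemma op_exp_annihilation_basis:
  "dual_vacuum (op_exp (\<lambda>n f K. p n / of_nat n * osc (int n) f K) m (basis_ket M)) =
     (if fock_degree M = m then (\<Prod>i\<in>#M. p (Suc i)) else 0)"
proof -
  have "op_power (\<lambda>n f K. p n / of_nat n * osc (int n) f K) k m (basis_ket M) {#} / fact k
    = (if k = size M then (if fock_degree M = m then (\<Prod>i\<in>#M. p (Suc i)) else 0) else 0)" for k
    using op_power_annihilation_basis[of "{#}" p k m M]
    by (auto simp: mset_weight_def mset_fact_def[of "{#}"])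
  then show ?thesis
    using size_le_fock_degree[of M] unfolding dual_vacuum_def op_exp_def by auto
qed

lemma S_ket_weight:
  "S_ket q \<Lambda> M = norm_ket q \<Lambda> * mset_weight (\<lambda>i. - power_sum (Suc i) (col_spec q \<Lambda>) / of_nat (Suc i)) M"
proof -
  let ?p = "\<lambda>n. power_sum n (col_spec q \<Lambda>)"
  let ?x = "\<lambda>i. - ?p (Suc i) / of_nat (Suc i)"
  have *: "op_power (\<lambda>n f K. - (?p n / of_nat n) * osc (- int n) f K) k m g
     = op_power (\<lambda>n f K. ?x (n - 1) * osc (- int n) f K) k m g" for k m g
    by (induction k arbitrary: m) auto
  have "op_exp (\<lambda>n f K. - (?p n / of_nat n) * osc (- int n) f K) m vacuum M
     = (if m = fock_degree M then mset_weight ?x M else 0)" for m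
    using op_exp_creation_vacuum[of ?x m M] unfolding op_exp_def * by auto
  moreover have "(\<Sum>m. if m = fock_degree M then mset_weight ?x M else 0) = mset_weight ?x M"
    using sums_unique[OF sums_single[of "fock_degree M" "\<lambda>_. mset_weight ?x M"]] by simp
  ultimately show ?thesis
    unfolding S_ket_def by (simp only:)
qed

lemma S_bra_prod: "S_bra q \<Lambda> M = norm_bra q \<Lambda> * (\<Prod>i\<in>#M. power_sum (Suc i) (row_spec q \<Lambda>))"
proof -
  have "(\<Sum>m. if fock_degree M = m then (\<Prod>i\<in>#M. power_sum (Suc i) (row_spec q \<Lambda>)) else 0)
    = (\<Prod>i\<in>#M. power_sum (Suc i) (row_spec q \<Lambda>))"
    using sums_unique[OF sums_single[of "fock_degree M" "\<lambda>_. \<Prod>i\<in>#M. power_sum (Suc i) (row_spec q \<Lambda>)"]]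
    by (simp add: eq_commute)
  then show ?thesis
    unfolding S_bra_def op_exp_annihilation_basis by (simp only:)
qed

lemma S_ket_empty: "S_ket q \<Lambda> {#} = norm_ket q \<Lambda>"
  by (simp add: S_ket_weight mset_weight_def mset_fact_def)

lemma S_bra_empty: "S_bra q \<Lambda> {#} = norm_bra q \<Lambda>"
  by (simp add: S_bra_prod)

lemma S_bra_add: "S_bra q \<Lambda> (add_mset i M) = power_sum (Suc i) (row_spec q \<Lambda>) * S_bra q \<Lambda> M"
  by (simp add: S_bra_prod)

text \<open>A coherent ket is an eigenvector of every annihilator: a_n is n times a derivative, and
  the factor n cancels the 1/n in the exponent.\<close>

lemma osc_S_ket:
  assumes "n > 0"
  shows "osc (int n) (S_ket q \<Lambda>) = (\<lambda>M. - power_sum n (col_spec q \<Lambda>) * S_ket q \<Lambda> M)"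
proof
  fix M
  obtain i where n: "n = Suc i" using assms gr0_implies_Suc by blast
  let ?x = "\<lambda>i. - power_sum (Suc i) (col_spec q \<Lambda>) / of_nat (Suc i)"
  have "osc (int n) (S_ket q \<Lambda>) M
    = of_nat (Suc i) * norm_ket q \<Lambda> * (of_nat (count M i + 1) * mset_weight ?x (add_mset i M))"
    unfolding n osc_annihilation S_ket_weight by simp
  also have "\<dots> = - power_sum n (col_spec q \<Lambda>) * S_ket q \<Lambda> M"
    unfolding mset_weight_add by (simp add: n S_ket_weight del: of_nat_Suc)
  finally show "osc (int n) (S_ket q \<Lambda>) M = - power_sum n (col_spec q \<Lambda>) * S_ket q \<Lambda> M" .
qed

subsection \<open>Vertex operators between coherent states\<close>

lemma exp_fps_nth: "fps_nth (exp_fps a) m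
   = (\<Sum>k\<le>m. fps_nth (Abs_fps (\<lambda>n. if n = 0 then 0 else a n) ^ k) m / fact k)"
  by (simp add: exp_fps_def fps_compose_nth atLeast0AtMost)

lemma fps_nth_power_Suc_no_constant:
  "fps_nth (Abs_fps (\<lambda>n. if n = 0 then 0 else a n :: complex) ^ Suc k) m
   = (\<Sum>n = 1..m. a n * fps_nth (Abs_fps (\<lambda>n. if n = 0 then 0 else a n) ^ k) (m - n))"
  unfolding power_Suc fps_mult_nth
  by (intro sum.mono_neutral_cong_right) auto

lemma op_power_eigenvector:
  assumes "\<And>n. n > 0 \<Longrightarrow> osc (int n) f = (\<lambda>M. \<sigma> n * f M)"
  shows "op_power (\<lambda>n. scaled_osc c (int n)) k m f
    = (\<lambda>M. fps_nth (Abs_fps (\<lambda>n. if n = 0 then 0 else c (int n) * \<sigma> n) ^ k) m * f M)"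
proof (induction k arbitrary: m)
  case (Suc k)
  show ?case
  proof
    fix M
    have "op_power (\<lambda>n. scaled_osc c (int n)) (Suc k) m f M
      = (\<Sum>n = 1..m. c (int n) * \<sigma> n * fps_nth (Abs_fps (\<lambda>n. if n = 0 then 0 else c (int n) * \<sigma> n) ^ k) (m - n)) * f M"
      unfolding op_power.simps Suc.IH scaled_osc_def osc_scale sum_distrib_right
      by (intro sum.cong) (auto simp: assms)
    then show "op_power (\<lambda>n. scaled_osc c (int n)) (Suc k) m f M
      = fps_nth (Abs_fps (\<lambda>n. if n = 0 then 0 else c (int n) * \<sigma> n) ^ Suc k) m * f M"
      by (simp only: fps_nth_power_Suc_no_constant)
  qed
qed auto

lemma op_exp_eigenvector:
  assumes "\<And>n. n > 0 \<Longrightarrow> osc (int n) f = (\<lambda>M. \<sigma> n * f M)"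
  shows "op_exp (\<lambda>n. scaled_osc c (int n)) m f
    = (\<lambda>M. fps_nth (exp_fps (\<lambda>n. c (int n) * \<sigma> n)) m * f M)"
  by (rule ext) (simp add: op_exp_def op_power_eigenvector[OF assms] exp_fps_nth sum_distrib_right)

lemma op_exp_creation_scale:
  "op_exp (\<lambda>n. scaled_osc b (- int n)) m (\<lambda>M. c * f M) = (\<lambda>M. c * op_exp (\<lambda>n. scaled_osc b (- int n)) m f M)"
proof -
  have "op_power (\<lambda>n. scaled_osc b (- int n)) k m (\<lambda>M. c * f M)
     = (\<lambda>M. c * op_power (\<lambda>n. scaled_osc b (- int n)) k m f M)" for k
  proof (induction k arbitrary: m)
    case (Suc k)
    show ?case
    proof
      fix M
      show "op_power (\<lambda>n. scaled_osc b (- int n)) (Suc k) m (\<lambda>M. c * f M) M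
        = c * op_power (\<lambda>n. scaled_osc b (- int n)) (Suc k) m f M"
        unfolding op_power.simps Suc.IH sum_distrib_left
        by (simp add: scaled_osc_def osc_scale mult_ac)
    qed
  qed auto
  then show ?thesis unfolding op_exp_def by (simp add: sum_distrib_left)
qed

text \<open>The coefficient of w^m creates degree m, so nothing of lower degree is reached. This
  makes the series in \<open>vertex_coeff\<close> finite at each basis vector.\<close>

lemma op_exp_creation_eq_0:
  assumes "fock_degree M < m" shows "op_exp (\<lambda>n. scaled_osc c (- int n)) m f M = 0"
proof -
  have "op_power (\<lambda>n. scaled_osc c (- int n)) k m f M = 0" if "fock_degree M < m" for k m M
    using that
  proof (induction k arbitrary: m M)
    case (Suc k)
    have "scaled_osc c (- int n) (op_power (\<lambda>n. scaled_osc c (- int n)) k (m - n) f) M = 0"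
      if n: "n \<in> {1..m}" for n
    proof -
      obtain i where i: "n = Suc i" using n by (cases n) auto
      show ?thesis
        using Suc.prems n i fock_degree_remove[of i M]
        by (auto simp: scaled_osc_def osc_creation simp del: of_nat_Suc intro!: Suc.IH)
    qed
    then show ?case by simp
  qed auto
  then show ?thesis using assms by (simp add: op_exp_def)
qed

lemma graded_pairing_scale: "graded_pairing \<phi> (\<lambda>M. c * f M) d = c * graded_pairing \<phi> f d"
  by (simp add: graded_pairing_def sum_distrib_left mult_ac)

lemma graded_pairing_sum: "graded_pairing \<phi> (\<lambda>M. \<Sum>x\<in>A. f x M) d = (\<Sum>x\<in>A. graded_pairing \<phi> (f x) d)"
  unfolding graded_pairing_def sum_distrib_left by (rule sum.swap)

section \<open>Left eigenvectors of the creation operators paired with coherent kets\<close>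

context
  fixes \<phi> :: bra and \<rho> :: "nat \<Rightarrow> complex"
  assumes bra_add: "\<And>i M. \<phi> (add_mset i M) = \<rho> (Suc i) * \<phi> M"
begin

lemma graded_pairing_creation:
  assumes "n > 0"
  shows "graded_pairing \<phi> (osc (- int n) f) d = (if n \<le> d then \<rho> n * graded_pairing \<phi> f (d - n) else 0)"
proof -
  obtain i where n: "n = Suc i" using assms gr0_implies_Suc by blast
  have "graded_pairing \<phi> (osc (- int n) f) d = (\<Sum>M | fock_degree M = d \<and> i \<in># M. \<phi> M * f (M - {#i#}))"
    unfolding graded_pairing_def n osc_creation
    by (rule sum.mono_neutral_cong_right) (auto simp: finite_fock_degree)
  also have "\<dots> = (\<Sum>M | fock_degree M + Suc i = d. \<phi> (add_mset i M) * f M)"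
    by (rule sum.reindex_bij_witness[of _ "add_mset i" "\<lambda>M. M - {#i#}"])
       (use fock_degree_remove[of i] in auto)
  also have "\<dots> = (if n \<le> d then \<rho> n * graded_pairing \<phi> f (d - n) else 0)"
  proof (cases "n \<le> d")
    case True
    then have "{M. fock_degree M + Suc i = d} = {M. fock_degree M = d - n}" using n by auto
    then show ?thesis using True n
      by (simp add: bra_add graded_pairing_def sum_distrib_left mult_ac)
  next
    case False
    then have "{M. fock_degree M + Suc i = d} = {}" using n by auto
    then show ?thesis using False by (simp only: sum.empty if_False)
  qed
  finally show ?thesis .
qed

text \<open>Creation operators act to the left as scalars, and each lowers the degree at which bra
  and ket still have to be paired.\<close>

lemma graded_pairing_op_exp_creation:
  "graded_pairing \<phi> (op_exp (\<lambda>n. scaled_osc c (- int n)) m f) d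
    = (if m \<le> d then fps_nth (exp_fps (\<lambda>n. c (- int n) * \<rho> n)) m * graded_pairing \<phi> f (d - m) else 0)"
proof -
  let ?F = "Abs_fps (\<lambda>n. if n = 0 then 0 else c (- int n) * \<rho> n)"
  have "graded_pairing \<phi> (op_power (\<lambda>n. scaled_osc c (- int n)) k m f) d
    = (if m \<le> d then fps_nth (?F ^ k) m * graded_pairing \<phi> f (d - m) else 0)" for k
  proof (induction k arbitrary: m d)
    case 0
    then show ?case by (auto simp: graded_pairing_def)
  next
    case (Suc k)
    have "graded_pairing \<phi> (op_power (\<lambda>n. scaled_osc c (- int n)) (Suc k) m f) d
      = (\<Sum>n=1..m. c (- int n) * graded_pairing \<phi> (osc (- int n) (op_power (\<lambda>n. scaled_osc c (- int n)) k (m - n) f)) d)"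
      unfolding op_power.simps graded_pairing_sum scaled_osc_def graded_pairing_scale ..
    also have "\<dots> = (\<Sum>n=1..m. if m \<le> d then c (- int n) * \<rho> n * fps_nth (?F ^ k) (m - n) * graded_pairing \<phi> f (d - m) else 0)"
    proof (intro sum.cong refl)
      fix n assume n: "n \<in> {1..m}"
      then have "n > 0" "m - n \<le> d - n \<and> n \<le> d \<longleftrightarrow> m \<le> d" "m \<le> d \<Longrightarrow> d - n - (m - n) = d - m" by auto
      then show "c (- int n) * graded_pairing \<phi> (osc (- int n) (op_power (\<lambda>n. scaled_osc c (- int n)) k (m - n) f)) d
       = (if m \<le> d then c (- int n) * \<rho> n * fps_nth (?F ^ k) (m - n) * graded_pairing \<phi> f (d - m) else 0)"
        by (auto simp only: graded_pairing_creation Suc.IH split: if_splits) auto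
    qed
    also have "\<dots> = (if m \<le> d then fps_nth (?F ^ Suc k) m * graded_pairing \<phi> f (d - m) else 0)"
      by (simp add: fps_nth_power_Suc_no_constant sum_distrib_right del: power_Suc)
    finally show ?case .
  qed
  then show ?thesis
    unfolding op_exp_def using graded_pairing_scale[of \<phi> "1 / fact k" for k]
    by (simp add: graded_pairing_sum exp_fps_nth sum_distrib_right)
qed

context
  fixes f :: ket and \<sigma> :: "nat \<Rightarrow> complex"
  assumes ket_eigen: "\<And>n. n > 0 \<Longrightarrow> osc (int n) f = (\<lambda>M. \<sigma> n * f M)"
begin

text \<open>The degree operator \<Sum> a_{-n} a_n acts on both sides by scalars: a_n on the ket,
  a_{-n} on the bra. This gives the recursion of an exponential, so that
  \<langle>\<phi>|t^L|f\<rangle> is a multiple of exp (\<Sum> \<rho>_n \<sigma>_n t^n / n).\<close>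

lemma graded_pairing_coherent:
  "graded_pairing \<phi> f d = \<phi> {#} * f {#} * fps_nth (exp_fps (\<lambda>n. \<rho> n * \<sigma> n / of_nat n)) d"
proof (rule exp_fps_nth_uniqueI)
  have "{M. fock_degree M = 0} = {{#}}"
  proof -
    have "M = {#}" if "fock_degree M = 0" for M
      using size_le_fock_degree[of M] that by simp
    then show ?thesis by auto
  qed
  then show "graded_pairing \<phi> f 0 = \<phi> {#} * f {#}" by (simp add: graded_pairing_def)
next
  fix d
  have "(\<Sum>n = 1..d. osc (- int n) (osc (int n) f) M) = of_nat d * f M" if "fock_degree M = d" for M
  proof -
    have "(\<Sum>n = 1..d. osc (- int n) (osc (int n) f) M) = (\<Sum>i<d. of_nat (count M i * Suc i) * f M)"
    proof (rule sum.reindex_bij_witness[of _ Suc "\<lambda>n. n - 1"])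
      fix n assume "n \<in> {1..d}"
      then obtain i where i: "n = Suc i" by (cases n) auto
      show "of_nat (count M (n - 1) * Suc (n - 1)) * f M = osc (- int n) (osc (int n) f) M"
        unfolding i osc_creation osc_annihilation
        by (auto simp: not_in_iff Suc_le_eq algebra_simps)
    qed auto
    also have "\<dots> = of_nat (\<Sum>i<d. count M i * Suc i) * f M" by (simp add: sum_distrib_right)
    also have "(\<Sum>i<d. count M i * Suc i) = d"
      using fock_degree_count[of M d] member_less_fock_degree[of _ M] that by auto
    finally show ?thesis .
  qed
  then have "of_nat d * graded_pairing \<phi> f d = graded_pairing \<phi> (\<lambda>M. \<Sum>n = 1..d. osc (- int n) (osc (int n) f) M) d"
    by (subst graded_pairing_scale[symmetric], unfold graded_pairing_def, intro sum.cong) auto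
  also have "\<dots> = (\<Sum>n = 1..d. of_nat n * (\<rho> n * \<sigma> n / of_nat n) * graded_pairing \<phi> f (d - n))"
    unfolding graded_pairing_sum
    by (intro sum.cong) (auto simp: graded_pairing_creation ket_eigen graded_pairing_scale)
  finally show "of_nat d * graded_pairing \<phi> f d =
    (\<Sum>n = 1..d. of_nat n * (\<rho> n * \<sigma> n / of_nat n) * graded_pairing \<phi> f (d - n))" .
qed

lemma vertex_coeff_coherent:
  assumes "fock_degree M \<le> d"
  shows "vertex_coeff c k f M = (\<Sum>j\<in>{j. j \<le> d \<and> k \<le> int j}.
    fps_nth (exp_fps (\<lambda>n. c (int n) * \<sigma> n)) (nat (int j - k)) * op_exp (\<lambda>n. scaled_osc c (- int n)) j f M)"
proof -
  let ?A = "\<lambda>m. fps_nth (exp_fps (\<lambda>n. c (int n) * \<sigma> n)) m"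
  let ?g = "\<lambda>m. if k + int m < 0 then 0 else ?A m * op_exp (\<lambda>n. scaled_osc c (- int n)) (nat (k + int m)) f M"
  have "vertex_coeff c k f M = (\<Sum>m. ?g m)"
    unfolding vertex_coeff_def
    by (intro arg_cong[where f = suminf] ext)
      (simp add: op_exp_eigenvector[OF ket_eigen] op_exp_creation_scale)
  \<comment> \<open>Here k + m is the degree created, which must lie between 0 and d; it becomes the
    new index j below.\<close>
  also have "\<dots> = (\<Sum>m\<in>{m. 0 \<le> k + int m \<and> k + int m \<le> int d}. ?g m)"
  proof (rule suminf_finite)
    have "{m. 0 \<le> k + int m \<and> k + int m \<le> int d} \<subseteq> {..nat (int d - k)}" by auto
    then show "finite {m. 0 \<le> k + int m \<and> k + int m \<le> int d}" by (rule finite_subset) simp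
  qed (use assms in \<open>auto simp: op_exp_creation_eq_0\<close>)
  also have "\<dots> = (\<Sum>j\<in>{j. j \<le> d \<and> k \<le> int j}. ?A (nat (int j - k)) * op_exp (\<lambda>n. scaled_osc c (- int n)) j f M)"
    by (rule sum.reindex_bij_witness[of _ "\<lambda>j. nat (int j - k)" "\<lambda>m. nat (k + int m)"]) auto
  finally show ?thesis .
qed

text \<open>Annihilators act on the ket and creators on the bra as scalars, and normal ordering
  leaves no commutator behind. The regulator stands to the left of the current, so it records the
  created degree j as t^j but not the annihilated degree j - k.\<close>

lemma graded_pairing_vertex_coeff:
  "graded_pairing \<phi> (vertex_coeff c k f) d = fps_nth
     (fps_const (\<phi> {#} * f {#}) * exp_fps (\<lambda>n. \<rho> n * \<sigma> n / of_nat n) *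
      Abs_fps (\<lambda>j. if k \<le> int j then fps_nth (exp_fps (\<lambda>n. c (int n) * \<sigma> n)) (nat (int j - k)) *
         fps_nth (exp_fps (\<lambda>n. c (- int n) * \<rho> n)) j else 0)) d"
proof -
  let ?A = "\<lambda>m. fps_nth (exp_fps (\<lambda>n. c (int n) * \<sigma> n)) m"
  let ?B = "\<lambda>j. fps_nth (exp_fps (\<lambda>n. c (- int n) * \<rho> n)) j"
  have "graded_pairing \<phi> (vertex_coeff c k f) d = graded_pairing \<phi> (\<lambda>M. \<Sum>j\<in>{j. j \<le> d \<and> k \<le> int j}.
     ?A (nat (int j - k)) * op_exp (\<lambda>n. scaled_osc c (- int n)) j f M) d"
    unfolding graded_pairing_def by (intro sum.cong refl arg_cong2[where f = "(*)"] vertex_coeff_coherent) auto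
  also have "\<dots> = (\<Sum>j\<in>{j. j \<le> d \<and> k \<le> int j}. ?A (nat (int j - k)) * ?B j * graded_pairing \<phi> f (d - j))"
    unfolding graded_pairing_sum graded_pairing_scale graded_pairing_op_exp_creation
    by (intro sum.cong) auto
  also have "\<dots> = (\<Sum>j=0..d. (if k \<le> int j then ?A (nat (int j - k)) * ?B j else 0) * graded_pairing \<phi> f (d - j))"
    by (intro sum.mono_neutral_cong_left) auto
  also have "\<dots> = fps_nth (Abs_fps (\<lambda>j. if k \<le> int j then ?A (nat (int j - k)) * ?B j else 0) *
     (fps_const (\<phi> {#} * f {#}) * exp_fps (\<lambda>n. \<rho> n * \<sigma> n / of_nat n))) d"
    unfolding graded_pairing_coherent by (simp add: fps_mult_nth[of "Abs_fps _"])
  finally show ?thesis by (simp only: mult.commute)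
qed

end

end

section \<open>Combinatorics of partitions\<close>

definition box_content :: "nat \<times> nat \<Rightarrow> int" where
  "box_content x = int (snd x) - int (fst x)"

abbreviation conjugate :: "diagram \<Rightarrow> diagram" where
  "conjugate \<Lambda> \<equiv> prod.swap ` \<Lambda>"

lemma content_swap [simp]: "box_content (prod.swap x) = - box_content x"
  by (simp add: box_content_def)

lemma mem_transpose [simp]: "(i, j) \<in> conjugate \<Lambda> \<longleftrightarrow> (j, i) \<in> \<Lambda>"
  by (force simp: image_iff)

lemma transpose_transpose [simp]: "conjugate (conjugate \<Lambda>) = \<Lambda>"
  by (simp add: image_image)

lemma is_partition_transpose [simp]: "is_partition (conjugate \<Lambda>) \<longleftrightarrow> is_partition \<Lambda>"
proof -
  have "is_partition (conjugate \<Lambda>)" if "is_partition \<Lambda>" for \<Lambda>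
    using that unfolding is_partition_def by fastforce
  from this[of \<Lambda>] this[of "conjugate \<Lambda>"] show ?thesis by auto
qed

lemma row_len_transpose [simp]: "row_len (conjugate \<Lambda>) = col_len \<Lambda>"
  by (simp add: row_len_def col_len_def fun_eq_iff)

lemma col_len_transpose [simp]: "col_len (conjugate \<Lambda>) = row_len \<Lambda>"
  by (simp add: row_len_def col_len_def fun_eq_iff)

lemma transpose_eq_iff [simp]: "conjugate \<Lambda> = conjugate \<mu> \<longleftrightarrow> \<Lambda> = \<mu>"
  by (rule inj_image_eq_iff) (rule inj_swap)

lemma addable_transpose: "addable (conjugate \<Lambda>) = prod.swap ` addable \<Lambda>"
proof -
  have "prod.swap x \<notin> conjugate \<Lambda> \<and> is_partition (insert (prod.swap x) (conjugate \<Lambda>)) \<longleftrightarrow>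
    x \<notin> \<Lambda> \<and> is_partition (insert x \<Lambda>)" for x
    by (metis image_insert inj_image_mem_iff inj_swap is_partition_transpose)
  then have "prod.swap x \<in> addable (conjugate \<Lambda>) \<longleftrightarrow> prod.swap x \<in> prod.swap ` addable \<Lambda>" for x
    by (simp add: addable_def inj_image_mem_iff[OF inj_swap])
  then show ?thesis by (metis (no_types, opaque_lifting) set_eqI swap_swap)
qed

lemma removable_transpose: "removable (conjugate \<Lambda>) = prod.swap ` removable \<Lambda>"
proof -
  have "prod.swap x \<in> conjugate \<Lambda> \<and> is_partition (conjugate \<Lambda> - {prod.swap x}) \<longleftrightarrow>
    x \<in> \<Lambda> \<and> is_partition (\<Lambda> - {x})" for x
  proof -
    have "conjugate \<Lambda> - {prod.swap x} = conjugate (\<Lambda> - {x})"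
      by (simp add: image_set_diff[OF inj_swap])
    then show ?thesis by (simp add: inj_image_mem_iff[OF inj_swap])
  qed
  then have "prod.swap x \<in> removable (conjugate \<Lambda>) \<longleftrightarrow> prod.swap x \<in> prod.swap ` removable \<Lambda>" for x
    by (simp add: removable_def inj_image_mem_iff[OF inj_swap])
  then show ?thesis by (metis (no_types, opaque_lifting) set_eqI swap_swap)
qed

lemma is_partition_empty [simp]: "is_partition {}"
  by (simp add: is_partition_def)

lemma is_partitionI:
  assumes "finite \<Lambda>" "\<And>i j. (i, j) \<in> \<Lambda> \<Longrightarrow> 1 \<le> i \<and> 1 \<le> j \<and> {1..i} \<times> {1..j} \<subseteq> \<Lambda>"
  shows "is_partition \<Lambda>"
  unfolding is_partition_def using assms by blast

lemma downset_eq_interval: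
  fixes S :: "nat set"
  assumes "finite S" "\<And>j. j \<in> S \<Longrightarrow> 1 \<le> j \<and> {1..j} \<subseteq> S"
  shows "S = {1..card S}"
proof (cases "S = {}")
  case False
  define m where "m = Max S"
  have "j \<in> {1..m}" if "j \<in> S" for j
    using assms(2)[OF that] Max_ge[OF assms(1) that] by (simp add: m_def)
  then have "S \<subseteq> {1..m}" by blast
  moreover have "{1..m} \<subseteq> S"
    using assms(2)[OF Max_in[OF assms(1) False]] by (simp add: m_def)
  ultimately have S: "S = {1..m}" by (rule equalityI)
  have "card S = m" unfolding S by simp
  show ?thesis unfolding \<open>card S = m\<close> by (rule S)
qed simp

context
  fixes \<Lambda> :: diagram
  assumes part: "is_partition \<Lambda>"
begin

lemma partition_finite: "finite \<Lambda>"
  using part by (simp add: is_partition_def)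

lemma partition_boxD: "(i, j) \<in> \<Lambda> \<Longrightarrow> 1 \<le> i \<and> 1 \<le> j \<and> {1..i} \<times> {1..j} \<subseteq> \<Lambda>"
  using bspec[OF conjunct2[OF part[unfolded is_partition_def]], of "(i, j)"] by simp

lemma partition_down: "(i, j) \<in> \<Lambda> \<Longrightarrow> 1 \<le> a \<Longrightarrow> a \<le> i \<Longrightarrow> 1 \<le> b \<Longrightarrow> b \<le> j \<Longrightarrow> (a, b) \<in> \<Lambda>"
  by (rule subsetD[OF conjunct2[OF conjunct2[OF partition_boxD]]]) simp_all

lemma mem_iff_row_len: "(i, j) \<in> \<Lambda> \<longleftrightarrow> 1 \<le> i \<and> 1 \<le> j \<and> j \<le> row_len \<Lambda> i"
proof -
  have "{j. (i, j) \<in> \<Lambda>} = {1..row_len \<Lambda> i}"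
    unfolding row_len_def
  proof (rule downset_eq_interval)
    have "{j. (i, j) \<in> \<Lambda>} \<subseteq> snd ` \<Lambda>" by force
    then show "finite {j. (i, j) \<in> \<Lambda>}" using partition_finite finite_surj by blast
    show "1 \<le> j \<and> {1..j} \<subseteq> {j. (i, j) \<in> \<Lambda>}" if "j \<in> {j. (i, j) \<in> \<Lambda>}" for j
      using that partition_down[of i j] partition_boxD[of i j] by auto
  qed
  then show ?thesis using partition_boxD[of i j] by (auto simp: set_eq_iff)
qed

end

lemma mem_iff_col_len:
  assumes "is_partition \<Lambda>"
  shows "(i, j) \<in> \<Lambda> \<longleftrightarrow> 1 \<le> i \<and> 1 \<le> j \<and> i \<le> col_len \<Lambda> j"
  using mem_iff_row_len[of "conjugate \<Lambda>" j i] assms by auto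

context
  fixes \<Lambda> :: diagram
  assumes part: "is_partition \<Lambda>"
begin

lemma row_col_duality: "1 \<le> i \<Longrightarrow> 1 \<le> j \<Longrightarrow> i \<le> col_len \<Lambda> j \<longleftrightarrow> j \<le> row_len \<Lambda> i"
  using mem_iff_row_len[OF part, of i j] mem_iff_col_len[OF part, of i j] by blast

lemma col_len_antimono:
  assumes "1 \<le> j" "j \<le> j'" shows "col_len \<Lambda> j' \<le> col_len \<Lambda> j"
proof (cases "col_len \<Lambda> j' = 0")
  case False
  then have "1 \<le> col_len \<Lambda> j'" "1 \<le> j'" using assms by linarith+
  then have "j' \<le> row_len \<Lambda> (col_len \<Lambda> j')" using row_col_duality by blast
  then have "j \<le> row_len \<Lambda> (col_len \<Lambda> j')" using assms by linarith
  then show ?thesis using row_col_duality \<open>1 \<le> col_len \<Lambda> j'\<close> assms(1) by blast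
qed linarith

lemma row_len_antimono:
  assumes "1 \<le> i" "i \<le> i'" shows "row_len \<Lambda> i' \<le> row_len \<Lambda> i"
proof (cases "row_len \<Lambda> i' = 0")
  case False
  then have "1 \<le> row_len \<Lambda> i'" "1 \<le> i'" using assms by linarith+
  then have "i' \<le> col_len \<Lambda> (row_len \<Lambda> i')" using row_col_duality by blast
  then have "i \<le> col_len \<Lambda> (row_len \<Lambda> i')" using assms by linarith
  then show ?thesis using row_col_duality \<open>1 \<le> row_len \<Lambda> i'\<close> assms(1) by blast
qed linarith

lemma col_len_eq_0: "row_len \<Lambda> 1 < j \<Longrightarrow> col_len \<Lambda> j = 0"
  using row_col_duality[of 1 j] by linarith

lemma col_len_tail: "\<forall>j>row_len \<Lambda> 1. col_len \<Lambda> j = 0"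
  using col_len_eq_0 by blast

lemma row_len_eq_0: "col_len \<Lambda> 1 < i \<Longrightarrow> row_len \<Lambda> i = 0"
  using row_col_duality[of i 1] by linarith

section \<open>Corners of a diagram and their contents\<close>

lemma addable_eq: "addable \<Lambda> = (\<lambda>j. (Suc (col_len \<Lambda> j), j)) ` {j. 1 \<le> j \<and> (j = 1 \<or> col_len \<Lambda> j < col_len \<Lambda> (j - 1))}"
proof (intro equalityI subsetI)
  fix x assume "x \<in> addable \<Lambda>"
  moreover obtain i j where xij: "x = (i, j)" by (cases x)
  ultimately have x: "x = (i, j)" "(i, j) \<notin> \<Lambda>" and p: "is_partition (insert (i, j) \<Lambda>)"
    by (simp_all add: addable_def)
  note down = partition_down[OF p insertI1]
  have ij: "1 \<le> i" "1 \<le> j" using partition_boxD[OF p insertI1] by blast+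
  then have gt: "i > col_len \<Lambda> j" using x mem_iff_col_len[OF part, of i j] by auto
  have "i = Suc (col_len \<Lambda> j)"
  proof (rule ccontr)
    assume "i \<noteq> Suc (col_len \<Lambda> j)"
    then have "i - 1 > col_len \<Lambda> j" using gt by simp
    then have "(i - 1, j) \<in> insert (i, j) \<Lambda>" by (intro down) (use ij in simp_all)
    moreover have "i - 1 \<noteq> i" using ij by linarith
    ultimately have "(i - 1, j) \<in> \<Lambda>" by simp
    then show False using mem_iff_col_len[OF part, of "i - 1" j] \<open>i - 1 > col_len \<Lambda> j\<close> by linarith
  qed
  moreover have "j = 1 \<or> col_len \<Lambda> j < col_len \<Lambda> (j - 1)"
  proof (cases "j = 1")
    case False
    then have "(i, j - 1) \<in> insert (i, j) \<Lambda>" by (intro down) (use ij in simp_all)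
    moreover have "j - 1 \<noteq> j" using ij by linarith
    ultimately have "(i, j - 1) \<in> \<Lambda>" by simp
    then have "i \<le> col_len \<Lambda> (j - 1)" using mem_iff_col_len[OF part] by blast
    then show ?thesis using gt by linarith
  qed simp
  ultimately show "x \<in> (\<lambda>j. (Suc (col_len \<Lambda> j), j)) ` {j. 1 \<le> j \<and> (j = 1 \<or> col_len \<Lambda> j < col_len \<Lambda> (j - 1))}"
    using x ij by auto
next
  fix x assume "x \<in> (\<lambda>j. (Suc (col_len \<Lambda> j), j)) ` {j. 1 \<le> j \<and> (j = 1 \<or> col_len \<Lambda> j < col_len \<Lambda> (j - 1))}"
  then obtain j where x: "x = (Suc (col_len \<Lambda> j), j)" "1 \<le> j" "j = 1 \<or> col_len \<Lambda> j < col_len \<Lambda> (j - 1)" by auto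
  have "(a, b) \<in> insert x \<Lambda>" if "1 \<le> a" "a \<le> Suc (col_len \<Lambda> j)" "1 \<le> b" "b \<le> j" for a b
  proof (cases "b = j")
    case True
    then show ?thesis using that x mem_iff_col_len[OF part, of a b] by (auto simp: le_Suc_eq)
  next
    case False
    then have "col_len \<Lambda> (j - 1) \<le> col_len \<Lambda> b" using that by (intro col_len_antimono) auto
    then show ?thesis using False that x mem_iff_col_len[OF part, of a b] by auto
  qed
  then have box: "{1..fst x} \<times> {1..snd x} \<subseteq> insert x \<Lambda>"
    using x by (auto simp: subset_iff)
  have "is_partition (insert x \<Lambda>)"
  proof (rule is_partitionI)
    fix a b assume ab: "(a, b) \<in> insert x \<Lambda>"
    show "1 \<le> a \<and> 1 \<le> b \<and> {1..a} \<times> {1..b} \<subseteq> insert x \<Lambda>"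
    proof (cases "(a, b) = x")
      case True
      then have "fst x = a" "snd x = b" by auto
      then show ?thesis using box True x(1,2) by simp
    next
      case False
      then have "(a, b) \<in> \<Lambda>" using ab by blast
      from partition_boxD[OF part this] show ?thesis by blast
    qed
  qed (simp add: partition_finite[OF part])
  then show "x \<in> addable \<Lambda>"
    using x mem_iff_col_len[OF part] by (auto simp: addable_def)
qed

lemma removable_eq: "removable \<Lambda> = (\<lambda>j. (col_len \<Lambda> j, j)) ` {j. 1 \<le> j \<and> col_len \<Lambda> (Suc j) < col_len \<Lambda> j}"
proof (intro equalityI subsetI)
  fix x assume "x \<in> removable \<Lambda>"
  moreover obtain i j where xij: "x = (i, j)" by (cases x)
  ultimately have x: "x = (i, j)" "(i, j) \<in> \<Lambda>" and p: "is_partition (\<Lambda> - {(i, j)})"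
    by (simp_all add: removable_def)
  have ij: "1 \<le> i" "1 \<le> j" "i \<le> col_len \<Lambda> j" using x mem_iff_col_len[OF part, of i j] by auto
  have no: "(a, b) \<notin> \<Lambda> - {(i, j)}" if "i \<le> a" "j \<le> b" for a b
    using partition_down[OF p _ ij(1) that(1) ij(2) that(2)] by blast
  have "\<not> Suc i \<le> col_len \<Lambda> j"
    using no[of "Suc i" j] ij mem_iff_col_len[OF part, of "Suc i" j] by simp
  then have "i = col_len \<Lambda> j" using ij by simp
  moreover have "col_len \<Lambda> (Suc j) < i"
    using no[of i "Suc j"] ij mem_iff_col_len[OF part, of i "Suc j"] by simp
  ultimately show "x \<in> (\<lambda>j. (col_len \<Lambda> j, j)) ` {j. 1 \<le> j \<and> col_len \<Lambda> (Suc j) < col_len \<Lambda> j}"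
    using x ij by auto
next
  fix x assume "x \<in> (\<lambda>j. (col_len \<Lambda> j, j)) ` {j. 1 \<le> j \<and> col_len \<Lambda> (Suc j) < col_len \<Lambda> j}"
  then obtain j where x: "x = (col_len \<Lambda> j, j)" "1 \<le> j" "col_len \<Lambda> (Suc j) < col_len \<Lambda> j" by auto
  have "x \<notin> {1..a} \<times> {1..b}" if ab: "(a, b) \<in> \<Lambda> - {x}" for a b
  proof
    assume "x \<in> {1..a} \<times> {1..b}"
    then have *: "col_len \<Lambda> j \<le> a" "j \<le> b" using x by auto
    have a: "a \<le> col_len \<Lambda> b" using ab mem_iff_col_len[OF part, of a b] by auto
    show False
    proof (cases "b = j")
      case True then show ?thesis using * a ab x by auto
    next
      case False
      then have "col_len \<Lambda> b \<le> col_len \<Lambda> (Suc j)" using * by (intro col_len_antimono) auto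
      then show ?thesis using a x * by simp
    qed
  qed
  then have "is_partition (\<Lambda> - {x})"
    using part unfolding is_partition_def by blast
  moreover have "x \<in> \<Lambda>" using x mem_iff_col_len[OF part, of "col_len \<Lambda> j" j] by auto
  ultimately show "x \<in> removable \<Lambda>" by (simp add: removable_def)
qed

lemma finite_removable: "finite (removable \<Lambda>)"
  using partition_finite[OF part] by (simp add: removable_def)

lemma finite_addable: "finite (addable \<Lambda>)"
proof -
  have "j \<le> Suc (row_len \<Lambda> 1)" if "j = 1 \<or> col_len \<Lambda> j < col_len \<Lambda> (j - 1)" for j
  proof (rule ccontr)
    assume j: "\<not> j \<le> Suc (row_len \<Lambda> 1)"
    then have "col_len \<Lambda> (j - 1) = 0" by (intro col_len_eq_0) linarith
    then show False using that j by simp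
  qed
  then have "{j. 1 \<le> j \<and> (j = 1 \<or> col_len \<Lambda> j < col_len \<Lambda> (j - 1))} \<subseteq> {..Suc (row_len \<Lambda> 1)}"
    by blast
  from finite_subset[OF this] show ?thesis unfolding addable_eq by simp
qed

text \<open>The content j - 1 - \<Lambda>'_j of the first free box increases strictly with the
  column, as the column lengths decrease weakly.\<close>

lemma content_inj_addable: "inj_on box_content (addable \<Lambda>)"
proof (rule inj_onI)
  fix x y assume "x \<in> addable \<Lambda>" "y \<in> addable \<Lambda>" "box_content x = box_content y"
  then obtain i j where x: "x = (Suc (col_len \<Lambda> i), i)" "1 \<le> i" and y: "y = (Suc (col_len \<Lambda> j), j)" "1 \<le> j"
    and e: "int i - int (col_len \<Lambda> i) = int j - int (col_len \<Lambda> j)"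
    by (auto simp: addable_eq box_content_def)
  then have "i = j"
    using col_len_antimono[of i j] col_len_antimono[of j i] by (cases "i \<le> j") auto
  then show "x = y" using x y by simp
qed

text \<open>An addable box weakly to the left of a removable one has smaller content. Strictly to
  the right its column is at most as long as column l + 1, hence shorter than column l, and its
  content is larger.\<close>

lemma content_addable_removable:
  assumes "x \<in> addable \<Lambda>" "y \<in> removable \<Lambda>" shows "box_content x \<noteq> box_content y"
proof
  assume "box_content x = box_content y"
  moreover obtain j where x: "x = (Suc (col_len \<Lambda> j), j)" and j: "1 \<le> j"
    using assms(1) by (auto simp: addable_eq)
  moreover obtain l where y: "y = (col_len \<Lambda> l, l)" and l: "1 \<le> l" "col_len \<Lambda> (Suc l) < col_len \<Lambda> l"
    using assms(2) by (auto simp: removable_eq)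
  ultimately have e: "int j - 1 - int (col_len \<Lambda> j) = int l - int (col_len \<Lambda> l)"
    by (simp add: box_content_def)
  show False
    using col_len_antimono[of j l] col_len_antimono[of "Suc l" j] j l e by (cases "j \<le> l") auto
qed

text \<open>In column \<open>l\<close> the first free box has content \<open>l - 1 - \<Lambda>'\<^sub>l\<close> and the last box has content \<open>l - \<Lambda>'\<^sub>l\<close>.
  If column \<open>l + 1\<close> has the same length, neither its free box is addable nor the last box of column \<open>l\<close>
  removable, and the two contents agree.\<close>

lemma content_telescope:
  assumes J: "\<forall>j>J. col_len \<Lambda> j = 0"
  shows "image_mset box_content (mset_set (addable \<Lambda>)) + image_mset (\<lambda>l. int l - int (col_len \<Lambda> l)) (mset_set {1..J})
    = image_mset box_content (mset_set (removable \<Lambda>)) + image_mset (\<lambda>l. int l - 1 - int (col_len \<Lambda> l)) (mset_set {1..J}) + {#int J#}"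
proof -
  let ?c = "col_len \<Lambda>"
  \<comment> \<open>\<open>T\<close> holds the columns with an equally long right neighbour and
    \<open>R\<close> those where the length drops. Column 1 and the right neighbours of
    \<open>R\<close> carry the addable boxes.\<close>
  define T where "T = {l \<in> {1..J}. ?c (Suc l) = ?c l}"
  define R where "R = {l \<in> {1..J}. ?c (Suc l) < ?c l}"
  define A where "A = insert 1 (Suc ` R)"
  let ?g = "\<lambda>l. int l - 1 - int (?c l)" and ?h = "\<lambda>l. int l - int (?c l)"
  have fin: "finite T" "finite R" "finite A" by (auto simp: T_def R_def A_def)
  have RT: "{1..J} = R \<union> T" "R \<inter> T = {}"
  proof -
    have "?c (Suc l) \<le> ?c l" if "l \<in> {1..J}" for l using that by (intro col_len_antimono) auto
    then have "l \<in> R \<union> T" if "l \<in> {1..J}" for l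
      using that unfolding R_def T_def le_less by blast
    then show "{1..J} = R \<union> T" unfolding R_def T_def by blast
  qed (auto simp: R_def T_def)
  have "{1..Suc J} = insert 1 (Suc ` {1..J})"
    by (simp add: image_Suc_atLeastAtMost atLeastAtMost_insertL)
  then have AT: "{1..Suc J} = A \<union> Suc ` T"
    unfolding RT(1) A_def by (simp add: image_Un)
  have AT': "A \<inter> Suc ` T = {}"
    using RT(2) unfolding A_def T_def by auto
  have "{j. 1 \<le> j \<and> ?c (Suc j) < ?c j} = R"
  proof -
    have "j \<le> J" if "?c (Suc j) < ?c j" for j
      using J that by (metis linorder_not_less not_less0)
    then show ?thesis by (auto simp: R_def)
  qed
  then have rem: "removable \<Lambda> = (\<lambda>j. (?c j, j)) ` R" by (simp add: removable_eq)
  have "{j. 1 \<le> j \<and> (j = 1 \<or> ?c j < ?c (j - 1))} = A"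
  proof -
    have "j \<in> Suc ` R" if "j \<noteq> 1" "1 \<le> j" "?c j < ?c (j - 1)" for j
    proof (rule image_eqI)
      show "j = Suc (j - 1)" using that by simp
      have "\<not> J < j - 1" using J that(3) by (metis not_less0)
      then show "j - 1 \<in> R" using that by (simp add: R_def)
    qed
    then show ?thesis by (auto simp: A_def R_def)
  qed
  then have add: "addable \<Lambda> = (\<lambda>j. (Suc (?c j), j)) ` A" by (simp add: addable_eq)
  have CA: "image_mset box_content (mset_set (addable \<Lambda>)) = image_mset ?g (mset_set A)"
    unfolding add by (subst image_mset_mset_set[symmetric]) (auto simp: inj_on_def box_content_def multiset.map_comp o_def diff_diff_eq intro!: image_mset_cong)
  have CR: "image_mset box_content (mset_set (removable \<Lambda>)) = image_mset ?h (mset_set R)"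
    unfolding rem by (subst image_mset_mset_set[symmetric]) (auto simp: inj_on_def box_content_def multiset.map_comp o_def diff_diff_eq intro!: image_mset_cong)
  have hT: "image_mset ?h (mset_set T) = image_mset ?g (mset_set (Suc ` T))"
    by (subst image_mset_mset_set[symmetric])
      (auto simp: multiset.map_comp o_def T_def intro!: image_mset_cong)
  \<comment> \<open>Column J + 1 is empty, so its first free box has content J; this is the extra
    term of the statement.\<close>
  have gJ: "image_mset ?g (mset_set {1..J}) + {#int J#} = image_mset ?g (mset_set {1..Suc J})"
    using J by (simp add: atLeastAtMostSuc_conv)
  have RTm: "mset_set {1..J} = mset_set R + mset_set T"
    unfolding RT(1) using RT(2) fin by (simp add: mset_set_Union)
  have ATm: "mset_set {1..Suc J} = mset_set A + mset_set (Suc ` T)"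
    unfolding AT using AT' fin by (simp add: mset_set_Union)
  have "image_mset box_content (mset_set (addable \<Lambda>)) + image_mset ?h (mset_set {1..J})
    = image_mset ?g (mset_set A) + (image_mset ?h (mset_set R) + image_mset ?g (mset_set (Suc ` T)))"
    unfolding CA RTm image_mset_union hT ..
  also have "\<dots> = image_mset ?h (mset_set R) + image_mset ?g (mset_set {1..Suc J})"
    unfolding ATm image_mset_union by (simp only: add_ac)
  also have "\<dots> = image_mset box_content (mset_set (removable \<Lambda>)) + (image_mset ?g (mset_set {1..J}) + {#int J#})"
    unfolding CR gJ ..
  finally show ?thesis by (simp only: add.assoc)
qed

lemma content_sum_telescope:
  fixes f :: "int \<Rightarrow> 'a :: comm_monoid_add"
  assumes J: "\<forall>j>J. col_len \<Lambda> j = 0"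
  shows "(\<Sum>x\<in>addable \<Lambda>. f (box_content x)) + (\<Sum>l=1..J. f (int l - int (col_len \<Lambda> l)))
    = (\<Sum>x\<in>removable \<Lambda>. f (box_content x)) + (\<Sum>l=1..J. f (int l - 1 - int (col_len \<Lambda> l))) + f (int J)"
  using arg_cong[OF content_telescope[OF J], where f = "\<lambda>M. sum_mset (image_mset f M)"]
  by (simp add: multiset.map_comp o_def sum_unfold_sum_mset add_ac)

lemma content_prod_telescope:
  fixes f :: "int \<Rightarrow> 'a :: comm_monoid_mult"
  assumes J: "\<forall>j>J. col_len \<Lambda> j = 0"
  shows "(\<Prod>x\<in>addable \<Lambda>. f (box_content x)) * (\<Prod>l=1..J. f (int l - int (col_len \<Lambda> l)))
    = (\<Prod>x\<in>removable \<Lambda>. f (box_content x)) * (\<Prod>l=1..J. f (int l - 1 - int (col_len \<Lambda> l))) * f (int J)"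
  using arg_cong[OF content_telescope[OF J], where f = "\<lambda>M. prod_mset (image_mset f M)"]
  by (simp add: multiset.map_comp o_def prod_unfold_prod_mset mult_ac)

lemma card_addable: "card (addable \<Lambda>) = Suc (card (removable \<Lambda>))"
  using content_sum_telescope[OF col_len_tail, of "\<lambda>_. 1::nat"] by simp

text \<open>The two column sums differ by 1 in each of the J columns, which balances the extra term
  J. It follows that the weights q^content of both kinds of corners have the same product.\<close>

lemma sum_content_addable: "(\<Sum>x\<in>addable \<Lambda>. box_content x) = (\<Sum>x\<in>removable \<Lambda>. box_content x)"
  using content_sum_telescope[OF col_len_tail, of "\<lambda>c. c"] by (simp add: sum_subtractf)

lemma addable_insert:
  assumes "x \<in> addable \<Lambda>"
  shows "is_partition (insert x \<Lambda>) \<and> x \<notin> \<Lambda> \<and> x \<in> removable (insert x \<Lambda>)"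
proof -
  have x: "x \<notin> \<Lambda>" "is_partition (insert x \<Lambda>)" using assms by (simp_all add: addable_def)
  then have "insert x \<Lambda> - {x} = \<Lambda>" by blast
  then have "x \<in> removable (insert x \<Lambda>)" using part by (simp add: removable_def)
  with x show ?thesis by blast
qed

lemma removable_minus:
  assumes "x \<in> removable \<Lambda>"
  shows "is_partition (\<Lambda> - {x}) \<and> x \<in> addable (\<Lambda> - {x}) \<and> insert x (\<Lambda> - {x}) = \<Lambda>"
proof -
  have x: "x \<in> \<Lambda>" "is_partition (\<Lambda> - {x})" using assms by (simp_all add: removable_def)
  then have i: "insert x (\<Lambda> - {x}) = \<Lambda>" by blast
  then have "x \<in> addable (\<Lambda> - {x})" using part unfolding addable_def mem_Collect_eq i by blast
  with x i show ?thesis by blast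
qed

section \<open>Hook exponents and Maya diagrams\<close>

lemma partition_diagonal_hook:
  assumes "1 \<le> i" "1 \<le> j" shows "row_len \<Lambda> i + col_len \<Lambda> j + 1 \<noteq> i + j"
  \<comment> \<open>Inside the diagram the exponent i + j - 1 - \<Lambda>_i - \<Lambda>'_j is minus
    the hook length; outside it is positive.\<close>
  using row_col_duality[OF assms] by linarith

text \<open>The numbers \<open>\<Lambda>\<^sub>s - s\<close> and \<open>j - 1 - \<Lambda>'\<^sub>j\<close> are the two colours of the Maya diagram.\<close>

lemma maya_complement:
  "(\<exists>s\<ge>1. n = int (row_len \<Lambda> s) - int s) \<or> (\<exists>j\<ge>1. n = int j - 1 - int (col_len \<Lambda> j))"
proof (subst disj_commute, rule disjCI)
  assume no: "\<not> (\<exists>s\<ge>1. n = int (row_len \<Lambda> s) - int s)"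
  let ?P = "\<lambda>i. 1 \<le> i \<and> int (row_len \<Lambda> i) - int i < n"
  have "?P (Suc (col_len \<Lambda> 1 + nat \<bar>n\<bar>))" using row_len_eq_0[of "Suc (col_len \<Lambda> 1 + nat \<bar>n\<bar>)"] by auto
  define i where "i = (LEAST i. ?P i)"
  have i: "1 \<le> i" "int (row_len \<Lambda> i) - int i < n"
    unfolding i_def using LeastI[of ?P, OF \<open>?P _\<close>] by blast+
  have "\<not> ?P (i - 1)" unfolding i_def by (rule not_less_Least) (use i in \<open>simp add: i_def\<close>)
  then have prev: "i = 1 \<or> int (row_len \<Lambda> (i - 1)) - int (i - 1) > n"
  proof (cases "i = 1")
    case False
    then have "1 \<le> i - 1" using i(1) by linarith
    then have "n \<le> int (row_len \<Lambda> (i - 1)) - int (i - 1)" "n \<noteq> int (row_len \<Lambda> (i - 1)) - int (i - 1)"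
      using \<open>\<not> ?P (i - 1)\<close> no by (linarith, blast)
    then show ?thesis by linarith
  qed simp
  \<comment> \<open>Row i - 1 has its value above n and row i below it, so column n + i ends exactly
    in row i - 1.\<close>
  define j where "j = nat (n + int i)"
  have j: "1 \<le> j" "n = int j - int i" using i by (auto simp: j_def)
  have "\<not> i \<le> col_len \<Lambda> j" using row_col_duality[of i j] i j by auto
  moreover have "i - 1 \<le> col_len \<Lambda> j"
    using prev row_col_duality[of "i - 1" j] i j by (cases "i = 1") auto
  ultimately have "col_len \<Lambda> j = i - 1" by simp
  then show "\<exists>j\<ge>1. n = int j - 1 - int (col_len \<Lambda> j)" using i j by (intro exI[of _ j]) auto
qed

end

lemma partition_eqI:
  assumes "is_partition \<Lambda>" "is_partition \<mu>" "\<And>i. i \<ge> 1 \<Longrightarrow> row_len \<Lambda> i = row_len \<mu> i"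
  shows "\<Lambda> = \<mu>"
proof -
  have "(i, j) \<in> \<Lambda> \<longleftrightarrow> (i, j) \<in> \<mu>" for i j
    unfolding mem_iff_row_len[OF assms(1)] mem_iff_row_len[OF assms(2)] using assms(3) by auto
  then show ?thesis by auto
qed

text \<open>If no such pair existed, no number \<Lambda>_i - i would have the other colour in the
  Maya diagram of \<mu>, so each would equal some \<mu>_s - s. Both sequences decrease strictly, and
  an inclusion between Maya diagrams of equal charge is an equality.\<close>

lemma distinct_partitions_hook:
  assumes L: "is_partition \<Lambda>" and M: "is_partition \<mu>" and "\<Lambda> \<noteq> \<mu>"
  shows "\<exists>i\<ge>1. \<exists>j\<ge>1. row_len \<Lambda> i + col_len \<mu> j + 1 = i + j"
proof (rule ccontr)
  assume no: "\<not> ?thesis"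
  have s: "\<exists>s\<ge>1. int (row_len \<Lambda> i) - int i = int (row_len \<mu> s) - int s" if "i \<ge> 1" for i
  proof (rule ccontr)
    assume "\<not> ?thesis"
    then obtain j where "j \<ge> 1" "int (row_len \<Lambda> i) - int i = int j - 1 - int (col_len \<mu> j)"
      using maya_complement[OF M, of "int (row_len \<Lambda> i) - int i"] by auto
    then show False using no that by fastforce
  qed
  \<comment> \<open>The rows before i already use up i - 1 values of \<mu>, which pushes the partner
    s of i to s \<ge> i.\<close>
  have le: "row_len \<Lambda> i \<le> row_len \<mu> i" if "i \<ge> 1" for i
    using that
  proof (induction i rule: less_induct)
    case (less i)
    obtain s where s: "s \<ge> 1" "int (row_len \<Lambda> i) - int i = int (row_len \<mu> s) - int s"
      using s less.prems by blast
    show ?case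
    proof (cases "s < i")
      case True
      then show ?thesis using less.IH[of s] s row_len_antimono[OF L, of s i] by auto
    next
      case False
      then show ?thesis using s row_len_antimono[OF M, of i s] less.prems by auto
    qed
  qed
  \<comment> \<open>The opposite bound descends from the rows beyond \<mu>, where it is trivial: the
    bound in row i + 1 forces the partner of row i to satisfy s \<le> i.\<close>
  have "row_len \<mu> i \<le> row_len \<Lambda> i" if "i \<ge> 1" for i
  proof (cases "i \<le> Suc (col_len \<mu> 1)")
    case True
    then show ?thesis using \<open>i \<ge> 1\<close>
    proof (induction i rule: inc_induct)
      case base
      then show ?case using row_len_eq_0[OF M] by simp
    next
      case (step i)
      obtain s where s: "s \<ge> 1" "int (row_len \<Lambda> i) - int i = int (row_len \<mu> s) - int s"
        using s step.prems by blast
      have "s \<le> i"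
      proof (rule ccontr)
        assume "\<not> s \<le> i"
        then have "row_len \<mu> s \<le> row_len \<mu> (Suc i)" by (intro row_len_antimono[OF M]) auto
        then show False
          using s step.IH \<open>\<not> s \<le> i\<close> row_len_antimono[OF L, of i "Suc i"] step.prems by auto
      qed
      then show ?case using s row_len_antimono[OF M, of s i] by auto
    qed
  next
    case False
    then show ?thesis using row_len_eq_0[OF M] by simp
  qed
  then have "\<Lambda> = \<mu>" using le L M by (intro partition_eqI) (auto intro: antisym)
  then show False using assms by blast
qed

section \<open>Building partitions box by box\<close>

lemma col_len_insert:
  assumes "finite \<Lambda>" "x \<notin> \<Lambda>"
  shows "col_len (insert x \<Lambda>) l = col_len \<Lambda> l + (if l = snd x then 1 else 0)"
proof (cases "l = snd x")
  case True
  then have "{i. (i, l) \<in> insert x \<Lambda>} = insert (fst x) {i. (i, l) \<in> \<Lambda>}" by (cases x) auto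
  moreover have "finite {i. (i, l) \<in> \<Lambda>}"
    by (rule finite_subset[OF _ finite_imageI[OF assms(1), of fst]]) force
  moreover have "fst x \<notin> {i. (i, l) \<in> \<Lambda>}" using assms True by auto
  ultimately show ?thesis using True by (simp add: col_len_def)
next
  case False
  then have "{i. (i, l) \<in> insert x \<Lambda>} = {i. (i, l) \<in> \<Lambda>}" by (cases x) auto
  then show ?thesis using False by (simp add: col_len_def)
qed

lemma removable_nonempty:
  assumes "is_partition \<Lambda>" "\<Lambda> \<noteq> {}" shows "removable \<Lambda> \<noteq> {}"
proof -
  \<comment> \<open>A box maximizing i + j dominates no other box, so it is a corner.\<close>
  let ?f = "\<lambda>x::nat \<times> nat. fst x + snd x"
  have fin: "finite (?f ` \<Lambda>)" using partition_finite[OF assms(1)] by blast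
  then have "Max (?f ` \<Lambda>) \<in> ?f ` \<Lambda>" using assms(2) by (intro Max_in) blast+
  then obtain x where x': "Max (?f ` \<Lambda>) = ?f x" "x \<in> \<Lambda>" by (rule imageE)
  have x: "?f y \<le> ?f x" if "y \<in> \<Lambda>" for y
    using Max_ge[OF fin imageI[OF that]] x'(1) by linarith
  have "x \<notin> {1..a} \<times> {1..b}" if "(a, b) \<in> \<Lambda> - {x}" for a b
  proof
    assume "x \<in> {1..a} \<times> {1..b}"
    then have "fst x \<le> a" "snd x \<le> b" by (simp_all add: mem_Times_iff)
    moreover have "a + b \<le> fst x + snd x" using x[of "(a, b)"] that by simp
    ultimately have "x = (a, b)" by (simp add: prod_eq_iff)
    then show False using that by simp
  qed
  then have "is_partition (\<Lambda> - {x})"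
    using partition_finite[OF assms(1)] partition_boxD[OF assms(1)]
    by (intro is_partitionI) blast+
  then show ?thesis using x'(2) unfolding removable_def by blast
qed

lemma partition_induct [consumes 1, case_names empty insert]:
  assumes "is_partition \<Lambda>" "P {}"
    "\<And>\<Lambda> x. is_partition \<Lambda> \<Longrightarrow> x \<in> addable \<Lambda> \<Longrightarrow> P \<Lambda> \<Longrightarrow> P (insert x \<Lambda>)"
  shows "P \<Lambda>"
  using assms(1)
proof (induction "card \<Lambda>" arbitrary: \<Lambda>)
  case 0
  then show ?case using assms(2) partition_finite by auto
next
  case (Suc n)
  then obtain x where x: "x \<in> removable \<Lambda>" using removable_nonempty by fastforce
  have "card (\<Lambda> - {x}) = n"
    using x Suc.hyps(2) by (auto simp: removable_def)
  then show ?case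
    using Suc.hyps(1)[of "\<Lambda> - {x}"] removable_minus[OF Suc.prems x] assms(3) by metis
qed

text \<open>Besides the evenness of \<open>kappa\<close>, this shows that adding a box changes
  \<open>kappa \<Lambda> div 2\<close> by its content.\<close>

lemma kappa_content:
  assumes "is_partition \<Lambda>" shows "kappa \<Lambda> = 2 * (\<Sum>x\<in>\<Lambda>. box_content x)"
proof -
  have "\<Lambda> = Sigma (fst ` \<Lambda>) (\<lambda>i. {1..row_len \<Lambda> i})"
    using mem_iff_row_len[OF assms] by (force simp: image_iff)
  then have "(\<Sum>x\<in>\<Lambda>. box_content x) = (\<Sum>(i, j)\<in>Sigma (fst ` \<Lambda>) (\<lambda>i. {1..row_len \<Lambda> i}). int j - int i)"
    by (simp add: box_content_def case_prod_unfold)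
  also have "\<dots> = (\<Sum>i\<in>fst ` \<Lambda>. \<Sum>j\<in>{1..row_len \<Lambda> i}. int j - int i)"
    using partition_finite[OF assms] by (subst sum.Sigma) auto
  finally have "2 * (\<Sum>x\<in>\<Lambda>. box_content x) = (\<Sum>i\<in>fst ` \<Lambda>. 2 * (\<Sum>j\<in>{1..row_len \<Lambda> i}. int j - int i))"
    by (simp add: sum_distrib_left)
  moreover have "2 * (\<Sum>j\<in>{1..n}. int j - int i) = int n * (int n - 2 * int i + 1)" for n i
    by (induction n) (auto simp: algebra_simps)
  ultimately show ?thesis by (simp add: kappa_def)
qed

section \<open>Power sums of the spectral sequences\<close>

locale nome =
  fixes q :: complex
  assumes q_pos: "0 < norm q" and q_less: "norm q < 1"
begin

lemma q_nonzero [simp]: "q \<noteq> 0"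
  using q_pos by auto

lemma q_power_neq_1: "n > 0 \<Longrightarrow> q ^ n \<noteq> 1"
  using q_less by (metis norm_one norm_power power_less_one_iff norm_ge_zero less_irrefl)

lemma q_powi_eq_1_iff: "q powi k = 1 \<longleftrightarrow> k = 0"
proof (cases "k \<ge> 0")
  case True
  then obtain n where "k = int n" using nonneg_int_cases by blast
  then show ?thesis using q_power_neq_1[of n] by (cases "n = 0") auto
next
  case False
  then obtain n where "k = - int n" "n > 0" by (metis int_cases2 linorder_not_le neg_less_0_iff_less of_nat_0_less_iff zero_le_imp_eq_int nle_le of_nat_0_le_iff)
  then show ?thesis using q_power_neq_1[of n] by (simp add: power_int_minus)
qed

lemma col_spec_tail: "\<forall>j>J. col_len \<Lambda> j = 0 \<Longrightarrow> col_spec q \<Lambda> (Suc (i + J)) = q ^ J * q ^ i"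
  by (simp add: col_spec_def power_add flip: of_nat_add)

lemma summable_col_spec:
  assumes "is_partition \<Lambda>" shows "summable (\<lambda>i. norm (col_spec q \<Lambda> (Suc i)))"
proof -
  have "summable (\<lambda>i. norm (col_spec q \<Lambda> (Suc (i + row_len \<Lambda> 1))))"
    unfolding col_spec_tail[OF col_len_tail[OF assms]] norm_mult norm_power
    using q_less by (intro summable_mult summable_geometric) simp
  then show ?thesis by (subst (asm) summable_iff_shift)
qed

lemma summable_col_spec_power:
  assumes "is_partition \<Lambda>" "n > 0" shows "summable (\<lambda>i. norm (col_spec q \<Lambda> (Suc i) ^ n))"
proof -
  have "norm (q ^ n) < 1" using q_less assms(2) by (simp add: norm_power power_less_one_iff)
  then have "summable (\<lambda>i. norm (col_spec q \<Lambda> (Suc (i + row_len \<Lambda> 1)) ^ n))"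
    unfolding col_spec_tail[OF col_len_tail[OF assms(1)]] norm_mult power_mult_distrib
    by (intro summable_mult) (simp add: norm_power power_mult[symmetric] mult.commute[of _ n], simp add: power_mult summable_geometric)
  then show ?thesis by (subst (asm) summable_iff_shift)
qed

lemma power_sum_suminf:
  assumes "summable (\<lambda>i. norm (x (Suc i) ^ n))"
  shows "power_sum n x = (\<Sum>i. x (Suc i) ^ n)"
proof -
  have "{1..} = range Suc" by (auto simp: image_iff) (metis Suc_le_D)
  then have "power_sum n x = (\<Sum>\<^sub>\<infinity>i. x (Suc i) ^ n)"
    unfolding power_sum_def by (simp add: infsum_reindex o_def)
  then show ?thesis
    using norm_summable_imp_has_sum[OF assms] summable_sums[OF summable_norm_cancel[OF assms]] infsumI by metis
qed

definition psum :: "diagram \<Rightarrow> nat \<Rightarrow> complex" where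
  "psum \<Lambda> n = power_sum n (col_spec q \<Lambda>)"

lemma psum_suminf:
  assumes "is_partition \<Lambda>" "n > 0" shows "psum \<Lambda> n = (\<Sum>i. col_spec q \<Lambda> (Suc i) ^ n)"
  unfolding psum_def by (intro power_sum_suminf summable_col_spec_power assms)

text \<open>The row spectrum is q times the column spectrum of the transposed diagram, so the single
  function \<open>psum\<close> serves both kets and bras.\<close>

lemma power_sum_row_spec:
  assumes "is_partition \<Lambda>" "n > 0"
  shows "power_sum n (row_spec q \<Lambda>) = q ^ n * psum (conjugate \<Lambda>) n"
proof -
  have "row_spec q \<Lambda> l = q * col_spec q (conjugate \<Lambda>) l" for l
    unfolding row_spec_def col_spec_def
    by (subst power_int_add_1'[symmetric]) (auto simp: algebra_simps)
  then show ?thesis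
    by (simp add: power_sum_def psum_def power_mult_distrib infsum_cmult_right')
qed

text \<open>Multiplication by 1 - q^n subtracts from each column's first free content its last
  content. The columns telescope down to the corners, and the geometric tail beyond column J
  supplies the free box of column J + 1.\<close>

lemma psum_content:
  assumes "is_partition \<Lambda>" "n > 0"
  shows "(1 - q ^ n) * psum \<Lambda> n = (\<Sum>x\<in>addable \<Lambda>. (q powi box_content x) ^ n) - (\<Sum>x\<in>removable \<Lambda>. (q powi box_content x) ^ n)"
proof -
  define J where "J = row_len \<Lambda> 1"
  have J: "\<forall>j>J. col_len \<Lambda> j = 0"
    unfolding J_def by (rule col_len_tail[OF assms(1)])
  let ?f = "\<lambda>c. (q powi c) ^ n"
  have "norm (q ^ n) < 1" using q_less assms(2) by (simp add: norm_power power_less_one_iff)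
  have tail: "(\<Sum>i. col_spec q \<Lambda> (Suc (i + J)) ^ n) = ?f (int J) / (1 - q ^ n)"
  proof -
    have "(\<Sum>i. col_spec q \<Lambda> (Suc (i + J)) ^ n) = (\<Sum>i. q ^ (J * n) * (q ^ n) ^ i)"
      unfolding col_spec_tail[OF J] by (simp add: power_mult_distrib power_mult[symmetric] mult.commute)
    also have "\<dots> = q ^ (J * n) * (1 / (1 - q ^ n))"
      using \<open>norm (q ^ n) < 1\<close> by (simp add: suminf_mult suminf_geometric summable_geometric)
    finally show ?thesis by (simp add: power_mult)
  qed
  have "psum \<Lambda> n = (\<Sum>i. col_spec q \<Lambda> (Suc (i + J)) ^ n) + (\<Sum>i<J. col_spec q \<Lambda> (Suc i) ^ n)"
    unfolding psum_suminf[OF assms]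
    by (intro suminf_split_initial_segment summable_norm_cancel[OF summable_col_spec_power] assms)
  also have "(\<Sum>i<J. col_spec q \<Lambda> (Suc i) ^ n) = (\<Sum>l=1..J. ?f (int l - 1 - int (col_len \<Lambda> l)))"
    by (rule sum.reindex_bij_witness[of _ "\<lambda>l. l - 1" Suc]) (auto simp: col_spec_def algebra_simps)
  finally have "(1 - q ^ n) * psum \<Lambda> n = ?f (int J) + (1 - q ^ n) * (\<Sum>l=1..J. ?f (int l - 1 - int (col_len \<Lambda> l)))"
    unfolding tail using q_power_neq_1[OF assms(2)] by (simp add: field_simps)
  also have "q ^ n * (\<Sum>l=1..J. ?f (int l - 1 - int (col_len \<Lambda> l))) = (\<Sum>l=1..J. ?f (int l - int (col_len \<Lambda> l)))"
    unfolding sum_distrib_left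
    by (intro sum.cong refl, subst power_mult_distrib[symmetric], subst power_int_add_1'[symmetric])
      (auto simp: algebra_simps)
  then have "(1 - q ^ n) * (\<Sum>l=1..J. ?f (int l - 1 - int (col_len \<Lambda> l)))
     = (\<Sum>l=1..J. ?f (int l - 1 - int (col_len \<Lambda> l))) - (\<Sum>l=1..J. ?f (int l - int (col_len \<Lambda> l)))"
    by (simp add: algebra_simps)
  also have "?f (int J) + ((\<Sum>l=1..J. ?f (int l - 1 - int (col_len \<Lambda> l))) - (\<Sum>l=1..J. ?f (int l - int (col_len \<Lambda> l))))
    = (\<Sum>x\<in>addable \<Lambda>. ?f (box_content x)) - (\<Sum>x\<in>removable \<Lambda>. ?f (box_content x))"
  proof -
    have "e + (d - b) = a - c" if "a + b = c + d + e" for a b c d e :: complex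
      using that by algebra
    from this[OF content_sum_telescope[OF assms(1) J, of ?f]] show ?thesis .
  qed
  finally show ?thesis .
qed

text \<open>The entry of a column in the spectrum is q to the content of its first free box. Filling
  that box lowers the exponent by 1 and changes no other entry.\<close>

lemma psum_insert:
  assumes "is_partition \<Lambda>" "x \<in> addable \<Lambda>" "n > 0"
  shows "psum (insert x \<Lambda>) n = psum \<Lambda> n + (q powi (box_content x - 1)) ^ n - (q powi box_content x) ^ n"
proof -
  obtain j where x: "x = (Suc (col_len \<Lambda> j), j)" "1 \<le> j"
    using assms(2) by (auto simp: addable_eq[OF assms(1)])
  obtain l where l: "j = Suc l" using x(2) by (cases j) auto
  have p: "is_partition (insert x \<Lambda>)" "x \<notin> \<Lambda>" using addable_insert[OF assms(1,2)] by blast+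
  have c: "col_len (insert x \<Lambda>) k = col_len \<Lambda> k + (if k = j then 1 else 0)" for k
    using col_len_insert[OF partition_finite[OF assms(1)] p(2)] x by simp
  let ?d = "\<lambda>i. if i = l then (q powi (box_content x - 1)) ^ n - (q powi box_content x) ^ n else 0"
  have eq: "col_spec q (insert x \<Lambda>) (Suc i) ^ n = col_spec q \<Lambda> (Suc i) ^ n + ?d i" for i
    unfolding col_spec_def c by (auto simp: l x box_content_def algebra_simps)
  have "psum (insert x \<Lambda>) n = (\<Sum>i. col_spec q \<Lambda> (Suc i) ^ n) + (\<Sum>i. ?d i)"
    unfolding psum_suminf[OF p(1) assms(3)] eq
    by (intro suminf_add[symmetric] summable_norm_cancel[OF summable_col_spec_power] assms summable_single)
  also have "(\<Sum>i. ?d i) = (q powi (box_content x - 1)) ^ n - (q powi box_content x) ^ n"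
    using sums_unique[OF sums_single[of l "\<lambda>_. (q powi (box_content x - 1)) ^ n - (q powi box_content x) ^ n"]] by simp
  finally show ?thesis
    unfolding psum_suminf[OF assms(1,3)] by simp
qed

end

section \<open>Matrix elements of the currents\<close>

lemma lin_fps_of_poly: "lin u = fps_of_poly [:1, - u:]"
  by (simp add: lin_def fps_of_poly_simps flip: fps_const_neg)

text \<open>Lagrange interpolation after clearing denominators: both sides are polynomials of degree
  below the number of nodes 1 / u(a) and agree at each of them.\<close>

lemma partial_fractions:
  fixes u w :: "'a \<Rightarrow> complex"
  assumes fin: "finite A" and card: "card R < card A" and inj: "inj_on u A" and nz: "\<And>a. a \<in> A \<Longrightarrow> u a \<noteq> 0"
  defines "c \<equiv> \<lambda>a. (\<Prod>r\<in>R. 1 - w r / u a) / (\<Prod>b\<in>A - {a}. 1 - u b / u a)"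
  shows "(\<Prod>r\<in>R. lin (w r)) * (\<Prod>a\<in>A. inverse (lin (u a))) = (\<Sum>a\<in>A. fps_const (c a) * inverse (lin (u a)))"
proof -
  define p where "p = (\<Prod>r\<in>R. [:1, - w r:])"
  define s where "s = (\<Sum>a\<in>A. smult (c a) (\<Prod>b\<in>A - {a}. [:1, - u b:]))"
  have deg: "degree (\<Prod>x\<in>B. [:1, - v x:]) \<le> card B" for B and v :: "'a \<Rightarrow> complex"
  proof (cases "finite B")
    case True
    have "degree (\<Prod>x\<in>B. [:1, - v x:]) \<le> (\<Sum>x\<in>B. degree [:1, - v x:])"
      using degree_prod_sum_le[OF True, of "\<lambda>x. [:1, - v x:]"] by (simp add: o_def)
    also have "\<dots> \<le> (\<Sum>x\<in>B. 1)" by (intro sum_mono) simp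
    finally show ?thesis by simp
  qed simp
  have "p = s"
  proof (rule poly_eqI_degree[of "(\<lambda>a. 1 / u a) ` A"])
    have "inj_on (\<lambda>a. 1 / u a) A"
      using inj by (auto simp: inj_on_def divide_simps)
    then have cA: "card ((\<lambda>a. 1 / u a) ` A) = card A" by (rule card_image)
    show "card ((\<lambda>a. 1 / u a) ` A) > degree p"
      unfolding cA p_def using deg[of w R] card by simp
    have "degree s \<le> card A - 1"
      unfolding s_def
    proof (rule degree_sum_le[OF fin])
      fix a assume "a \<in> A"
      then have "card (A - {a}) = card A - 1" using fin by simp
      then show "degree (smult (c a) (\<Prod>b\<in>A - {a}. [:1, - u b:])) \<le> card A - 1"
        using deg[of u "A - {a}"] degree_smult_le order_trans by metis
    qed
    then show "card ((\<lambda>a. 1 / u a) ` A) > degree s" unfolding cA using card by simp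
  next
    fix x assume "x \<in> (\<lambda>a. 1 / u a) ` A"
    then obtain a where a: "a \<in> A" "x = 1 / u a" by auto
    have z: "(\<Prod>b\<in>A - {e}. 1 - u b / u a) = 0" if "e \<in> A" "e \<noteq> a" for e
      using that a fin nz by (intro prod_zero) (auto intro!: bexI[of _ a])
    have nz': "(\<Prod>b\<in>A - {a}. 1 - u b / u a) \<noteq> 0"
      using fin inj a nz by (auto simp: inj_on_def)
    have "poly s x = (\<Sum>e\<in>A. c e * (\<Prod>b\<in>A - {e}. 1 - u b / u a))"
      by (simp add: s_def poly_sum poly_prod a mult.commute)
    also have "\<dots> = c a * (\<Prod>b\<in>A - {a}. 1 - u b / u a)"
    proof -
      have "(\<Sum>e\<in>A - {a}. c e * (\<Prod>b\<in>A - {e}. 1 - u b / u a)) = 0"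
        by (rule sum.neutral) (simp add: z)
      then show ?thesis by (simp add: sum.remove[OF fin a(1)])
    qed
    also have "\<dots> = poly p x"
      using nz' by (simp add: c_def p_def poly_prod a mult.commute)
    finally show "poly p x = poly s x" ..
  qed
  then have "fps_of_poly p = fps_of_poly s" by (rule arg_cong)
  then have "(\<Prod>r\<in>R. lin (w r)) = (\<Sum>a\<in>A. fps_const (c a) * (\<Prod>b\<in>A - {a}. lin (u b)))"
    unfolding p_def s_def lin_fps_of_poly fps_of_poly_prod fps_of_poly_sum fps_of_poly_smult .
  then have "(\<Prod>r\<in>R. lin (w r)) * (\<Prod>a\<in>A. inverse (lin (u a)))
      = (\<Sum>a\<in>A. fps_const (c a) * ((\<Prod>b\<in>A - {a}. lin (u b)) * (\<Prod>b\<in>A. inverse (lin (u b)))))"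
    by (simp add: sum_distrib_right mult.assoc)
  also have "\<dots> = (\<Sum>a\<in>A. fps_const (c a) * inverse (lin (u a)))"
  proof (intro sum.cong refl)
    fix a assume a: "a \<in> A"
    have "(\<Prod>b\<in>A - {a}. lin (u b)) * (\<Prod>b\<in>A - {a}. inverse (lin (u b))) = 1"
      by (simp flip: prod.distrib)
    then show "fps_const (c a) * ((\<Prod>b\<in>A - {a}. lin (u b)) * (\<Prod>b\<in>A. inverse (lin (u b)))) = fps_const (c a) * inverse (lin (u a))"
      using prod.remove[OF fin a, of "\<lambda>b. inverse (lin (u b))"] by (simp add: mult_ac)
  qed
  finally show ?thesis .
qed

context nome
begin

definition chi :: "nat \<times> nat \<Rightarrow> complex" where "chi x = q powi box_content x"

lemma chi_nonzero [simp]: "chi x \<noteq> 0"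
  by (simp add: chi_def)

lemma chi_swap: "chi (prod.swap x) = inverse (chi x)"
  by (simp add: chi_def power_int_minus)

lemma chi_eq_iff: "chi x = chi y \<longleftrightarrow> box_content x = box_content y"
proof
  assume "chi x = chi y"
  then have "q powi (box_content x - box_content y) = 1"
    by (simp add: chi_def power_int_diff)
  then show "box_content x = box_content y" by (simp add: q_powi_eq_1_iff)
qed (simp add: chi_def)

lemma prod_chi: "(\<Prod>x\<in>A. chi x) = q powi (\<Sum>x\<in>A. box_content x)"
  by (induction A rule: infinite_finite_induct) (simp_all add: chi_def power_int_add)

text \<open>\<open>ann \<mu>\<close> is the series in \<open>v/z\<close> by which the annihilation part of \<open>x\<^sup>+\<close> acts on \<open>|\<mu>\<rangle>\<close>, and \<open>cre \<mu>\<close>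
  the series in \<open>z/v\<close> by which its creation part acts on \<open>\<langle>\<mu>|\<close> from the right.  The residue of \<open>ann \<mu>\<close> at
  an addable box \<open>x\<close> is \<open>alpha \<mu> x\<close>.\<close>

definition ann :: "diagram \<Rightarrow> complex fps" where
  "ann \<mu> = (\<Prod>r\<in>removable \<mu>. lin (chi r)) * (\<Prod>a\<in>addable \<mu>. inverse (lin (chi a)))"

definition cre :: "diagram \<Rightarrow> complex fps" where
  "cre \<mu> = (\<Prod>a\<in>addable \<mu>. lin (inverse (chi a))) * (\<Prod>r\<in>removable \<mu>. inverse (lin (inverse (chi r))))"

definition alpha :: "diagram \<Rightarrow> nat \<times> nat \<Rightarrow> complex" where
  "alpha \<mu> x = (\<Prod>r\<in>removable \<mu>. 1 - chi r / chi x) / (\<Prod>a\<in>addable \<mu> - {x}. 1 - chi a / chi x)"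

lemma ann_exp:
  assumes "is_partition \<mu>" shows "exp_fps (\<lambda>n. (1 - q ^ n) * psum \<mu> n / of_nat n) = ann \<mu>"
  unfolding ann_def exp_fps_lin_ratio[OF finite_addable[OF assms] finite_removable[OF assms], symmetric] chi_def
  by (rule exp_fps_cong) (simp add: psum_content[OF assms])

lemma cre_transpose: "cre (conjugate \<mu>) = (\<Prod>a\<in>addable \<mu>. lin (chi a)) * (\<Prod>r\<in>removable \<mu>. inverse (lin (chi r)))"
  unfolding cre_def addable_transpose removable_transpose
  by (simp add: prod.reindex chi_swap)

lemma cre_exp_transpose:
  assumes "is_partition \<mu>"
  shows "exp_fps (\<lambda>n. - ((1 - q ^ n) * psum \<mu> n / of_nat n)) = cre (conjugate \<mu>)"
  unfolding cre_transpose exp_fps_lin_ratio[OF finite_removable[OF assms] finite_addable[OF assms], symmetric] chi_def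
  by (rule exp_fps_cong) (simp add: psum_content[OF assms] divide_simps)

lemma cre_exp:
  assumes "is_partition \<mu>"
  shows "exp_fps (\<lambda>n. - ((1 - q ^ n) * psum (conjugate \<mu>) n / of_nat n)) = cre \<mu>"
  using cre_exp_transpose[of "conjugate \<mu>"] assms by simp

text \<open>The two exponents are negatives of each other. This is the power series form of the
  reciprocity between the two halves of a current on one diagram.\<close>

lemma ann_transpose_mult_cre:
  assumes "is_partition \<mu>" shows "ann (conjugate \<mu>) * cre \<mu> = 1"
proof -
  have "exp_fps (\<lambda>n. (1 - q ^ n) * psum (conjugate \<mu>) n / of_nat n
     + - ((1 - q ^ n) * psum (conjugate \<mu>) n / of_nat n)) = 1"
    by (simp add: exp_fps_zero)
  then show ?thesis
    unfolding exp_fps_add using ann_exp[of "conjugate \<mu>"] cre_exp[OF assms] assms by simp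
qed

lemma ann_partial_fractions:
  assumes "is_partition \<mu>"
  shows "ann \<mu> = (\<Sum>a\<in>addable \<mu>. fps_const (alpha \<mu> a) * inverse (lin (chi a)))"
  unfolding ann_def alpha_def
  by (rule partial_fractions)
     (use card_addable[OF assms] finite_addable[OF assms] content_inj_addable[OF assms]
      in \<open>auto simp: inj_on_def chi_eq_iff\<close>)

text \<open>Each factor obeys 1 - \<chi>_x / \<chi>_a = - (\<chi>_x / \<chi>_a) (1 - \<chi>_a /
  \<chi>_x). Numerator and denominator have equally many factors, so signs and powers of \<chi>_x
  cancel. The products of the weights differ by \<chi>_x because the contents of addable and
  removable boxes have equal sums.\<close>

lemma alpha_transpose:
  assumes "is_partition \<mu>" "x \<in> addable \<mu>"
  shows "alpha (conjugate \<mu>) (prod.swap x) = alpha \<mu> x / chi x"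
proof -
  let ?A = "addable \<mu> - {x}" and ?R = "removable \<mu>"
  have fin: "finite ?A" "finite (addable \<mu>)" "finite ?R"
    using finite_addable finite_removable assms by auto
  have card: "card ?A = card ?R" using card_addable[OF assms(1)] assms(2) fin by simp
  have flip: "(\<Prod>a\<in>B. 1 - chi x / chi a) = (- chi x) ^ card B / (\<Prod>a\<in>B. chi a) * (\<Prod>a\<in>B. 1 - chi a / chi x)" for B
  proof -
    have "(\<Prod>a\<in>B. 1 - chi x / chi a) = (\<Prod>a\<in>B. (- chi x) / chi a * (1 - chi a / chi x))"
      by (intro prod.cong) (auto simp: field_simps)
    then show ?thesis by (simp only: prod.distrib prod_dividef prod_constant)
  qed
  have "(\<Prod>a\<in>addable \<mu>. chi a) = (\<Prod>a\<in>?R. chi a)"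
    unfolding prod_chi sum_content_addable[OF assms(1)] ..
  then have c: "chi x * (\<Prod>a\<in>?A. chi a) = (\<Prod>a\<in>?R. chi a)"
    using prod.remove[OF fin(2) assms(2), of chi] by simp
  have "prod.swap ` addable \<mu> - {prod.swap x} = prod.swap ` ?A"
    by (simp add: image_set_diff[OF inj_swap])
  then have "alpha (conjugate \<mu>) (prod.swap x) = (\<Prod>r\<in>?R. 1 - chi x / chi r) / (\<Prod>a\<in>?A. 1 - chi x / chi a)"
    unfolding alpha_def addable_transpose removable_transpose
    by (simp add: prod.reindex chi_swap divide_inverse mult.commute)
  also have "\<dots> = alpha \<mu> x * ((\<Prod>a\<in>?A. chi a) / (\<Prod>a\<in>?R. chi a))"
    unfolding flip card alpha_def by (simp add: field_simps)
  also have "(\<Prod>a\<in>?A. chi a) / (\<Prod>a\<in>?R. chi a) = 1 / chi x"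
    unfolding c[symmetric] using fin by simp
  finally show ?thesis by simp
qed

text \<open>\<open>pair_fps \<Lambda> \<mu>\<close> is \<open>\<langle>\<Lambda>|t\<^sup>L|\<mu>\<rangle>\<close> without the normalization factors.\<close>

definition pair_fps :: "diagram \<Rightarrow> diagram \<Rightarrow> complex fps" where
  "pair_fps \<Lambda> \<mu> = exp_fps (\<lambda>n. - (q ^ n * psum (conjugate \<Lambda>) n * psum \<mu> n / of_nat n))"

definition pair_val :: "diagram \<Rightarrow> diagram \<Rightarrow> complex" where
  "pair_val \<Lambda> \<mu> = (\<Prod>i. \<Prod>j. 1 - q powi
     (- int (row_len \<Lambda> (Suc i)) - int (col_len \<mu> (Suc j)) + int (Suc i) + int (Suc j) - 1))"

lemma pair_val_hook_prod: "pair_val \<mu> \<mu> = hook_prod \<mu> q"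
  by (simp add: pair_val_def hook_prod_def)

lemma pair_fps_transpose: "pair_fps (conjugate \<mu>) (conjugate \<Lambda>) = pair_fps \<Lambda> \<mu>"
  by (simp add: pair_fps_def mult_ac)

text \<open>By \<open>psum_insert\<close> the exponent changes by - (1 - q^n) p_n \<chi>_x^n / n
  with the power sums p_n of the transposed bra diagram. This is the exponent of
  \<open>cre \<Lambda>\<close> after dilation by \<chi>_x.\<close>

lemma pair_fps_insert:
  assumes "is_partition \<Lambda>" "is_partition \<mu>" "x \<in> addable \<mu>"
  shows "pair_fps \<Lambda> (insert x \<mu>) = pair_fps \<Lambda> \<mu> * dilate (chi x) (cre \<Lambda>)"
proof -
  have "pair_fps \<Lambda> (insert x \<mu>) = exp_fps (\<lambda>n. - (q ^ n * psum (conjugate \<Lambda>) n * psum \<mu> n / of_nat n)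
     + chi x ^ n * - ((1 - q ^ n) * psum (conjugate \<Lambda>) n / of_nat n))"
    unfolding pair_fps_def
  proof (rule exp_fps_cong)
    fix n :: nat assume "n > 0"
    have "q ^ n * (q powi (box_content x - 1)) ^ n = chi x ^ n"
      unfolding power_mult_distrib[symmetric] chi_def by (simp add: power_int_diff)
    then show "- (q ^ n * psum (conjugate \<Lambda>) n * psum (insert x \<mu>) n / of_nat n)
      = - (q ^ n * psum (conjugate \<Lambda>) n * psum \<mu> n / of_nat n)
     + chi x ^ n * - ((1 - q ^ n) * psum (conjugate \<Lambda>) n / of_nat n)"
      unfolding psum_insert[OF assms(2,3) \<open>n > 0\<close>] chi_def[symmetric] using \<open>n > 0\<close> by (simp add: field_simps)
  qed
  then show ?thesis
    unfolding exp_fps_add pair_fps_def[symmetric] dilate_exp_fps[symmetric] cre_exp[OF assms(1)] .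
qed

text \<open>The series expands \<Prod> (1 - t s_i c_j), with s the row spectrum of \<Lambda> and c
  the column spectrum of \<mu>. This is entire in t. The product converges absolutely, so at t = 1
  it vanishes only if some factor does, that is, if some exponent of q is 0; by the Maya diagrams
  this happens exactly for distinct partitions.\<close>

lemma pair_cval_and_zero:
  assumes "is_partition \<Lambda>" "is_partition \<mu>"
  shows cval_pair: "cval (pair_fps \<Lambda> \<mu>) (pair_val \<Lambda> \<mu>)"
    and pair_val_eq_0_iff: "pair_val \<Lambda> \<mu> = 0 \<longleftrightarrow> \<Lambda> \<noteq> \<mu>"
proof -
  let ?c = "\<lambda>j. col_spec q \<mu> (Suc j)" and ?s = "\<lambda>i. row_spec q \<Lambda> (Suc i)"
  have T: "is_partition (conjugate \<Lambda>)" using assms by simp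
  have row: "row_spec q \<Lambda> l = q * col_spec q (conjugate \<Lambda>) l" for l
    unfolding row_spec_def col_spec_def
    by (subst power_int_add_1'[symmetric]) (auto simp: algebra_simps)
  have sc: "?s i * ?c j = q powi (- int (row_len \<Lambda> (Suc i)) - int (col_len \<mu> (Suc j)) + int (Suc i) + int (Suc j) - 1)" for i j
    unfolding row_spec_def col_spec_def
    by (subst power_int_add[symmetric]) (auto simp: algebra_simps)
  note sumc = summable_col_spec[OF assms(2)]
  have sums: "summable (\<lambda>i. norm (?s i))"
    unfolding row norm_mult using summable_col_spec[OF T] by (intro summable_mult) simp
  have holo1: "(\<lambda>x. 1 - x) holomorphic_on (UNIV :: complex set)"
    by (intro holomorphic_intros)
  have "(\<lambda>x. 1 - x) has_fps_expansion (1 - fps_X :: complex fps)"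
    by (intro fps_expansion_intros)
  then have fps1: "(\<lambda>x. 1 - x) has_fps_expansion exp_fps (\<lambda>n. - (1 ^ n) / of_nat n)"
    unfolding exp_fps_lin by (simp add: lin_def)
  \<comment> \<open>The double product is built in two rounds: over j with the base function 1 - x,
    and over i with the resulting entire function \<open>C\<close>.\<close>
  define C where "C = (\<lambda>x. \<Prod>j. 1 - x * ?c j)"
  have holoC: "C holomorphic_on UNIV"
    unfolding C_def by (rule scaled_prod_holomorphic[OF holo1 fps1 sumc])
  have fpsC: "C has_fps_expansion exp_fps (\<lambda>n. - (1 ^ n) / of_nat n * (\<Sum>j. ?c j ^ n))"
    unfolding C_def by (rule scaled_prod_expansion[OF holo1 fps1 sumc])
  have C0: "C x = 0 \<longleftrightarrow> (\<exists>j. x * ?c j = 1)" for x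
    unfolding C_def using scaled_prod_eq_0_iff[OF holo1 fps1 sumc, of x] by (metis eq_iff_diff_eq_0)
  have val: "(\<Prod>i. C (1 * ?s i)) = pair_val \<Lambda> \<mu>"
    unfolding C_def pair_val_def mult_1 sc ..
  have "exp_fps (\<lambda>n. - (1 ^ n) / of_nat n * (\<Sum>j. ?c j ^ n) * (\<Sum>i. ?s i ^ n)) = pair_fps \<Lambda> \<mu>"
    unfolding pair_fps_def
  proof (rule exp_fps_cong)
    fix n :: nat assume n: "n > 0"
    have "(\<Sum>i. ?s i ^ n) = q ^ n * psum (conjugate \<Lambda>) n"
      unfolding row power_mult_distrib psum_suminf[OF T n]
      by (rule suminf_mult[OF summable_norm_cancel[OF summable_col_spec_power[OF T n]]])
    then show "- (1 ^ n) / of_nat n * (\<Sum>j. ?c j ^ n) * (\<Sum>i. ?s i ^ n)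
       = - (q ^ n * psum (conjugate \<Lambda>) n * psum \<mu> n / of_nat n)"
      unfolding psum_suminf[OF assms(2) n] by simp
  qed
  with scaled_prod_expansion[OF holoC fpsC sums]
  have "(\<lambda>t. \<Prod>i. C (t * ?s i)) has_fps_expansion pair_fps \<Lambda> \<mu>" by simp
  from cval_entire[OF scaled_prod_holomorphic[OF holoC fpsC sums] this]
  show "cval (pair_fps \<Lambda> \<mu>) (pair_val \<Lambda> \<mu>)" unfolding val .
  have "pair_val \<Lambda> \<mu> = 0 \<longleftrightarrow> (\<exists>i j. ?s i * ?c j = 1)"
    unfolding val[symmetric] scaled_prod_eq_0_iff[OF holoC fpsC sums] C0 by simp
  also have "\<dots> \<longleftrightarrow> (\<exists>i j. row_len \<Lambda> (Suc i) + col_len \<mu> (Suc j) + 1 = Suc i + Suc j)"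
    unfolding sc q_powi_eq_1_iff by (intro ex_cong1) linarith
  also have "\<dots> \<longleftrightarrow> \<Lambda> \<noteq> \<mu>"
  proof
    assume "\<Lambda> \<noteq> \<mu>"
    then obtain i j where ij: "i \<ge> 1" "j \<ge> 1" "row_len \<Lambda> i + col_len \<mu> j + 1 = i + j"
      using distinct_partitions_hook[OF assms] by blast
    then have "i = Suc (i - 1)" "j = Suc (j - 1)" by linarith+
    with ij(3) show "\<exists>i j. row_len \<Lambda> (Suc i) + col_len \<mu> (Suc j) + 1 = Suc i + Suc j" by metis
  next
    assume "\<exists>i j. row_len \<Lambda> (Suc i) + col_len \<mu> (Suc j) + 1 = Suc i + Suc j"
    then show "\<Lambda> \<noteq> \<mu>"
      using partition_diagonal_hook[OF assms(1)] by (metis One_nat_def Suc_le_mono le0)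
  qed
  finally show "pair_val \<Lambda> \<mu> = 0 \<longleftrightarrow> \<Lambda> \<noteq> \<mu>" .
qed

section \<open>Modes of the current between S-dual states\<close>

definition vertex_fps :: "int \<Rightarrow> diagram \<Rightarrow> diagram \<Rightarrow> complex fps" where
  "vertex_fps k \<Lambda> \<mu> = Abs_fps (\<lambda>j. if k \<le> int j then fps_nth (ann \<mu>) (nat (int j - k)) * fps_nth (cre \<Lambda>) j else 0)"

lemma ann_nth:
  assumes "is_partition \<mu>" shows "fps_nth (ann \<mu>) m = (\<Sum>a\<in>addable \<mu>. alpha \<mu> a * chi a ^ m)"
  unfolding ann_partial_fractions[OF assms] by (simp add: fps_sum_nth inverse_lin)

text \<open>By partial fractions the coefficients of \<open>ann \<mu>\<close> are combinations of
  powers \<chi>_a^m, and such a power dilates \<open>cre \<Lambda>\<close>. The dilated series also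
  contains the terms j < k, which are subtracted; for k \<le> 0 there are none, as
  \<open>nat k\<close> is 0.\<close>

lemma vertex_fps_decomp:
  assumes "is_partition \<mu>"
  shows "vertex_fps k \<Lambda> \<mu> = (\<Sum>a\<in>addable \<mu>. fps_const (alpha \<mu> a * chi a powi (- k)) *
    (dilate (chi a) (cre \<Lambda>) - Abs_fps (\<lambda>n. if n < nat k then chi a ^ n * fps_nth (cre \<Lambda>) n else 0)))"
proof (rule fps_ext)
  fix j
  have "fps_nth (vertex_fps k \<Lambda> \<mu>) j = (\<Sum>a\<in>addable \<mu>. if k \<le> int j then alpha \<mu> a * chi a ^ nat (int j - k) * fps_nth (cre \<Lambda>) j else 0)"
    by (simp add: vertex_fps_def ann_nth[OF assms] sum_distrib_right)
  also have "\<dots> = (\<Sum>a\<in>addable \<mu>. alpha \<mu> a * chi a powi (- k) *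
    (chi a ^ j * fps_nth (cre \<Lambda>) j - (if j < nat k then chi a ^ j * fps_nth (cre \<Lambda>) j else 0)))"
  proof (intro sum.cong refl)
    fix a
    have "chi a ^ nat (int j - k) = chi a powi (- k) * chi a ^ j" if "k \<le> int j"
    proof -
      have "chi a ^ nat (int j - k) = chi a powi (int j - k)" using that by (simp add: power_int_def)
      also have "\<dots> = chi a powi (- k) * chi a powi int j"
        by (subst power_int_add[symmetric]) (auto simp: algebra_simps)
      finally show ?thesis by simp
    qed
    then show "(if k \<le> int j then alpha \<mu> a * chi a ^ nat (int j - k) * fps_nth (cre \<Lambda>) j else 0)
      = alpha \<mu> a * chi a powi (- k) *
    (chi a ^ j * fps_nth (cre \<Lambda>) j - (if j < nat k then chi a ^ j * fps_nth (cre \<Lambda>) j else 0))"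
      by (auto simp: zless_nat_eq_int_zless)
  qed
  finally show "fps_nth (vertex_fps k \<Lambda> \<mu>) j = fps_nth (\<Sum>a\<in>addable \<mu>. fps_const (alpha \<mu> a * chi a powi (- k)) *
    (dilate (chi a) (cre \<Lambda>) - Abs_fps (\<lambda>n. if n < nat k then chi a ^ n * fps_nth (cre \<Lambda>) n else 0))) j"
    by (simp add: fps_sum_nth)
qed

text \<open>For \<open>\<Lambda> = \<mu>\<close> the two parts of the current cancel up to a monomial,
  \<open>cre \<mu> w \<cdot> ann \<mu> (1/w) = - w\<close> as rational functions; the truncation picks up its coefficient.\<close>

lemma vertex_truncation_diagonal:
  assumes "is_partition \<mu>"
  shows "(\<Sum>a\<in>addable \<mu>. alpha \<mu> a * chi a powi (- k) * (\<Sum>n<nat k. chi a ^ n * fps_nth (cre \<mu>) n)) = (if k = 1 then 1 else 0)"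
proof (cases "k > 0")
  case True
  \<comment> \<open>The sum will turn out to be the coefficient of index k - 1 in a product equal to
    1, so only k = 1 contributes.\<close>
  define K where "K = nat k - 1"
  have k: "k = int (Suc K)" "nat k = Suc K" using True by (auto simp: K_def)
  let ?T = "conjugate \<mu>"
  have "(\<Sum>a\<in>addable \<mu>. alpha \<mu> a * chi a powi (- k) * (\<Sum>n<nat k. chi a ^ n * fps_nth (cre \<mu>) n))
    = (\<Sum>a\<in>addable \<mu>. \<Sum>n=0..K. alpha \<mu> a / chi a * inverse (chi a) ^ (K - n) * fps_nth (cre \<mu>) n)"
  proof (intro sum.cong refl)
    fix a
    have *: "chi a powi (- k) * chi a ^ n = inverse (chi a) ^ (K - n) / chi a" if "n \<in> {0..K}" for n
    proof -
      have "Suc K = Suc (K - n) + n" using that by auto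
      then have "chi a ^ Suc K = chi a ^ (K - n) * chi a * chi a ^ n"
        by (metis power_add power_Suc2)
      then show ?thesis unfolding k power_int_minus power_int_of_nat by (simp add: field_simps)
    qed
    have "alpha \<mu> a * chi a powi (- k) * (chi a ^ n * fps_nth (cre \<mu>) n)
      = alpha \<mu> a / chi a * inverse (chi a) ^ (K - n) * fps_nth (cre \<mu>) n" if "n \<in> {0..K}" for n
    proof -
      have "alpha \<mu> a * chi a powi (- k) * (chi a ^ n * fps_nth (cre \<mu>) n)
        = alpha \<mu> a * (chi a powi (- k) * chi a ^ n) * fps_nth (cre \<mu>) n"
        by (simp only: mult.assoc)
      also have "chi a powi (- k) * chi a ^ n = inverse (chi a) ^ (K - n) / chi a"
        by (rule *[OF that])
      finally show ?thesis by simp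
    qed
    then show "alpha \<mu> a * chi a powi (- k) * (\<Sum>n<nat k. chi a ^ n * fps_nth (cre \<mu>) n)
      = (\<Sum>n=0..K. alpha \<mu> a / chi a * inverse (chi a) ^ (K - n) * fps_nth (cre \<mu>) n)"
      unfolding k(2) sum_distrib_left lessThan_Suc_atMost atMost_atLeast0
      by (rule sum.cong[OF refl])
  qed
  also have "\<dots> = (\<Sum>n=0..K. (\<Sum>a\<in>addable \<mu>. alpha \<mu> a / chi a * inverse (chi a) ^ (K - n)) * fps_nth (cre \<mu>) n)"
    unfolding sum_distrib_right by (rule sum.swap)
  also have "\<dots> = (\<Sum>n=0..K. fps_nth (cre \<mu>) n * fps_nth (ann ?T) (K - n))"
  proof (intro sum.cong refl)
    fix n
    \<comment> \<open>By \<open>alpha_transpose\<close> the numbers \<alpha>_a / \<chi>_a are the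
      residues of the transposed diagram, and its weights are the inverses of the \<chi>_a.\<close>
    have "fps_nth (ann ?T) (K - n) = (\<Sum>a\<in>addable \<mu>. alpha \<mu> a / chi a * inverse (chi a) ^ (K - n))"
      using assms by (simp add: ann_nth addable_transpose sum.reindex alpha_transpose chi_swap cong: sum.cong)
    then show "(\<Sum>a\<in>addable \<mu>. alpha \<mu> a / chi a * inverse (chi a) ^ (K - n)) * fps_nth (cre \<mu>) n
      = fps_nth (cre \<mu>) n * fps_nth (ann ?T) (K - n)" by simp
  qed
  also have "\<dots> = fps_nth (cre \<mu> * ann ?T) K" by (simp add: fps_mult_nth)
  also have "cre \<mu> * ann ?T = 1" using ann_transpose_mult_cre[OF assms] by (simp add: mult.commute)
  finally show ?thesis using k by auto
qed simp

lemma cval_vertex: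
  assumes L: "is_partition \<Lambda>" and M: "is_partition \<mu>"
  shows "cval (pair_fps \<Lambda> \<mu> * vertex_fps k \<Lambda> \<mu>)
    ((\<Sum>a\<in>addable \<mu>. if \<Lambda> = insert a \<mu> then alpha \<mu> a * chi a powi (- k) * pair_val \<Lambda> \<Lambda> else 0)
      - (if \<Lambda> = \<mu> \<and> k = 1 then pair_val \<mu> \<mu> else 0))"
proof -
  let ?c = "\<lambda>a. alpha \<mu> a * chi a powi (- k)"
  let ?t = "\<lambda>a. Abs_fps (\<lambda>n. if n < nat k then chi a ^ n * fps_nth (cre \<Lambda>) n else 0)"
  let ?s = "\<lambda>a. \<Sum>n<nat k. chi a ^ n * fps_nth (cre \<Lambda>) n"
  \<comment> \<open>The dilated series cannot be evaluated alone: for \<Lambda> = \<mu> + a it has a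
    pole at t = 1, where \<open>pair_fps \<Lambda> \<mu>\<close> has a zero. Absorbing it into the
    pairing with \<mu> + a resolves this.\<close>
  have "pair_fps \<Lambda> \<mu> * vertex_fps k \<Lambda> \<mu> = (\<Sum>a\<in>addable \<mu>. fps_const (?c a) * (pair_fps \<Lambda> (insert a \<mu>) - pair_fps \<Lambda> \<mu> * ?t a))"
    unfolding vertex_fps_decomp[OF M] sum_distrib_left
    by (intro sum.cong) (auto simp: pair_fps_insert[OF L M] algebra_simps)
  moreover have "cval (\<Sum>a\<in>addable \<mu>. fps_const (?c a) * (pair_fps \<Lambda> (insert a \<mu>) - pair_fps \<Lambda> \<mu> * ?t a))
    (\<Sum>a\<in>addable \<mu>. ?c a * (pair_val \<Lambda> (insert a \<mu>) - pair_val \<Lambda> \<mu> * ?s a))"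
    using L M addable_insert[OF M]
    by (intro cval_sum cval_cmult cval_diff cval_mult cval_truncated cval_pair) auto
  moreover have "(\<Sum>a\<in>addable \<mu>. ?c a * (pair_val \<Lambda> (insert a \<mu>) - pair_val \<Lambda> \<mu> * ?s a))
    = (\<Sum>a\<in>addable \<mu>. ?c a * pair_val \<Lambda> (insert a \<mu>)) - pair_val \<Lambda> \<mu> * (\<Sum>a\<in>addable \<mu>. ?c a * ?s a)"
    by (simp add: sum_subtractf sum_distrib_left algebra_simps)
  moreover have "(\<Sum>a\<in>addable \<mu>. ?c a * pair_val \<Lambda> (insert a \<mu>))
    = (\<Sum>a\<in>addable \<mu>. if \<Lambda> = insert a \<mu> then ?c a * pair_val \<Lambda> \<Lambda> else 0)"
    using L M addable_insert[OF M] by (intro sum.cong) (auto simp: pair_val_eq_0_iff)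
  moreover have "pair_val \<Lambda> \<mu> * (\<Sum>a\<in>addable \<mu>. ?c a * ?s a) = (if \<Lambda> = \<mu> \<and> k = 1 then pair_val \<mu> \<mu> else 0)"
    using pair_val_eq_0_iff[OF L M] vertex_truncation_diagonal[OF M, of k] by auto
  ultimately show ?thesis by simp
qed

end

section \<open>Normalization factors\<close>

text \<open>The condition inside \<open>holo_sqrt\<close>, isolated so that roots can be multiplied.
  With F = g^2 it says only that g is holomorphic in the disc and positive on (0, 1).\<close>

definition holomorphic_root :: "(complex \<Rightarrow> complex) \<Rightarrow> (complex \<Rightarrow> complex) \<Rightarrow> bool" where
  "holomorphic_root F g \<longleftrightarrow> g holomorphic_on ball 0 1 \<and> (\<forall>z \<in> ball 0 1 - {0}. g z ^ 2 = F z) \<and>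
     (\<forall>x::real. 0 < x \<and> x < 1 \<longrightarrow> (\<exists>y>0. g (of_real x) = of_real y))"

text \<open>On (0, 1) two positive numbers with equal squares coincide, and this interval
  accumulates at the interior point 0 of the disc.\<close>

lemma holomorphic_root_unique:
  assumes f: "holomorphic_root F f" and g: "holomorphic_root F g" and w: "w \<in> ball 0 1"
  shows "f w = g w"
proof -
  let ?U = "complex_of_real ` {0<..<1}"
  have "f w - g w = 0"
  proof (rule analytic_continuation[of "\<lambda>z. f z - g z" "ball 0 1" ?U 0])
    show "(\<lambda>z. f z - g z) holomorphic_on ball 0 1"
      using f g by (intro holomorphic_intros) (simp_all add: holomorphic_root_def)
    show "(0::complex) islimpt ?U"
      unfolding islimpt_approachable
    proof (intro allI impI)
      fix e :: real assume "e > 0"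
      then obtain y where y: "0 < y" "y < 1" "y < e"
        using field_lbound_gt_zero[of e 1] by auto
      then have "of_real y \<in> ?U" "of_real y \<noteq> (0::complex)" "dist (of_real y) (0::complex) < e"
        by simp_all
      then show "\<exists>x'\<in>?U. x' \<noteq> 0 \<and> dist x' 0 < e" by blast
    qed
  next
    fix z assume "z \<in> ?U"
    then obtain x where x: "z = of_real x" "0 < x" "x < 1" by auto
    then obtain a b where a: "f z = of_real a" "a > 0" and b: "g z = of_real b" "b > 0"
      using f g unfolding holomorphic_root_def by metis
    have "z \<in> ball 0 1 - {0}" using x by simp
    then have "f z ^ 2 = g z ^ 2" using f g unfolding holomorphic_root_def by metis
    then have "a ^ 2 = b ^ 2" unfolding a b by (metis of_real_eq_iff of_real_power)
    then have "a = b" using a b by (simp add: power2_eq_iff)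
    then show "f z - g z = 0" using a b by simp
  qed (use w in auto)
  then show ?thesis by simp
qed

lemma holo_sqrt_eq:
  assumes g: "holomorphic_root F g" and q: "q \<in> ball 0 1" shows "holo_sqrt F q = g q"
  unfolding holo_sqrt_def
proof (rule the_equality)
  show "\<exists>f. f holomorphic_on ball 0 1 \<and> (\<forall>z \<in> ball 0 1 - {0}. f z ^ 2 = F z) \<and>
     (\<forall>x::real. 0 < x \<and> x < 1 \<longrightarrow> (\<exists>y>0. f (of_real x) = of_real y)) \<and> g q = f q"
    using g unfolding holomorphic_root_def by blast
next
  fix w assume "\<exists>f. f holomorphic_on ball 0 1 \<and> (\<forall>z \<in> ball 0 1 - {0}. f z ^ 2 = F z) \<and>
     (\<forall>x::real. 0 < x \<and> x < 1 \<longrightarrow> (\<exists>y>0. f (of_real x) = of_real y)) \<and> w = f q"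
  then obtain f where "holomorphic_root F f" "w = f q"
    unfolding holomorphic_root_def by blast
  then show "w = g q" using holomorphic_root_unique[OF _ g q] by blast
qed

lemma holomorphic_root_mult:
  assumes "holomorphic_root F f" and "holomorphic_root G g"
    and "\<And>z. z \<in> ball 0 1 - {0} \<Longrightarrow> H z = F z * G z"
  shows "holomorphic_root H (\<lambda>z. f z * g z)"
  unfolding holomorphic_root_def
proof (intro conjI ballI allI impI)
  show "(\<lambda>z. f z * g z) holomorphic_on ball 0 1"
    using assms(1,2) by (intro holomorphic_intros) (simp_all add: holomorphic_root_def)
  show "(f z * g z)\<^sup>2 = H z" if "z \<in> ball 0 1 - {0}" for z
    using assms that by (simp add: holomorphic_root_def power_mult_distrib)
  show "\<exists>y>0. f (of_real x) * g (of_real x) = of_real y" if "0 < x \<and> x < 1" for x :: real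
  proof -
    obtain a b where "a > 0" "f (of_real x) = of_real a" "b > 0" "g (of_real x) = of_real b"
      using assms(1,2) \<open>0 < x \<and> x < 1\<close> unfolding holomorphic_root_def by metis
    then show ?thesis by (intro exI[of _ "a * b"]) simp
  qed
qed

lemma holomorphic_root_id_power: "holomorphic_root (\<lambda>z. (z ^ n) ^ 2) (\<lambda>z. z ^ n)"
  unfolding holomorphic_root_def
proof (intro conjI ballI allI impI)
  show "\<exists>y>0. complex_of_real x ^ n = of_real y" if "0 < x \<and> x < 1" for x :: real
    using that by (intro exI[of _ "x ^ n"]) simp
qed (auto intro!: holomorphic_intros)

subsection \<open>Adding a box\<close>

lemma nomeI: "z \<in> ball 0 1 - {0} \<Longrightarrow> nome z"
  by unfold_locales auto

context nome
begin

lemma alpha_nonzero: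
  assumes "is_partition \<mu>" "x \<in> addable \<mu>" shows "alpha \<mu> x \<noteq> 0"
proof -
  have "chi a \<noteq> chi x" if "a \<in> addable \<mu> - {x}" for a
    using that assms(2) content_inj_addable[OF assms(1)] by (auto simp: chi_eq_iff inj_on_def)
  moreover have "chi r \<noteq> chi x" if "r \<in> removable \<mu>" for r
    using content_addable_removable[OF assms(1,2) that] by (metis chi_eq_iff)
  ultimately show ?thesis
    using finite_addable[OF assms(1)] finite_removable[OF assms(1)] by (auto simp: alpha_def)
qed

text \<open>The linear factor of x itself becomes 1 - t, and what remains has at t = 1 the value of
  the reciprocal of the residue. This isolates the simple zero.\<close>

lemma dilate_cre_transpose:
  assumes "is_partition \<mu>" "x \<in> addable \<mu>"
  obtains F where "dilate (inverse (chi x)) (cre (conjugate \<mu>)) = lin 1 * F" "cval F (1 / alpha \<mu> x)"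
proof -
  define F where "F = (\<Prod>a\<in>addable \<mu> - {x}. lin (chi a / chi x)) * (\<Prod>r\<in>removable \<mu>. inverse (lin (chi r / chi x)))"
  have "dilate (inverse (chi x)) (cre (conjugate \<mu>)) = lin 1 * F"
    unfolding cre_transpose dilate_mult dilate_prod dilate_lin dilate_inverse_lin F_def
    using prod.remove[OF finite_addable[OF assms(1)] assms(2), of "\<lambda>a. lin (chi a * inverse (chi x))"]
    by (simp add: divide_inverse mult.assoc)
  moreover have "cval F ((\<Prod>a\<in>addable \<mu> - {x}. 1 - chi a / chi x) * (\<Prod>r\<in>removable \<mu>. 1 / (1 - chi r / chi x)))"
    unfolding F_def
  proof (intro cval_mult cval_prod cval_lin cval_inverse_lin)
    fix r assume "r \<in> removable \<mu>"
    from content_addable_removable[OF assms this] show "chi r / chi x \<noteq> 1"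
      using chi_eq_iff by simp
  qed
  moreover have "(\<Prod>a\<in>addable \<mu> - {x}. 1 - chi a / chi x) * (\<Prod>r\<in>removable \<mu>. 1 / (1 - chi r / chi x)) = 1 / alpha \<mu> x"
    by (simp add: alpha_def prod_dividef)
  ultimately show ?thesis using that by metis
qed

text \<open>Derived from the exponent, which avoids a case distinction on corners. The box x passes
  from addable to removable and gives two inverse factors. At each neighbouring content either a box
  becomes addable or a removable one is lost, with the same linear factor.\<close>

lemma cre_insert:
  assumes "is_partition \<mu>" "x \<in> addable \<mu>"
  defines "w \<equiv> inverse (chi x)"
  shows "cre (insert x \<mu>) = cre \<mu> * (lin (w / q) * lin (q * w) * inverse (lin w) * inverse (lin w))"
proof -
  let ?T = "conjugate \<mu>"
  have T: "is_partition ?T" "prod.swap x \<in> addable ?T" using assms by (auto simp: addable_transpose)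
  have ins: "conjugate (insert x \<mu>) = insert (prod.swap x) ?T" by simp
  have p: "is_partition (insert x \<mu>)" using addable_insert[OF assms(1,2)] by blast
  have "cre (insert x \<mu>) = exp_fps (\<lambda>n. - ((1 - q ^ n) * psum ?T n / of_nat n) +
     (- ((w / q) ^ n) / of_nat n + - ((q * w) ^ n) / of_nat n + w ^ n / of_nat n + w ^ n / of_nat n))"
    unfolding cre_exp[OF p, symmetric]
  proof (rule exp_fps_cong)
    fix n :: nat assume n: "n > 0"
    have ps: "psum (conjugate (insert x \<mu>)) n = psum ?T n + (w / q) ^ n - w ^ n"
      unfolding ins psum_insert[OF T n] w_def by (simp add: chi_def power_int_minus power_int_diff divide_inverse)
    have qw: "q ^ n * (w / q) ^ n = w ^ n" by (simp add: power_divide)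
    have "(1 - q ^ n) * (psum ?T n + W - w ^ n)
      = (1 - q ^ n) * psum ?T n + W + q ^ n * w ^ n - w ^ n - w ^ n" if "q ^ n * W = w ^ n" for W
      using that by (simp add: algebra_simps)
    from this[OF qw] show "- ((1 - q ^ n) * psum (conjugate (insert x \<mu>)) n / of_nat n)
      = - ((1 - q ^ n) * psum ?T n / of_nat n) +
     (- ((w / q) ^ n) / of_nat n + - ((q * w) ^ n) / of_nat n + w ^ n / of_nat n + w ^ n / of_nat n)"
      unfolding ps power_mult_distrib using n by (simp add: field_simps)
  qed
  then show ?thesis
    unfolding exp_fps_add cre_exp[OF assms(1)] exp_fps_lin exp_fps_inverse_lin .
qed

text \<open>Both \<open>dilate\<close> factors contain \<open>1 - t\<close>, which cancels the double pole at \<open>t = 1\<close> coming from the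
  new removable box.\<close>

lemma pair_val_insert:
  assumes "is_partition \<mu>" "x \<in> addable \<mu>"
  shows "pair_val (insert x \<mu>) (insert x \<mu>) * alpha \<mu> x ^ 2 = pair_val \<mu> \<mu> * chi x * (1 - q) * (1 - 1 / q)"
proof -
  let ?T = "conjugate \<mu>" and ?I = "insert x \<mu>"
  have T: "is_partition ?T" "prod.swap x \<in> addable ?T" using assms by (auto simp: addable_transpose)
  have I: "is_partition ?I" using addable_insert[OF assms] by blast
  obtain F where F: "dilate (inverse (chi x)) (cre ?T) = lin 1 * F" "cval F (1 / alpha \<mu> x)"
    using dilate_cre_transpose[OF assms] .
  obtain G where G: "dilate (chi x) (cre \<mu>) = lin 1 * G" "cval G (chi x / alpha \<mu> x)"
    using dilate_cre_transpose[OF T] unfolding chi_swap alpha_transpose[OF assms] by auto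
  \<comment> \<open>The box is added on the bra side by way of transposition; the ket side follows
    below.\<close>
  have "pair_fps ?I \<mu> = pair_fps ?T (insert (prod.swap x) ?T)"
    using pair_fps_transpose[of \<mu> ?I] by simp
  also have "\<dots> = pair_fps \<mu> \<mu> * (lin 1 * F)"
    unfolding pair_fps_insert[OF T(1) T] pair_fps_transpose chi_swap F(1) ..
  finally have 1: "pair_fps ?I \<mu> = pair_fps \<mu> \<mu> * (lin 1 * F)" .
  have w: "inverse (chi x) / q * chi x = 1 / q" "q * inverse (chi x) * chi x = q" "inverse (chi x) * chi x = 1"
    by (simp_all add: field_simps)
  have "dilate (chi x) (cre ?I) = lin 1 * G * (lin (1 / q) * lin q * inverse (lin 1) * inverse (lin 1))"
    unfolding cre_insert[OF assms] dilate_mult G(1) dilate_lin dilate_inverse_lin w ..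
  then have "pair_fps ?I ?I = pair_fps \<mu> \<mu> * (lin 1 * F) * (lin 1 * G * (lin (1 / q) * lin q * inverse (lin 1) * inverse (lin 1)))"
    unfolding pair_fps_insert[OF I assms] 1 by simp
  also have "\<dots> = (lin 1 * inverse (lin 1)) * (lin 1 * inverse (lin 1)) * (pair_fps \<mu> \<mu> * F * (G * (lin (1 / q) * lin q)))"
    by (simp only: mult_ac)
  finally have "pair_fps ?I ?I = pair_fps \<mu> \<mu> * F * (G * (lin (1 / q) * lin q))"
    by simp
  moreover have "cval (pair_fps \<mu> \<mu> * F * (G * (lin (1 / q) * lin q)))
     (pair_val \<mu> \<mu> * (1 / alpha \<mu> x) * ((chi x / alpha \<mu> x) * ((1 - 1 / q) * (1 - q))))"
    by (intro cval_mult cval_lin cval_pair assms F G)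
  ultimately have "pair_val ?I ?I = pair_val \<mu> \<mu> * (1 / alpha \<mu> x) * ((chi x / alpha \<mu> x) * ((1 - 1 / q) * (1 - q)))"
    using cval_unique[OF cval_pair[OF I I]] by simp
  then show ?thesis using alpha_nonzero[OF assms] by (simp add: field_simps power2_eq_square)
qed

end

section \<open>Positivity of the residue on (0, 1)\<close>

lemma holomorphic_root_one_minus_power:
  assumes "n > 0" shows "holomorphic_root (\<lambda>z. (1 - z ^ n) ^ 2) (\<lambda>z. 1 - z ^ n)"
  unfolding holomorphic_root_def
proof (intro conjI ballI allI impI)
  show "\<exists>y>0. 1 - complex_of_real x ^ n = of_real y" if "0 < x \<and> x < 1" for x :: real
    using that assms by (intro exI[of _ "1 - x ^ n"]) (simp add: power_less_one_iff)
qed (auto intro!: holomorphic_intros)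

lemma holomorphic_root_inverse_one_minus_power:
  assumes "n > 0" shows "holomorphic_root (\<lambda>z. (1 / (1 - z ^ n)) ^ 2) (\<lambda>z. 1 / (1 - z ^ n))"
  unfolding holomorphic_root_def
proof (intro conjI ballI allI impI)
  have "z ^ n \<noteq> 1" if "z \<in> ball 0 1" for z :: complex
    using that assms by (metis dist_0_norm mem_ball norm_ge_zero norm_one norm_power order_less_irrefl power_less_one_iff)
  then show "(\<lambda>z::complex. 1 / (1 - z ^ n)) holomorphic_on ball 0 1"
    by (intro holomorphic_intros) auto
  show "\<exists>y>0. 1 / (1 - complex_of_real x ^ n) = of_real y" if "0 < x \<and> x < 1" for x :: real
    using that assms by (intro exI[of _ "1 / (1 - x ^ n)"]) (simp add: power_less_one_iff)
qed simp

lemma holomorphic_root_power_ratio: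
  assumes "a > 0" "b > 0"
  shows "holomorphic_root (\<lambda>z. ((1 - z ^ a) / (1 - z ^ b)) ^ 2) (\<lambda>z. (1 - z ^ a) / (1 - z ^ b))"
  using holomorphic_root_mult[OF holomorphic_root_one_minus_power[OF assms(1)]
      holomorphic_root_inverse_one_minus_power[OF assms(2)],
      of "\<lambda>z. ((1 - z ^ a) / (1 - z ^ b)) ^ 2"]
  by (simp add: power_divide)

lemma holomorphic_root_prod:
  assumes "finite A" "\<And>x. x \<in> A \<Longrightarrow> holomorphic_root (\<lambda>z. (f x z) ^ 2) (f x)"
  shows "holomorphic_root (\<lambda>z. (\<Prod>x\<in>A. f x z) ^ 2) (\<lambda>z. \<Prod>x\<in>A. f x z)"
  using assms
proof (induction A rule: finite_induct)
  case empty
  then show ?case using holomorphic_root_id_power[of 0] by simp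
next
  case (insert x A)
  then show ?case
    by (simp add: holomorphic_root_mult[where F = "\<lambda>z. (f x z)\<^sup>2"] power_mult_distrib)
qed

text \<open>For negative e the powers - z^(e+1) and - z^e are pulled out and leave a single z. What
  remains has nonnegative exponents. If the denominator vanishes, both sides are 0.\<close>

lemma one_minus_powi_ratio:
  fixes z :: complex
  assumes "z \<noteq> 0" "e \<noteq> 0" "e \<noteq> - 1"
  shows "(1 - z powi (e + 1)) / (1 - z powi e)
    = (if e < 0 then z else 1) * ((1 - z ^ nat \<bar>e + 1\<bar>) / (1 - z ^ nat \<bar>e\<bar>))"
proof (cases "e < 0")
  case True
  define m where "m = nat (- e) - 1"
  have m: "e = - int (Suc m)" "e + 1 = - int m" "nat \<bar>e + 1\<bar> = m" "nat \<bar>e\<bar> = Suc m"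
    using True assms(3) by (auto simp: m_def)
  have "(1 - inverse (z ^ m)) / (1 - inverse (z ^ Suc m)) = z * ((1 - z ^ m) / (1 - z ^ Suc m))"
  proof (cases "z ^ Suc m = 1")
    case False
    then have "1 - inverse (z ^ Suc m) \<noteq> 0" "1 - z ^ Suc m \<noteq> 0"
      by (metis eq_iff_diff_eq_0 inverse_eq_1_iff, simp)
    then show ?thesis using assms(1) by (simp add: divide_simps) (simp add: algebra_simps)
  qed simp
  then show ?thesis
    unfolding m(2) m(3) m(4) using True by (simp add: m(1) power_int_minus del: power_Suc of_nat_Suc)
next
  case False
  then obtain n where "e = int n" using nonneg_int_cases by (metis not_less)
  then have "z powi (e + 1) = z ^ Suc n" "z powi e = z ^ n" "nat \<bar>e + 1\<bar> = Suc n" "nat \<bar>e\<bar> = n"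
    by (simp_all flip: of_nat_Suc add: power_int_of_nat nat_add_distrib del: power_Suc)
      (metis of_nat_Suc power_int_of_nat add.commute)
  with False show ?thesis by simp
qed

text \<open>Telescoping turns the product over corners into one over all columns, with factors (1 -
  z^(e+1)) / (1 - z^e), where e is the content of the column's first free box minus that of x.
  Columns to the left of x have e < -1 and contribute a power of z each, columns to the right have e
  > 0, and the column of x leaves 1 - z.\<close>

lemma alpha_root:
  assumes p: "is_partition \<mu>" and x: "x \<in> addable \<mu>"
  obtains U where "holomorphic_root (\<lambda>z. (U z) ^ 2) U"
    "\<And>z. z \<in> ball 0 1 - {0} \<Longrightarrow> nome.alpha z \<mu> x = (1 - z) * z ^ (snd x - 1) * U z"
proof -
  obtain j where j: "x = (Suc (col_len \<mu> j), j)" "1 \<le> j" "j = 1 \<or> col_len \<mu> j < col_len \<mu> (j - 1)"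
    using x by (auto simp: addable_eq[OF p])
  define c where "c = box_content x"
  have c: "c = int j - 1 - int (col_len \<mu> j)" by (simp add: c_def j box_content_def)
  \<comment> \<open>The summand j keeps the column of x in the range even if that column is still
    empty.\<close>
  define J where "J = row_len \<mu> 1 + j"
  have J: "\<forall>l>J. col_len \<mu> l = 0" using col_len_tail[OF p] by (simp add: J_def)
  define e where "e = (\<lambda>l. int l - 1 - int (col_len \<mu> l) - c)"
  have e_gt: "e l > 0" if "l > j" for l
    using col_len_antimono[OF p, of j l] that j by (simp add: e_def c)
  have e_lt: "e l < - 1" if "1 \<le> l" "l < j" for l
  proof -
    have "col_len \<mu> (j - 1) \<le> col_len \<mu> l" using that by (intro col_len_antimono[OF p]) auto
    then show ?thesis using that j(3) by (simp add: e_def c)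
  qed
  have e_j: "e j = 0" by (simp add: e_def c)
  let ?R = "\<lambda>(z::complex) l. (1 - z ^ nat \<bar>e l + 1\<bar>) / (1 - z ^ nat \<bar>e l\<bar>)"
  define N where "N = nat (int J - c)"
  have N: "N > 0" "int J - c = int N" using j by (auto simp: N_def J_def c)
  define U where "U = (\<lambda>z::complex. (\<Prod>l\<in>{1..J} - {j}. ?R z l) * (1 / (1 - z ^ N)))"
  have pos: "nat \<bar>e l + 1\<bar> > 0 \<and> nat \<bar>e l\<bar> > 0 \<and> e l \<noteq> 0 \<and> e l \<noteq> - 1" if "l \<in> {1..J} - {j}" for l
    using that e_gt[of l] e_lt[of l] by (cases "l < j") auto
  have root: "holomorphic_root (\<lambda>z. (U z) ^ 2) U"
    unfolding U_def
  proof (rule holomorphic_root_mult)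
    show "holomorphic_root (\<lambda>z. (\<Prod>l\<in>{1..J} - {j}. ?R z l) ^ 2)
       (\<lambda>z. \<Prod>l\<in>{1..J} - {j}. ?R z l)"
      using pos by (intro holomorphic_root_prod holomorphic_root_power_ratio) blast+
    show "holomorphic_root (\<lambda>z. (1 / (1 - z ^ N)) ^ 2) (\<lambda>z. 1 / (1 - z ^ N))"
      by (rule holomorphic_root_inverse_one_minus_power[OF N(1)])
  qed (simp only: power_mult_distrib)
  have "nome.alpha z \<mu> x = (1 - z) * z ^ (snd x - 1) * U z" if z: "z \<in> ball 0 1 - {0}" for z
  proof -
    interpret nome z by (rule nomeI[OF z])
    \<comment> \<open>Setting f to 1 at the content of x lets the omitted factor a = x take part in
      the telescoping and makes f nowhere zero.\<close>
    define f where "f = (\<lambda>d. if d = c then 1 else 1 - z powi (d - c))"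
    have fnz: "f d \<noteq> 0" for d by (auto simp: f_def q_powi_eq_1_iff)
    have chi_ratio: "chi a / chi x = z powi (box_content a - c)" for a
      by (simp add: chi_def c_def power_int_diff)
    have R: "(\<Prod>r\<in>removable \<mu>. 1 - chi r / chi x) = (\<Prod>r\<in>removable \<mu>. f (box_content r))"
    proof (intro prod.cong refl)
      fix r assume "r \<in> removable \<mu>"
      from content_addable_removable[OF p x this] have "box_content r \<noteq> c" unfolding c_def by metis
      then show "1 - chi r / chi x = f (box_content r)" by (simp add: f_def chi_ratio)
    qed
    have A: "(\<Prod>a\<in>addable \<mu> - {x}. 1 - chi a / chi x) = (\<Prod>a\<in>addable \<mu>. f (box_content a))"
    proof -
      have "(\<Prod>a\<in>addable \<mu>. f (box_content a)) = f c * (\<Prod>a\<in>addable \<mu> - {x}. f (box_content a))"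
        unfolding c_def by (rule prod.remove[OF finite_addable[OF p] x])
      also have "(\<Prod>a\<in>addable \<mu> - {x}. f (box_content a)) = (\<Prod>a\<in>addable \<mu> - {x}. 1 - chi a / chi x)"
        using content_inj_addable[OF p] x by (intro prod.cong) (auto simp: f_def chi_ratio c_def inj_on_def)
      finally show ?thesis by (simp add: f_def)
    qed
    let ?P = "\<Prod>l=1..J. f (int l - int (col_len \<mu> l))" and ?Q = "\<Prod>l=1..J. f (int l - 1 - int (col_len \<mu> l))"
    have nz: "?P \<noteq> 0" "?Q \<noteq> 0" "(\<Prod>a\<in>addable \<mu>. f (box_content a)) \<noteq> 0"
      using fnz finite_addable[OF p] by auto
    have "alpha \<mu> x = (\<Prod>r\<in>removable \<mu>. f (box_content r)) / (\<Prod>a\<in>addable \<mu>. f (box_content a))"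
      unfolding alpha_def R A ..
    also have "\<dots> = ?P / (?Q * f (int J))"
      using content_prod_telescope[OF p J, of f] nz fnz by (simp add: divide_simps mult_ac)
    also have "\<dots> = (\<Prod>l=1..J. f (int l - int (col_len \<mu> l)) / f (int l - 1 - int (col_len \<mu> l))) / f (int J)"
      by (simp add: prod_dividef)
    also have "f (int J) = 1 - z ^ N"
      using N by (auto simp: f_def)
    also have "(\<Prod>l=1..J. f (int l - int (col_len \<mu> l)) / f (int l - 1 - int (col_len \<mu> l)))
      = (\<Prod>l=1..J. (if l = j then 1 - z else (if l < j then z else 1) * ?R z l))"
    proof (intro prod.cong refl)
      fix l assume l: "l \<in> {1..J}"
      have fe: "f (int l - 1 - int (col_len \<mu> l)) = (if e l = 0 then 1 else 1 - z powi e l)"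
        "f (int l - int (col_len \<mu> l)) = (if e l = - 1 then 1 else 1 - z powi (e l + 1))"
        by (auto simp: f_def e_def algebra_simps)
      show "f (int l - int (col_len \<mu> l)) / f (int l - 1 - int (col_len \<mu> l))
        = (if l = j then 1 - z else (if l < j then z else 1) * ?R z l)"
      proof (cases "l = j")
        case True
        then show ?thesis unfolding fe using e_j by simp
      next
        case False
        then have "e l \<noteq> 0 \<and> e l \<noteq> - 1" using pos[of l] l by blast
        moreover have "e l < 0 \<longleftrightarrow> l < j"
          using False e_gt[of l] e_lt[of l] l by (cases rule: linorder_cases[of l j]) auto
        ultimately show ?thesis
          unfolding fe using one_minus_powi_ratio[of z "e l"] False by simp
      qed
    qed
    also have "\<dots> = (1 - z) * (\<Prod>l\<in>{1..J} - {j}. (if l < j then z else 1) * ?R z l)"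
      using j by (subst prod.remove[of _ j]) (auto simp: J_def intro!: prod.cong)
    also have "\<dots> = (1 - z) * ((\<Prod>l\<in>{1..J} - {j}. if l < j then z else 1) * (\<Prod>l\<in>{1..J} - {j}. ?R z l))"
      by (simp only: prod.distrib)
    \<comment> \<open>Exactly the j - 1 columns to the left of x contribute a factor z.\<close>
    also have "(\<Prod>l\<in>{1..J} - {j}. if l < j then z else 1) = (\<Prod>l\<in>{1..<j}. z)"
      by (rule prod.mono_neutral_cong_right) (auto simp: J_def)
    finally show ?thesis by (simp add: U_def mult_ac j)
  qed
  with root show thesis by (rule that)
qed


subsection \<open>The empty partition\<close>

lemma addable_empty: "addable {} = {(1, 1)}"
proof -
  have "col_len {} j = 0" for j by (simp add: col_len_def)
  then show ?thesis unfolding addable_eq[OF is_partition_empty] by auto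
qed

lemma one_minus_power_bound:
  fixes z :: complex
  assumes "norm z \<le> r" "r < 1" "n > 0" shows "1 - r \<le> norm (1 - z ^ n)"
proof -
  have "norm (z ^ n) \<le> r ^ n" using assms by (simp add: norm_power power_mono)
  also have "r ^ n \<le> r ^ 1" using assms order_trans[OF norm_ge_zero assms(1)] by (intro power_decreasing) auto
  finally show ?thesis using norm_triangle_ineq2[of 1 "z ^ n"] by simp
qed

lemma macmahon_term_bound:
  fixes z :: complex
  assumes "norm z \<le> r" "r < 1"
  shows "norm (z ^ n / (of_nat n * (1 - z ^ n) ^ 2)) \<le> r ^ n / (1 - r) ^ 2"
proof (cases "n = 0")
  case False
  have r: "0 \<le> r" using assms norm_ge_zero order_trans by blast
  have "norm (z ^ n / (of_nat n * (1 - z ^ n) ^ 2)) = norm z ^ n / (of_nat n * norm (1 - z ^ n) ^ 2)"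
    by (simp add: norm_divide norm_mult norm_power)
  also have "\<dots> \<le> r ^ n / (1 * (1 - r) ^ 2)"
    using assms False one_minus_power_bound[of z r n] r
    by (intro frac_le mult_mono power_mono) (auto simp: zero_less_mult_iff)
  finally show ?thesis by simp
qed simp

text \<open>The term for \<open>n = 0\<close> vanishes because \<open>x / 0 = 0\<close>.\<close>

definition macmahon_log :: "complex \<Rightarrow> complex" where
  "macmahon_log z = (\<Sum>n. z ^ n / (of_nat n * (1 - z ^ n) ^ 2))"

lemma macmahon_log_holomorphic: "macmahon_log holomorphic_on ball 0 1"
proof (rule holomorphic_uniform_sequence)
  let ?f = "\<lambda>n (z::complex). z ^ n / (of_nat n * (1 - z ^ n) ^ 2)"
  show "(\<lambda>z. \<Sum>n<N. ?f n z) holomorphic_on ball 0 1" for N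
  proof (rule holomorphic_on_sum)
    fix n
    show "?f n holomorphic_on ball 0 1"
    proof (cases "n = 0")
      case False
      have "1 - z ^ n \<noteq> 0" if "z \<in> ball 0 1" for z :: complex
        using one_minus_power_bound[of z "norm z" n] that False by auto
      then show ?thesis using False by (intro holomorphic_intros) auto
    qed simp
  qed
  fix x :: complex assume x: "x \<in> ball 0 1"
  define d where "d = (1 - norm x) / 2"
  define r where "r = norm x + d"
  have d: "d > 0" "r < 1" "0 \<le> r" using x by (auto simp: d_def r_def field_simps)
  have le: "norm z \<le> r" if "z \<in> cball x d" for z
    using that norm_triangle_ineq2[of z x] by (simp add: r_def dist_norm norm_minus_commute)
  have "uniform_limit (cball x d) (\<lambda>N z. \<Sum>n<N. ?f n z) (\<lambda>z. \<Sum>n. ?f n z) sequentially"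
  proof (rule Weierstrass_m_test)
    show "norm (?f n z) \<le> r ^ n / (1 - r) ^ 2" if "z \<in> cball x d" for n z
      by (rule macmahon_term_bound[OF le[OF that] d(2)])
    show "summable (\<lambda>n. r ^ n / (1 - r) ^ 2)"
      using d by (intro summable_divide summable_geometric) simp
  qed
  then show "\<exists>d>0. cball x d \<subseteq> ball 0 1 \<and> uniform_limit (cball x d) (\<lambda>N z. \<Sum>n<N. ?f n z) macmahon_log sequentially"
    using d le unfolding macmahon_log_def[abs_def] by (intro exI[of _ d] conjI) force+
qed simp

text \<open>A real logarithm on (0, 1) makes the exponential of its half positive there, as the
  normalization demands.\<close>

lemma macmahon_log_real:
  assumes "0 < x" "x < 1" obtains y :: real where "macmahon_log (of_real x) = of_real y"
proof (rule that)
  define f where "f = (\<lambda>n. x ^ n / (of_nat n * (1 - x ^ n) ^ 2))"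
  have f: "complex_of_real x ^ n / (of_nat n * (1 - of_real x ^ n) ^ 2) = of_real (f n)" for n
    by (simp add: f_def)
  have nx: "norm (complex_of_real x) \<le> x" using assms by simp
  have "norm (f n) \<le> x ^ n / (1 - x) ^ 2" for n
    using macmahon_term_bound[OF nx assms(2), of n] unfolding f norm_of_real real_norm_def .
  moreover have "summable (\<lambda>n. x ^ n / (1 - x) ^ 2)"
    using assms by (intro summable_divide summable_geometric) simp
  ultimately have "summable f"
    by (rule summable_comparison_test'[rotated])
  then show "macmahon_log (of_real x) = of_real (\<Sum>n. f n)"
    unfolding macmahon_log_def f by (rule suminf_of_real[symmetric])
qed

context nome
begin

lemma psum_empty: "n > 0 \<Longrightarrow> psum {} n = 1 / (1 - q ^ n)"
  using psum_content[OF is_partition_empty, of n] q_power_neq_1[of n]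
  by (simp add: addable_empty removable_def box_content_def field_simps)

text \<open>The product \<Prod> (1 - q^(i+j-1)) = \<Prod> (1 - q^n)^n is the reciprocal of
  MacMahon's function. Its regularized series is exp (B(t)) with B convergent beyond the unit disc,
  so uniqueness of continuation identifies the values at t = 1.\<close>

lemma hook_prod_empty: "hook_prod {} q = exp (- macmahon_log q)"
proof -
  define b where "b = (\<lambda>n. - (q ^ n / (of_nat n * (1 - q ^ n) ^ 2)))"
  define B where "B = Abs_fps b"
  \<comment> \<open>The midpoint of 1 and 1 / |q|: t = 1 has to lie strictly inside the disc of
    convergence.\<close>
  define r where "r = (1 + 1 / norm q) / 2"
  have r: "r > 1" "norm q * r < 1"
    using q_pos q_less by (auto simp: r_def field_simps)
  have "summable (\<lambda>n. b n * of_real r ^ n)"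
  proof (rule summable_comparison_test')
    show "summable (\<lambda>n. (norm q * r) ^ n / (1 - norm q) ^ 2)"
      using r q_pos by (intro summable_divide summable_geometric) simp
    show "norm (b n * of_real r ^ n) \<le> (norm q * r) ^ n / (1 - norm q) ^ 2" for n
    proof -
      have "norm (b n * of_real r ^ n) = norm (q ^ n / (of_nat n * (1 - q ^ n) ^ 2)) * r ^ n"
      proof -
        have "norm (complex_of_real r ^ n) = r ^ n" using r by (simp add: norm_power)
        then show ?thesis by (simp only: b_def norm_mult norm_minus_cancel)
      qed
      also have "\<dots> \<le> norm q ^ n / (1 - norm q) ^ 2 * r ^ n"
        using r macmahon_term_bound[of q "norm q" n] q_less by (intro mult_right_mono) auto
      finally show ?thesis by (simp add: power_mult_distrib)
    qed
  qed
  then have rad: "fps_conv_radius B \<ge> ereal r"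
    using conv_radius_geI[of b "of_real r"] r by (simp add: B_def fps_conv_radius_def)
  have rad0: "fps_conv_radius B > 0"
    using rad r by (metis ereal_less(2) less_le_trans less_trans zero_less_one)
  have eB: "eval_fps B holomorphic_on ball 0 r"
  proof (rule holomorphic_on_eval_fps)
    have "ereal (norm x) < fps_conv_radius B" if "norm x < r" for x :: complex
      using rad that by (meson ereal_less_eq(3) less_ereal.simps(1) order_less_le_trans)
    then show "ball (0::complex) r \<subseteq> eball 0 (fps_conv_radius B)" by (auto simp: dist_norm)
  qed
  have "(exp \<circ> eval_fps B) has_fps_expansion (fps_exp 1 oo B)"
    by (intro has_fps_expansion_compose has_fps_expansion_exp1 eval_fps_has_fps_expansion rad0)
      (simp add: B_def b_def)
  moreover have "B = Abs_fps (\<lambda>n. if n = 0 then 0 else b n)"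
    by (rule fps_ext) (simp add: B_def b_def)
  ultimately have "(exp \<circ> eval_fps B) has_fps_expansion exp_fps b"
    by (simp add: exp_fps_def)
  moreover have "exp_fps b = pair_fps {} {}"
    unfolding pair_fps_def
    by (rule exp_fps_cong) (simp add: psum_empty b_def power2_eq_square)
  moreover have "(exp \<circ> eval_fps B) holomorphic_on ball 0 r"
    by (rule holomorphic_on_compose[OF eB]) (intro holomorphic_intros)
  ultimately have "(exp \<circ> eval_fps B) 1 = pair_val {} {}"
    using r by (intro cval_unique_aux[OF cval_pair[OF is_partition_empty is_partition_empty], of "ball 0 r"]) (simp_all add: o_def)
  moreover have "eval_fps B 1 = - macmahon_log q"
  proof -
    have "summable (\<lambda>n. q ^ n / (of_nat n * (1 - q ^ n) ^ 2))"
    proof (rule summable_comparison_test')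
      show "summable (\<lambda>n. norm q ^ n / (1 - norm q) ^ 2)"
        using q_less by (intro summable_divide summable_geometric) simp
    qed (use macmahon_term_bound[of q "norm q"] q_less in auto)
    then show ?thesis
      by (simp add: eval_fps_def B_def b_def macmahon_log_def suminf_minus)
  qed
  ultimately show ?thesis by (simp add: pair_val_hook_prod)
qed

end

subsection \<open>The normalization factors as holomorphic functions\<close>

definition ket_square :: "diagram \<Rightarrow> complex \<Rightarrow> complex" where
  "ket_square \<Lambda> z = (-1) ^ card \<Lambda> * z powi (kappa \<Lambda> div 2 - int (card \<Lambda>)) * inverse (hook_prod \<Lambda> z)"

lemma kappa_insert:
  assumes "is_partition \<mu>" "x \<in> addable \<mu>"
  shows "kappa (insert x \<mu>) div 2 = kappa \<mu> div 2 + box_content x"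
proof -
  have I: "is_partition (insert x \<mu>)" "x \<notin> \<mu>" using addable_insert[OF assms] by blast+
  show ?thesis
    unfolding kappa_content[OF I(1)] kappa_content[OF assms(1)]
    using I(2) partition_finite[OF assms(1)] by simp
qed

text \<open>The prefactors of the normalization serve this purpose: the sign and the power of z
  contribute - \<chi>_x / z, which turns \<alpha>^2 / (\<chi>_x (1 - z) (1 - 1/z)) into the perfect
  square \<alpha>^2 / (1 - z)^2.\<close>

lemma ket_square_insert:
  assumes p: "is_partition \<mu>" "x \<in> addable \<mu>" and z: "z \<in> ball 0 1 - {0}"
  shows "ket_square (insert x \<mu>) z = ket_square \<mu> z * (nome.alpha z \<mu> x / (1 - z)) ^ 2"
proof -
  interpret nome z by (rule nomeI[OF z])
  have z1: "z \<noteq> 1" "1 - z \<noteq> 0" using q_power_neq_1[of 1] by auto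
  have c: "card (insert x \<mu>) = Suc (card \<mu>)"
    using addable_insert[OF p] partition_finite[OF p(1)] by simp
  have I: "is_partition (insert x \<mu>)" using addable_insert[OF p] by blast
  have nz: "hook_prod \<mu> z \<noteq> 0" "hook_prod (insert x \<mu>) z \<noteq> 0"
    using pair_val_eq_0_iff[OF p(1) p(1)] pair_val_eq_0_iff[OF I I] by (simp_all add: pair_val_hook_prod)
  have "kappa \<mu> div 2 + box_content x - int (Suc (card \<mu>)) = kappa \<mu> div 2 - int (card \<mu>) + box_content x - 1"
    by simp
  then have e: "z powi (kappa (insert x \<mu>) div 2 - int (card (insert x \<mu>)))
    = z powi (kappa \<mu> div 2 - int (card \<mu>)) * chi x / z"
    unfolding kappa_insert[OF p] c chi_def by (simp add: power_int_add power_int_diff)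
  have h: "inverse (hook_prod (insert x \<mu>) z) = inverse (hook_prod \<mu> z) * (alpha \<mu> x ^ 2 / (chi x * (1 - z) * (1 - 1 / z)))"
    using pair_val_insert[OF p] nz z1 alpha_nonzero[OF p] unfolding pair_val_hook_prod
    by (simp add: divide_simps) (simp add: algebra_simps)
  have "- (1 / z) * (1 / ((1 - z) * (1 - 1 / z))) = 1 / (1 - z) ^ 2"
    using z1 by (simp add: divide_simps power2_eq_square)
  moreover have "- (chi x / z) * (A / (chi x * (1 - z) * (1 - 1 / z))) = - (1 / z) * (1 / ((1 - z) * (1 - 1 / z))) * A" for A
    by (simp add: mult.assoc)
  ultimately have "- (chi x / z) * (A / (chi x * (1 - z) * (1 - 1 / z))) = A / (1 - z) ^ 2" for A
    by simp
  note quot = this[of "alpha \<mu> x ^ 2"]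
  have "ket_square (insert x \<mu>) z = ket_square \<mu> z * (- (chi x / z) * (alpha \<mu> x ^ 2 / (chi x * (1 - z) * (1 - 1 / z))))"
    unfolding ket_square_def e h unfolding c by (simp add: mult_ac)
  then show ?thesis unfolding quot power_divide .
qed

lemma norm_ket_empty_root:
  "holomorphic_root (ket_square {}) (\<lambda>z. exp (macmahon_log z / 2))"
  unfolding holomorphic_root_def
proof (intro conjI ballI allI impI)
  show "(\<lambda>z. exp (macmahon_log z / 2)) holomorphic_on ball 0 1"
    by (intro holomorphic_intros macmahon_log_holomorphic) simp
  show "exp (macmahon_log z / 2) ^ 2 = ket_square {} z" if "z \<in> ball 0 1 - {0}" for z
    using nome.hook_prod_empty[OF nomeI[OF that]]
    by (simp add: ket_square_def kappa_def exp_minus flip: exp_double)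
  show "\<exists>y>0. exp (macmahon_log (of_real x) / 2) = of_real y" if x: "0 < x \<and> x < 1" for x
  proof -
    obtain y where "macmahon_log (of_real x) = of_real y"
      using macmahon_log_real[OF conjunct1[OF x] conjunct2[OF x]] .
    then have "exp (macmahon_log (of_real x) / 2) = of_real (exp (y / 2))"
      by (simp flip: exp_of_real)
    then show ?thesis by (intro exI[of _ "exp (y / 2)"]) simp
  qed
qed

lemma norm_root_step:
  assumes p: "is_partition \<mu>" "x \<in> addable \<mu>" and g: "holomorphic_root (ket_square \<mu>) g"
  obtains U where "holomorphic_root (\<lambda>z. (U z) ^ 2) U"
    "\<And>z. z \<in> ball 0 1 - {0} \<Longrightarrow> nome.alpha z \<mu> x / (1 - z) = z ^ (snd x - 1) * U z"
    "holomorphic_root (ket_square (insert x \<mu>)) (\<lambda>z. g z * (z ^ (snd x - 1) * U z))"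
proof -
  obtain U where U: "holomorphic_root (\<lambda>z. (U z) ^ 2) U"
    "\<And>z. z \<in> ball 0 1 - {0} \<Longrightarrow> nome.alpha z \<mu> x = (1 - z) * z ^ (snd x - 1) * U z"
    using alpha_root[OF p] by blast
  have quot: "nome.alpha z \<mu> x / (1 - z) = z ^ (snd x - 1) * U z" if "z \<in> ball 0 1 - {0}" for z
    using U(2)[OF that] that by auto
  have "holomorphic_root (\<lambda>z. (z ^ (snd x - 1) * U z) ^ 2) (\<lambda>z. z ^ (snd x - 1) * U z)"
    by (rule holomorphic_root_mult[OF holomorphic_root_id_power U(1)]) (simp only: power_mult_distrib)
  then have "holomorphic_root (ket_square (insert x \<mu>)) (\<lambda>z. g z * (z ^ (snd x - 1) * U z))"
    by (rule holomorphic_root_mult[OF g]) (simp only: ket_square_insert[OF p] quot)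
  with U(1) quot show thesis by (rule that)
qed

text \<open>The function h is the root for the bra. It is carried along separately because the power
  relating it to g may be negative, so that holomorphy at 0 does not follow from that of g. Adding a
  box (i, j) multiplies g by z^(j-1) U and h by z^i U.\<close>

lemma norm_roots:
  assumes "is_partition \<Lambda>"
  obtains g h where "holomorphic_root (ket_square \<Lambda>) g" "holomorphic_root (\<lambda>z. (h z) ^ 2) h"
    "\<And>z. z \<in> ball 0 1 - {0} \<Longrightarrow> h z = z powi (int (card \<Lambda>) - kappa \<Lambda> div 2) * g z"
proof -
  have "\<exists>g h. holomorphic_root (ket_square \<Lambda>) g \<and> holomorphic_root (\<lambda>z. (h z) ^ 2) h \<and>
    (\<forall>z \<in> ball 0 1 - {0}. h z = z powi (int (card \<Lambda>) - kappa \<Lambda> div 2) * g z)"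
    using assms
  proof (induction rule: partition_induct)
    case empty
    let ?g = "\<lambda>z. exp (macmahon_log z / 2)"
    have "holomorphic_root (\<lambda>z. (?g z) ^ 2) ?g"
      using norm_ket_empty_root unfolding holomorphic_root_def by blast
    then show ?case
      using norm_ket_empty_root by (intro exI[of _ ?g] conjI) (auto simp: kappa_def)
  next
    case (insert \<mu> x)
    obtain g h where g: "holomorphic_root (ket_square \<mu>) g" and h: "holomorphic_root (\<lambda>z. (h z) ^ 2) h"
      and gh: "\<And>z. z \<in> ball 0 1 - {0} \<Longrightarrow> h z = z powi (int (card \<mu>) - kappa \<mu> div 2) * g z"
      using insert.IH by blast
    obtain U where U: "holomorphic_root (\<lambda>z. (U z) ^ 2) U"
      "holomorphic_root (ket_square (insert x \<mu>)) (\<lambda>z. g z * (z ^ (snd x - 1) * U z))"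
      using norm_root_step[OF insert.hyps g] by blast
    have x: "fst x \<ge> 1" "snd x \<ge> 1"
      using insert.hyps(2) by (auto simp: addable_eq[OF insert.hyps(1)])
    have c: "card (insert x \<mu>) = Suc (card \<mu>)"
      using addable_insert[OF insert.hyps] partition_finite[OF insert.hyps(1)] by simp
    have "holomorphic_root (\<lambda>z. (z ^ fst x * U z) ^ 2) (\<lambda>z. z ^ fst x * U z)"
      by (rule holomorphic_root_mult[OF holomorphic_root_id_power U(1)]) (simp only: power_mult_distrib)
    then have "holomorphic_root (\<lambda>z. (h z * (z ^ fst x * U z)) ^ 2) (\<lambda>z. h z * (z ^ fst x * U z))"
      by (rule holomorphic_root_mult[OF h]) (simp only: power_mult_distrib)
    moreover have "h z * (z ^ fst x * U z) = z powi (int (card (insert x \<mu>)) - kappa (insert x \<mu>) div 2) * (g z * (z ^ (snd x - 1) * U z))"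
      if z: "z \<in> ball 0 1 - {0}" for z
    proof -
      have z0: "z \<noteq> 0" using z by simp
      \<comment> \<open>For x = (i, j) this is 1 - (j - i) + (j - 1) = i.\<close>
      have "int (card (insert x \<mu>)) - kappa (insert x \<mu>) div 2 + int (snd x - 1)
        = int (card \<mu>) - kappa \<mu> div 2 + int (fst x)"
        unfolding c kappa_insert[OF insert.hyps] box_content_def using x by simp
      then have "z powi (int (card (insert x \<mu>)) - kappa (insert x \<mu>) div 2) * z ^ (snd x - 1)
        = z powi (int (card \<mu>) - kappa \<mu> div 2) * z ^ fst x"
        using power_int_add[of z "int (card (insert x \<mu>)) - kappa (insert x \<mu>) div 2" "int (snd x - 1)"]
          power_int_add[of z "int (card \<mu>) - kappa \<mu> div 2" "int (fst x)"] z0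
        by (simp only: power_int_of_nat simp_thms)
      then show ?thesis unfolding gh[OF z] by (simp add: mult_ac)
    qed
    ultimately show ?case
      using U(2) by (intro exI[of _ "\<lambda>z. g z * (z ^ (snd x - 1) * U z)"] exI[of _ "\<lambda>z. h z * (z ^ fst x * U z)"] conjI ballI)
  qed
  then obtain g h where "holomorphic_root (ket_square \<Lambda>) g" "holomorphic_root (\<lambda>z. (h z) ^ 2) h"
    "\<forall>z \<in> ball 0 1 - {0}. h z = z powi (int (card \<Lambda>) - kappa \<Lambda> div 2) * g z"
    by (elim exE conjE)
  then show thesis by (intro that[of g h]) (assumption, assumption, erule bspec)
qed

context nome
begin

lemma q_ball: "q \<in> ball 0 1" "q \<in> ball 0 1 - {0}"
  using q_less by auto

lemma norm_ket_root: "holomorphic_root (ket_square \<Lambda>) g \<Longrightarrow> norm_ket q \<Lambda> = g q"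
  unfolding norm_ket_def using holo_sqrt_eq[OF _ q_ball(1), of "ket_square \<Lambda>" g]
  by (simp add: ket_square_def[abs_def])

text \<open>The root for \<mu> + x is exhibited as the root for \<mu> times \<alpha> / (1 - z); by
  uniqueness of roots it can be evaluated at q, with no sign left open.\<close>

lemma norm_ket_insert:
  assumes "is_partition \<mu>" "x \<in> addable \<mu>"
  shows "norm_ket q (insert x \<mu>) = norm_ket q \<mu> * (alpha \<mu> x / (1 - q))"
proof -
  obtain g where g: "holomorphic_root (ket_square \<mu>) g" using norm_roots[OF assms(1)] .
  obtain U where U: "\<And>z. z \<in> ball 0 1 - {0} \<Longrightarrow> nome.alpha z \<mu> x / (1 - z) = z ^ (snd x - 1) * U z"
    "holomorphic_root (ket_square (insert x \<mu>)) (\<lambda>z. g z * (z ^ (snd x - 1) * U z))"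
    using norm_root_step[OF assms g] by blast
  show ?thesis
    unfolding norm_ket_root[OF g] norm_ket_root[OF U(2)] U(1)[OF q_ball(2)] ..
qed

lemma norm_ket_square:
  assumes "is_partition \<Lambda>" shows "norm_ket q \<Lambda> ^ 2 = ket_square \<Lambda> q"
proof -
  obtain g where g: "holomorphic_root (ket_square \<Lambda>) g" using norm_roots[OF assms] .
  then show ?thesis unfolding norm_ket_root[OF g] using q_ball(2) by (simp add: holomorphic_root_def)
qed

lemma norm_bra_eq:
  assumes "is_partition \<Lambda>"
  shows "norm_bra q \<Lambda> = (-1) ^ card \<Lambda> * (q powi (int (card \<Lambda>) - kappa \<Lambda> div 2) * norm_ket q \<Lambda>)"
proof -
  obtain g h where g: "holomorphic_root (ket_square \<Lambda>) g" and h: "holomorphic_root (\<lambda>z. (h z) ^ 2) h"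
    and gh: "\<And>z. z \<in> ball 0 1 - {0} \<Longrightarrow> h z = z powi (int (card \<Lambda>) - kappa \<Lambda> div 2) * g z"
    using norm_roots[OF assms] by blast
  let ?F = "\<lambda>z. (-1) ^ card \<Lambda> * z powi (- (kappa \<Lambda> div 2) + int (card \<Lambda>)) * inverse (hook_prod \<Lambda> z)"
  have "(h z) ^ 2 = ?F z" if z: "z \<in> ball 0 1 - {0}" for z
  proof -
    have "z \<noteq> 0" using z by simp
    have "(h z) ^ 2 = (z powi (int (card \<Lambda>) - kappa \<Lambda> div 2)) ^ 2 * ket_square \<Lambda> z"
      using g z unfolding gh[OF z] power_mult_distrib by (simp add: holomorphic_root_def)
    also have "\<dots> = ?F z"
      unfolding ket_square_def power2_eq_square using \<open>z \<noteq> 0\<close>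
      by (simp add: power_int_diff power_int_add power_int_minus divide_simps)
    finally show ?thesis .
  qed
  then have "holomorphic_root ?F h" using h unfolding holomorphic_root_def by metis
  from holo_sqrt_eq[OF this q_ball(1)] show ?thesis
    unfolding norm_bra_def norm_ket_root[OF g] gh[OF q_ball(2)] by simp
qed

text \<open>The powers of q and the signs in the two normalizations cancel, and the hook product
  cancels against the pairing.\<close>

lemma norm_bra_norm_ket:
  assumes "is_partition \<Lambda>" shows "norm_bra q \<Lambda> * norm_ket q \<Lambda> * pair_val \<Lambda> \<Lambda> = 1"
proof -
  have "hook_prod \<Lambda> q \<noteq> 0"
    using pair_val_eq_0_iff[OF assms assms] by (simp add: pair_val_hook_prod)
  moreover have "norm_bra q \<Lambda> * norm_ket q \<Lambda> = (-1) ^ card \<Lambda> * (q powi (int (card \<Lambda>) - kappa \<Lambda> div 2) * norm_ket q \<Lambda> ^ 2)"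
    unfolding norm_bra_eq[OF assms] power2_eq_square by simp
  moreover have "q powi (int (card \<Lambda>) - kappa \<Lambda> div 2) * q powi (kappa \<Lambda> div 2 - int (card \<Lambda>)) = 1"
    by (subst power_int_add[symmetric]) auto
  moreover have "((-1) ^ card \<Lambda> * (-1) ^ card \<Lambda> :: complex) = 1"
    by (simp flip: power_add power_mult_distrib)
  ultimately show ?thesis
    unfolding norm_ket_square[OF assms] ket_square_def pair_val_hook_prod by (simp add: mult_ac)
qed

end

section \<open>The projection operator on the S-dual basis\<close>

lemma exp_zero_mode_id: "exp_zero_mode s f = f"
proof
  fix M
  have "(osc 0 ^^ k) f M = (if k = 0 then f M else 0)" for k
    by (cases k) (simp_all add: osc_def)
  then have "s ^ k / fact k * (osc 0 ^^ k) f M = (if k = 0 then f M else 0)" for k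
    by simp
  then show "exp_zero_mode s f M = f M"
    using sums_unique[OF sums_single[of 0 "\<lambda>_. f M"]] by (simp add: exp_zero_mode_def)
qed

lemma cval_X_power_cancel: "cval (fps_X ^ n * F) w \<Longrightarrow> cval F w"
proof (induction n)
  case (Suc n)
  then show ?case using cval_fps_X_cancel[of "fps_X ^ n * F" w] by (simp add: mult.assoc)
qed simp

context nome
begin

section \<open>Regularized matrix elements\<close>

lemma reg_pairing_cval:
  assumes "\<And>d. graded_pairing \<phi> f d = fps_nth F d" "cval F w"
  shows "reg_pairing \<phi> f = w"
proof -
  have "graded_pairing \<phi> f = fps_nth F" using assms(1) by (rule ext)
  then show ?thesis using cval_continued_value[OF assms(2)] by (simp add: reg_pairing_def)
qed

lemma osc_S_ket_psum: "n > 0 \<Longrightarrow> osc (int n) (S_ket q \<mu>) = (\<lambda>M. - psum \<mu> n * S_ket q \<mu> M)"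
  by (simp add: osc_S_ket psum_def)

lemma pair_exp:
  assumes "is_partition \<Lambda>"
  shows "exp_fps (\<lambda>n. power_sum n (row_spec q \<Lambda>) * - psum \<mu> n / of_nat n) = pair_fps \<Lambda> \<mu>"
  unfolding pair_fps_def by (rule exp_fps_cong) (simp add: power_sum_row_spec[OF assms])

lemma graded_pairing_S:
  assumes "is_partition \<Lambda>"
  shows "graded_pairing (S_bra q \<Lambda>) (S_ket q \<mu>) d
    = fps_nth (fps_const (norm_bra q \<Lambda> * norm_ket q \<mu>) * pair_fps \<Lambda> \<mu>) d"
  unfolding fps_mult_left_const_nth pair_exp[OF assms, symmetric]
  by (rule graded_pairing_coherent[where \<phi> = "S_bra q \<Lambda>" and f = "S_ket q \<mu>" and \<sigma> = "\<lambda>n. - psum \<mu> n"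
        and \<rho> = "\<lambda>n. power_sum n (row_spec q \<Lambda>)", unfolded S_bra_empty S_ket_empty])
     (rule S_bra_add, erule osc_S_ket_psum)

lemma graded_pairing_vertex_S:
  "graded_pairing (S_bra q \<Lambda>) (vertex_coeff c k (S_ket q \<mu>)) d = fps_nth
     (fps_const (norm_bra q \<Lambda> * norm_ket q \<mu>) * exp_fps (\<lambda>n. power_sum n (row_spec q \<Lambda>) * - psum \<mu> n / of_nat n) *
      Abs_fps (\<lambda>j. if k \<le> int j then fps_nth (exp_fps (\<lambda>n. c (int n) * - psum \<mu> n)) (nat (int j - k)) *
         fps_nth (exp_fps (\<lambda>n. c (- int n) * power_sum n (row_spec q \<Lambda>))) j else 0)) d"
  by (rule graded_pairing_vertex_coeff[where \<phi> = "S_bra q \<Lambda>" and f = "S_ket q \<mu>" and \<sigma> = "\<lambda>n. - psum \<mu> n"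
        and \<rho> = "\<lambda>n. power_sum n (row_spec q \<Lambda>)", unfolded S_bra_empty S_ket_empty])
     (rule S_bra_add, erule osc_S_ket_psum)

lemma norm_pair:
  assumes "is_partition \<Lambda>" "is_partition \<mu>"
  shows "norm_bra q \<Lambda> * norm_ket q \<mu> * pair_val \<Lambda> \<mu> = (if \<Lambda> = \<mu> then 1 else 0)"
  using norm_bra_norm_ket[OF assms(1)] pair_val_eq_0_iff[OF assms] by auto

lemma reg_pairing_S_scaled:
  assumes "is_partition \<Lambda>" "is_partition \<mu>"
  shows "reg_pairing (S_bra q \<Lambda>) (\<lambda>M. c * S_ket q \<mu> M) = (if \<Lambda> = \<mu> then c else 0)"
proof (rule reg_pairing_cval)
  show "graded_pairing (S_bra q \<Lambda>) (\<lambda>M. c * S_ket q \<mu> M) d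
    = fps_nth (fps_const c * (fps_const (norm_bra q \<Lambda> * norm_ket q \<mu>) * pair_fps \<Lambda> \<mu>)) d" for d
    unfolding graded_pairing_scale graded_pairing_S[OF assms(1)] fps_mult_left_const_nth ..
  show "cval (fps_const c * (fps_const (norm_bra q \<Lambda> * norm_ket q \<mu>) * pair_fps \<Lambda> \<mu>)) (if \<Lambda> = \<mu> then c else 0)"
    using cval_cmult[OF cval_cmult[OF cval_pair[OF assms], of "norm_bra q \<Lambda> * norm_ket q \<mu>"], of c]
    unfolding norm_pair[OF assms] by (cases "\<Lambda> = \<mu>") simp_all
qed

text \<open>Acting to the left, a_{-n} leaves its eigenvalue on the bra and a power t^n, which is 1
  at t = 1.\<close>

lemma reg_pairing_S_creation:
  assumes "is_partition \<Lambda>" "is_partition \<mu>" "n > 0"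
  shows "reg_pairing (S_bra q \<Lambda>) (osc (- int n) (S_ket q \<mu>)) = (if \<Lambda> = \<mu> then power_sum n (row_spec q \<Lambda>) else 0)"
proof (rule reg_pairing_cval)
  let ?\<rho> = "power_sum n (row_spec q \<Lambda>)"
  let ?F = "fps_const (norm_bra q \<Lambda> * norm_ket q \<mu>) * pair_fps \<Lambda> \<mu>"
  show "graded_pairing (S_bra q \<Lambda>) (osc (- int n) (S_ket q \<mu>)) d = fps_nth (fps_X ^ n * (fps_const ?\<rho> * ?F)) d" for d
    unfolding graded_pairing_creation[where \<phi> = "S_bra q \<Lambda>" and \<rho> = "\<lambda>n. power_sum n (row_spec q \<Lambda>)", OF S_bra_add assms(3)] graded_pairing_S[OF assms(1)]
    by (simp add: fps_X_power_mult_nth not_le)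
  show "cval (fps_X ^ n * (fps_const ?\<rho> * ?F)) (if \<Lambda> = \<mu> then ?\<rho> else 0)"
    using cval_X_power[OF cval_cmult[OF cval_cmult[OF cval_pair[OF assms(1,2)], of "norm_bra q \<Lambda> * norm_ket q \<mu>"], of ?\<rho>], of n]
    unfolding norm_pair[OF assms(1,2)] by (cases "\<Lambda> = \<mu>") simp_all
qed

lemma reg_pairing_x_plus:
  assumes L: "is_partition \<Lambda>" and M: "is_partition \<mu>"
  shows "reg_pairing (S_bra q \<Lambda>) (x_plus q v k (S_ket q \<mu>)) =
    (\<Sum>a\<in>addable \<mu>. if \<Lambda> = insert a \<mu> then v powi (- k) * ((1 - q) * chi a powi (- k)) else 0)
    + (if \<Lambda> = \<mu> then (if k = 1 then - (1 / v) else 0) else 0)"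
    (is "_ = ?w")
proof (rule reg_pairing_cval)
  let ?c = "\<lambda>n. - ((1 - q powi n) / of_int n)"
  let ?N = "norm_bra q \<Lambda> * norm_ket q \<mu>"
  let ?t = "\<lambda>a. if \<Lambda> = insert a \<mu> then alpha \<mu> a * chi a powi (- k) * pair_val \<Lambda> \<Lambda> else 0"
  let ?d = "if \<Lambda> = \<mu> \<and> k = 1 then pair_val \<mu> \<mu> else 0"
  have A: "exp_fps (\<lambda>n. ?c (int n) * - psum \<mu> n) = ann \<mu>"
    unfolding ann_exp[OF M, symmetric] by (rule exp_fps_cong) simp
  have B: "exp_fps (\<lambda>n. ?c (- int n) * power_sum n (row_spec q \<Lambda>)) = cre \<Lambda>"
    unfolding cre_exp[OF L, symmetric]
    by (rule exp_fps_cong) (simp add: power_sum_row_spec[OF L] power_int_minus field_simps)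
  show "graded_pairing (S_bra q \<Lambda>) (x_plus q v k (S_ket q \<mu>)) d
    = fps_nth (fps_const (v powi (- k)) * (fps_const ?N * (pair_fps \<Lambda> \<mu> * vertex_fps k \<Lambda> \<mu>))) d" for d
    unfolding x_plus_def exp_zero_mode_id graded_pairing_scale
      graded_pairing_vertex_S A B pair_exp[OF L]
    unfolding vertex_fps_def by (simp only: fps_mult_left_const_nth mult.assoc)
  \<comment> \<open>The residue times the norm of |\<mu>\<rangle> is 1 - q times the norm of |\<mu>
    + a\<rangle>, after which only \<langle>\<Lambda>|\<Lambda>\<rangle> = 1 is left.\<close>
  have box: "?N * (alpha \<mu> a * chi a powi (- k) * pair_val \<Lambda> \<Lambda>) = (1 - q) * chi a powi (- k)"
    if "a \<in> addable \<mu>" "\<Lambda> = insert a \<mu>" for a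
  proof -
    have "1 - q \<noteq> 0" using q_power_neq_1[of 1] by auto
    then have ket: "norm_ket q \<mu> * alpha \<mu> a = (1 - q) * norm_ket q \<Lambda>"
      unfolding that(2) norm_ket_insert[OF M that(1)] by simp
    have "?N * (alpha \<mu> a * chi a powi (- k) * pair_val \<Lambda> \<Lambda>)
      = norm_bra q \<Lambda> * (norm_ket q \<mu> * alpha \<mu> a) * chi a powi (- k) * pair_val \<Lambda> \<Lambda>"
      by (simp only: mult_ac)
    also have "\<dots> = (1 - q) * chi a powi (- k) * (norm_bra q \<Lambda> * norm_ket q \<Lambda> * pair_val \<Lambda> \<Lambda>)"
      unfolding ket by (simp only: mult_ac)
    finally show ?thesis using norm_bra_norm_ket[OF L] by simp
  qed
  have "v powi (- k) * (?N * ((\<Sum>a\<in>addable \<mu>. ?t a)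
      - ?d))
    = (\<Sum>a\<in>addable \<mu>. v powi (- k) * (?N * ?t a))
      - v powi (- k) * (?N * ?d)"
    by (simp only: right_diff_distrib sum_distrib_left)
  also have "(\<Sum>a\<in>addable \<mu>. v powi (- k) * (?N * ?t a))
    = (\<Sum>a\<in>addable \<mu>. if \<Lambda> = insert a \<mu> then v powi (- k) * ((1 - q) * chi a powi (- k)) else 0)"
    using box by (intro sum.cong refl) auto
  also have "v powi (- k) * (?N * ?d)
    = - (if \<Lambda> = \<mu> then (if k = 1 then - (1 / v) else 0) else 0)"
    using norm_bra_norm_ket[OF L] by (auto simp: power_int_minus divide_inverse)
  finally have "v powi (- k) * (?N * ((\<Sum>a\<in>addable \<mu>. ?t a)
      - ?d))
    = ?w"
    by simp
  with cval_cmult[OF cval_cmult[OF cval_vertex[OF L M, of k], of ?N], of "v powi (- k)"]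
  show "cval (fps_const (v powi (- k)) * (fps_const ?N * (pair_fps \<Lambda> \<mu> * vertex_fps k \<Lambda> \<mu>)))
    ?w"
    by (simp only:)
qed

text \<open>Both numbers are values at t = 1 of the same power series, so the nested infinite
  products need not be interchanged.\<close>

lemma pair_val_transpose:
  assumes "is_partition \<mu>"
  shows "pair_val (conjugate \<mu>) (conjugate \<mu>) = pair_val \<mu> \<mu>"
  using cval_unique cval_pair[OF assms assms] cval_pair[of "conjugate \<mu>" "conjugate \<mu>"] assms
  by (simp add: pair_fps_transpose)

text \<open>Transposition exchanges bras and kets and turns the coefficient of \<open>z\<^sup>k\<close> in \<open>x\<^sup>-\<close> into that of \<open>z\<^bsup>-k\<^esup>\<close>
  in \<open>x\<^sup>+\<close>, up to a power of the regulator \<open>t\<close>.\<close>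

lemma cval_vertex_transpose:
  assumes L: "is_partition \<Lambda>" and M: "is_partition \<mu>"
  shows "cval (pair_fps \<Lambda> \<mu> * Abs_fps (\<lambda>j. if k \<le> int j then
      fps_nth (cre (conjugate \<mu>)) (nat (int j - k)) * fps_nth (ann (conjugate \<Lambda>)) j else 0))
    ((\<Sum>a\<in>addable \<Lambda>. if \<mu> = insert a \<Lambda> then alpha \<Lambda> a / chi a * chi a powi (- k) * pair_val \<mu> \<mu> else 0)
      - (if \<Lambda> = \<mu> \<and> k = - 1 then pair_val \<mu> \<mu> else 0))"
    (is "cval (_ * ?V) ?w")
proof -
  let ?L = "conjugate \<Lambda>" and ?M = "conjugate \<mu>"
  let ?W = "vertex_fps (- k) ?M ?L"
  have "(\<Sum>a\<in>addable ?L. if ?M = insert a ?L then alpha ?L a * chi a powi (- (- k)) * pair_val ?M ?M else 0)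
    = (\<Sum>a\<in>addable \<Lambda>. if \<mu> = insert a \<Lambda> then alpha \<Lambda> a / chi a * chi a powi (- k) * pair_val \<mu> \<mu> else 0)"
    unfolding addable_transpose sum.reindex[OF inj_on_subset[OF inj_swap subset_UNIV]] o_def
  proof (intro sum.cong refl)
    fix a assume a: "a \<in> addable \<Lambda>"
    have "?M = insert (prod.swap a) ?L \<longleftrightarrow> \<mu> = insert a \<Lambda>"
      unfolding image_insert[symmetric] by (rule transpose_eq_iff)
    moreover have "chi (prod.swap a) powi (- (- k)) = chi a powi (- k)"
      by (simp add: chi_swap power_int_inverse power_int_minus)
    ultimately show "(if ?M = insert (prod.swap a) ?L then alpha ?L (prod.swap a) * chi (prod.swap a) powi (- (- k)) * pair_val ?M ?M else 0)
      = (if \<mu> = insert a \<Lambda> then alpha \<Lambda> a / chi a * chi a powi (- k) * pair_val \<mu> \<mu> else 0)"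
      unfolding alpha_transpose[OF L a] pair_val_transpose[OF M] by simp
  qed
  moreover have "(if ?M = ?L \<and> - k = 1 then pair_val ?L ?L else 0) = (if \<Lambda> = \<mu> \<and> k = - 1 then pair_val \<mu> \<mu> else 0)"
    using pair_val_transpose[OF L] by auto
  ultimately have W: "cval (pair_fps \<Lambda> \<mu> * ?W) ?w"
    using cval_vertex[of ?M ?L "- k"] L M unfolding pair_fps_transpose is_partition_transpose by (simp only:)
  show ?thesis
  \<comment> \<open>The series of x^- is t^k times that of the transposed x^+. For negative k the
    power stands on the other side and has to be cancelled.\<close>
  proof (cases "k \<ge> 0")
    case True
    define n where "n = nat k"
    have k: "k = int n" using True by (simp add: n_def)
    have "?V = fps_X ^ n * ?W"
    proof (rule fps_ext)
      fix j show "fps_nth ?V j = fps_nth (fps_X ^ n * ?W) j"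
        by (cases "n \<le> j") (simp_all add: k fps_X_power_mult_nth vertex_fps_def nat_diff_distrib' of_nat_diff mult.commute)
    qed
    then have "pair_fps \<Lambda> \<mu> * ?V = fps_X ^ n * (pair_fps \<Lambda> \<mu> * ?W)" by (simp only: mult_ac)
    then show ?thesis using cval_X_power[OF W, of n] by (simp only:)
  next
    case False
    define n where "n = nat (- k)"
    have k: "k = - int n" using False by (simp add: n_def)
    have "?W = fps_X ^ n * ?V"
    proof (rule fps_ext)
      fix j show "fps_nth ?W j = fps_nth (fps_X ^ n * ?V) j"
        by (cases "n \<le> j") (simp_all add: k fps_X_power_mult_nth vertex_fps_def nat_diff_distrib' of_nat_diff mult.commute)
    qed
    then have "pair_fps \<Lambda> \<mu> * ?W = fps_X ^ n * (pair_fps \<Lambda> \<mu> * ?V)" by (simp only: mult_ac)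
    with W have "cval (fps_X ^ n * (pair_fps \<Lambda> \<mu> * ?V)) ?w" by (simp only:)
    then show ?thesis by (rule cval_X_power_cancel)
  qed
qed

lemma reg_pairing_x_minus:
  assumes L: "is_partition \<Lambda>" and M: "is_partition \<mu>"
  shows "reg_pairing (S_bra q \<Lambda>) (x_minus q v k (S_ket q \<mu>)) =
    (\<Sum>a\<in>removable \<mu>. if \<Lambda> = \<mu> - {a} then v powi (- k) * ((1 - inverse q) * chi a powi (- k)) else 0)
    + (if \<Lambda> = \<mu> then (if k = - 1 then - v else 0) else 0)"
    (is "_ = ?w")
proof (rule reg_pairing_cval)
  let ?c = "\<lambda>n. (1 - q powi n) / of_int n"
  let ?N = "norm_bra q \<Lambda> * norm_ket q \<mu>"
  let ?t = "\<lambda>a. if \<mu> = insert a \<Lambda> then alpha \<Lambda> a / chi a * chi a powi (- k) * pair_val \<mu> \<mu> else 0"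
  let ?d = "if \<Lambda> = \<mu> \<and> k = - 1 then pair_val \<mu> \<mu> else 0"
  let ?V = "Abs_fps (\<lambda>j. if k \<le> int j then
      fps_nth (cre (conjugate \<mu>)) (nat (int j - k)) * fps_nth (ann (conjugate \<Lambda>)) j else 0)"
  have L': "is_partition (conjugate \<Lambda>)" using L by simp
  have A: "exp_fps (\<lambda>n. ?c (int n) * - psum \<mu> n) = cre (conjugate \<mu>)"
    unfolding cre_exp_transpose[OF M, symmetric] by (rule exp_fps_cong) simp
  have B: "exp_fps (\<lambda>n. ?c (- int n) * power_sum n (row_spec q \<Lambda>)) = ann (conjugate \<Lambda>)"
    unfolding ann_exp[OF L', symmetric]
    by (rule exp_fps_cong) (simp add: power_sum_row_spec[OF L] power_int_minus field_simps)
  show "graded_pairing (S_bra q \<Lambda>) (x_minus q v k (S_ket q \<mu>)) d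
    = fps_nth (fps_const (v powi (- k)) * (fps_const ?N * (pair_fps \<Lambda> \<mu> * ?V))) d" for d
    unfolding x_minus_def exp_zero_mode_id graded_pairing_scale
      graded_pairing_vertex_S A B pair_exp[OF L]
    by (simp only: fps_mult_left_const_nth mult.assoc)
  \<comment> \<open>One factor \<alpha> comes from the ratio of the ket norms, the other, \<alpha> /
    \<chi>_a, is the residue of the transposed current. \<open>pair_val_insert\<close> evaluates
    their product.\<close>
  have box: "?N * (alpha \<Lambda> a / chi a * chi a powi (- k) * pair_val \<mu> \<mu>) = (1 - inverse q) * chi a powi (- k)"
    if "a \<in> addable \<Lambda>" "\<mu> = insert a \<Lambda>" for a
  proof -
    have q1: "1 - q \<noteq> 0" using q_power_neq_1[of 1] by auto
    have "alpha \<Lambda> a / (1 - q) * (alpha \<Lambda> a / chi a) * pair_val \<mu> \<mu> = pair_val \<mu> \<mu> * alpha \<Lambda> a ^ 2 / ((1 - q) * chi a)"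
      by (simp add: power2_eq_square)
    also have "\<dots> = pair_val \<Lambda> \<Lambda> * (1 - inverse q)"
      unfolding that(2) pair_val_insert[OF L that(1)] using q1 by (simp add: inverse_eq_divide)
    finally have s: "alpha \<Lambda> a / (1 - q) * (alpha \<Lambda> a / chi a) * pair_val \<mu> \<mu> = pair_val \<Lambda> \<Lambda> * (1 - inverse q)" .
    have "?N * (alpha \<Lambda> a / chi a * chi a powi (- k) * pair_val \<mu> \<mu>)
      = norm_bra q \<Lambda> * norm_ket q \<Lambda> * (alpha \<Lambda> a / (1 - q) * (alpha \<Lambda> a / chi a) * pair_val \<mu> \<mu>) * chi a powi (- k)"
      unfolding norm_ket_insert[OF L that(1), folded that(2)] by (simp only: mult_ac)
    also have "\<dots> = norm_bra q \<Lambda> * norm_ket q \<Lambda> * pair_val \<Lambda> \<Lambda> * ((1 - inverse q) * chi a powi (- k))"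
      unfolding s by (simp only: mult_ac)
    finally show ?thesis using norm_bra_norm_ket[OF L] by simp
  qed
  \<comment> \<open>The transposed computation ranges over boxes added to the bra diagram, the claim
    over boxes removed from the ket diagram.\<close>
  have reindex: "(\<Sum>a\<in>addable \<Lambda>. if \<mu> = insert a \<Lambda> then g a else 0) = (\<Sum>a\<in>removable \<mu>. if \<Lambda> = \<mu> - {a} then g a else 0)"
    for g :: "nat \<times> nat \<Rightarrow> complex"
  proof -
    have "a \<in> addable \<Lambda> \<and> \<mu> = insert a \<Lambda> \<longleftrightarrow> a \<in> removable \<mu> \<and> \<Lambda> = \<mu> - {a}" for a
      using L M by (auto simp: addable_def removable_def insert_absorb)
    then have "{a \<in> addable \<Lambda>. \<mu> = insert a \<Lambda>} = {a \<in> removable \<mu>. \<Lambda> = \<mu> - {a}}" by blast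
    then show ?thesis
      using finite_addable[OF L] finite_removable[OF M] by (simp flip: sum.inter_filter)
  qed
  have "v powi (- k) * (?N * ((\<Sum>a\<in>addable \<Lambda>. ?t a)
      - ?d))
    = (\<Sum>a\<in>addable \<Lambda>. v powi (- k) * (?N * ?t a))
      - v powi (- k) * (?N * ?d)"
    by (simp only: right_diff_distrib sum_distrib_left)
  also have "(\<Sum>a\<in>addable \<Lambda>. v powi (- k) * (?N * ?t a))
    = (\<Sum>a\<in>addable \<Lambda>. if \<mu> = insert a \<Lambda> then v powi (- k) * ((1 - inverse q) * chi a powi (- k)) else 0)"
  proof (intro sum.cong refl)
    fix a assume a: "a \<in> addable \<Lambda>"
    show "v powi (- k) * (?N * ?t a)
      = (if \<mu> = insert a \<Lambda> then v powi (- k) * ((1 - inverse q) * chi a powi (- k)) else 0)"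
    proof (cases "\<mu> = insert a \<Lambda>")
      case True
      show ?thesis by (simp only: if_P[OF True] box[OF a True])
    qed simp
  qed
  also have "v powi (- k) * (?N * ?d)
    = - (if \<Lambda> = \<mu> then (if k = - 1 then - v else 0) else 0)"
    using norm_bra_norm_ket[OF L] by auto
  finally have "v powi (- k) * (?N * ((\<Sum>a\<in>addable \<Lambda>. ?t a)
      - ?d))
    = ?w"
    unfolding reindex by simp
  with cval_cmult[OF cval_cmult[OF cval_vertex_transpose[OF L M, of k], of ?N], of "v powi (- k)"]
  show "cval (fps_const (v powi (- k)) * (fps_const ?N * (pair_fps \<Lambda> \<mu> * ?V)))
    ?w"
    by (simp only:)
qed

section \<open>Action of the projected operators on the S-dual basis\<close>

lemma proj_expansion:
  assumes "is_partition \<Lambda>" "finite A" "\<And>a. a \<in> A \<Longrightarrow> is_partition (g a)"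
    and r: "\<And>\<mu>. is_partition \<mu> \<Longrightarrow> reg_pairing (S_bra q \<mu>) f = (\<Sum>a\<in>A. if \<mu> = g a then c a else 0) + (if \<mu> = \<Lambda> then d else 0)"
  shows "proj q f M = (\<Sum>a\<in>A. c a * S_ket q (g a) M) + d * S_ket q \<Lambda> M"
proof -
  \<comment> \<open>All partitions with nonzero pairing lie in this finite set, which reduces the
    infinite sum in \<open>proj\<close> to a finite one.\<close>
  define F where "F = insert \<Lambda> (g ` A)"
  have F: "finite F" "F \<subseteq> Collect is_partition" "\<Lambda> \<in> F" "\<And>a. a \<in> A \<Longrightarrow> g a \<in> F"
    using assms by (auto simp: F_def)
  have zero: "S_ket q \<mu> M * reg_pairing (S_bra q \<mu>) f = 0" if "\<mu> \<in> Collect is_partition - F" for \<mu>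
  proof -
    have "(\<Sum>a\<in>A. if \<mu> = g a then c a else 0) = 0"
      using that F(4) by (intro sum.neutral) auto
    then show ?thesis using that F(3) r[of \<mu>] by auto
  qed
  have "proj q f M = (\<Sum>\<^sub>\<infinity>\<mu>\<in>F. S_ket q \<mu> M * reg_pairing (S_bra q \<mu>) f)"
    unfolding proj_def using F(2) zero by (intro infsum_cong_neutral) auto
  also have "\<dots> = (\<Sum>\<mu>\<in>F. S_ket q \<mu> M * reg_pairing (S_bra q \<mu>) f)"
    using F(1) by (rule infsum_finite)
  also have "\<dots> = (\<Sum>\<mu>\<in>F. (\<Sum>a\<in>A. if \<mu> = g a then c a * S_ket q (g a) M else 0) + (if \<mu> = \<Lambda> then d * S_ket q \<Lambda> M else 0))"
  proof (intro sum.cong refl)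
    fix \<mu> assume "\<mu> \<in> F"
    then have "is_partition \<mu>" using F(2) by blast
    have "S_ket q \<mu> M * (\<Sum>a\<in>A. if \<mu> = g a then c a else 0) = (\<Sum>a\<in>A. if \<mu> = g a then c a * S_ket q (g a) M else 0)"
      unfolding sum_distrib_left by (intro sum.cong) auto
    then show "S_ket q \<mu> M * reg_pairing (S_bra q \<mu>) f
      = (\<Sum>a\<in>A. if \<mu> = g a then c a * S_ket q (g a) M else 0) + (if \<mu> = \<Lambda> then d * S_ket q \<Lambda> M else 0)"
      unfolding r[OF \<open>is_partition \<mu>\<close>] by (simp add: distrib_left)
  qed
  also have "\<dots> = (\<Sum>a\<in>A. \<Sum>\<mu>\<in>F. if \<mu> = g a then c a * S_ket q (g a) M else 0) + (\<Sum>\<mu>\<in>F. if \<mu> = \<Lambda> then d * S_ket q \<Lambda> M else 0)"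
    unfolding sum.distrib by (subst sum.swap) simp
  also have "\<dots> = (\<Sum>a\<in>A. c a * S_ket q (g a) M) + d * S_ket q \<Lambda> M"
    using F by (simp add: sum.delta)
  finally show ?thesis .
qed

lemma proj_scaled:
  assumes "is_partition \<Lambda>"
    and "\<And>\<mu>. is_partition \<mu> \<Longrightarrow> reg_pairing (S_bra q \<mu>) f = (if \<mu> = \<Lambda> then d else 0)"
  shows "proj q f = (\<lambda>M. d * S_ket q \<Lambda> M)"
proof
  fix M show "proj q f M = d * S_ket q \<Lambda> M"
    using proj_expansion[of \<Lambda> "{}" "\<lambda>_. \<Lambda>" f "\<lambda>_. 0" d M] assms by simp
qed

lemma proj_S_ket: "is_partition \<Lambda> \<Longrightarrow> proj q (S_ket q \<Lambda>) = S_ket q \<Lambda>"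
  using proj_scaled[of \<Lambda> "S_ket q \<Lambda>" 1] reg_pairing_S_scaled[of _ \<Lambda> 1] by simp

lemma delta_coeff_box_weight:
  "delta_coeff (1 / box_weight q v x) k = v powi (- k) * chi x powi (- k)"
  by (simp add: delta_coeff_def box_weight_def chi_def box_content_def power_int_mult_distrib
      power_int_divide_distrib power_int_minus divide_inverse flip: power_int_inverse)

lemma x_plus_mod_S_ket:
  assumes L: "is_partition \<Lambda>"
  shows "x_plus_mod q v k (S_ket q \<Lambda>) M =
    (1 - q) * (\<Sum>x\<in>addable \<Lambda>. delta_coeff (1 / box_weight q v x) k * S_ket q (insert x \<Lambda>) M)"
proof -
  have "proj q (x_plus q v k (S_ket q \<Lambda>)) M
    = (\<Sum>a\<in>addable \<Lambda>. v powi (- k) * ((1 - q) * chi a powi (- k)) * S_ket q (insert a \<Lambda>) M)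
      + (if k = 1 then - (1 / v) else 0) * S_ket q \<Lambda> M"
    using addable_insert[OF L] reg_pairing_x_plus[OF _ L, of _ v k]
    by (intro proj_expansion L finite_addable[OF L]) auto
  then have "x_plus_mod q v k (S_ket q \<Lambda>) M
    = (\<Sum>a\<in>addable \<Lambda>. v powi (- k) * ((1 - q) * chi a powi (- k)) * S_ket q (insert a \<Lambda>) M)"
    by (simp add: x_plus_mod_def sandwich_def proj_S_ket[OF L])
  then show ?thesis by (simp add: delta_coeff_box_weight sum_distrib_left mult_ac)
qed

lemma x_minus_mod_S_ket:
  assumes L: "is_partition \<Lambda>"
  shows "x_minus_mod q v k (S_ket q \<Lambda>) M =
    (1 - inverse q) * (\<Sum>x\<in>removable \<Lambda>. delta_coeff (1 / box_weight q v x) k * S_ket q (\<Lambda> - {x}) M)"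
proof -
  have "proj q (x_minus q v k (S_ket q \<Lambda>)) M
    = (\<Sum>a\<in>removable \<Lambda>. v powi (- k) * ((1 - inverse q) * chi a powi (- k)) * S_ket q (\<Lambda> - {a}) M)
      + (if k = - 1 then - v else 0) * S_ket q \<Lambda> M"
    using removable_minus[OF L] reg_pairing_x_minus[OF _ L, of _ v k]
    by (intro proj_expansion L finite_removable[OF L]) auto
  then have "x_minus_mod q v k (S_ket q \<Lambda>) M
    = (\<Sum>a\<in>removable \<Lambda>. v powi (- k) * ((1 - inverse q) * chi a powi (- k)) * S_ket q (\<Lambda> - {a}) M)"
    by (simp add: x_minus_mod_def sandwich_def proj_S_ket[OF L])
  then show ?thesis by (simp add: delta_coeff_box_weight sum_distrib_left mult_ac)
qed

text \<open>The ket is an eigenvector of a_m with eigenvalue - p_m, and this sign cancels the one in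
  \<open>h_mod\<close>. For negative modes the eigenvalue belongs to the bra and is positive in p,
  so there the sign remains.\<close>

lemma h_mod_pos_S_ket:
  assumes L: "is_partition \<Lambda>" and m: "m > 0"
  shows "h_mod q v m (S_ket q \<Lambda>) M =
    v powi m / of_int m * (power_sum (nat m) (col_spec q \<Lambda>) / (1 - q powi (- m))) * S_ket q \<Lambda> M"
proof -
  have "osc m (S_ket q \<Lambda>) = (\<lambda>M. - psum \<Lambda> (nat m) * S_ket q \<Lambda> M)"
    using osc_S_ket_psum[of "nat m" \<Lambda>] m by simp
  then have "reg_pairing (S_bra q \<mu>) (osc m (S_ket q \<Lambda>)) = (if \<mu> = \<Lambda> then - psum \<Lambda> (nat m) else 0)"
    if "is_partition \<mu>" for \<mu>
    by (simp only: reg_pairing_S_scaled[OF that L])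
  from proj_scaled[OF L this] show ?thesis by (simp add: h_mod_def sandwich_def proj_S_ket[OF L] psum_def)
qed

lemma h_mod_neg_S_ket:
  assumes L: "is_partition \<Lambda>" and m: "m < 0"
  shows "h_mod q v m (S_ket q \<Lambda>) M =
    - (v powi m / of_int m) * (power_sum (nat (- m)) (row_spec q \<Lambda>) / (1 - q powi (- m))) * S_ket q \<Lambda> M"
proof -
  have "reg_pairing (S_bra q \<mu>) (osc m (S_ket q \<Lambda>)) = (if \<mu> = \<Lambda> then power_sum (nat (- m)) (row_spec q \<Lambda>) else 0)"
    if "is_partition \<mu>" for \<mu>
    using reg_pairing_S_creation[OF that L, of "nat (- m)"] m by auto
  from proj_scaled[OF L this]
  show ?thesis by (simp add: h_mod_def sandwich_def proj_S_ket[OF L])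
qed

end

theorem mainTheorem1:
  fixes q v :: complex and \<Lambda> :: diagram
  assumes "0 < norm q" and "norm q < 1" and "v \<noteq> 0" and "is_partition \<Lambda>"
  shows "(\<forall>k::int. x_plus_mod q v k (S_ket q \<Lambda>) =
            (\<lambda>M. (1 - q) * (\<Sum>x\<in>addable \<Lambda>.
               delta_coeff (1 / box_weight q v x) k * S_ket q (insert x \<Lambda>) M)))
       \<and> (\<forall>k::int. x_minus_mod q v k (S_ket q \<Lambda>) =
            (\<lambda>M. (1 - inverse q) * (\<Sum>x\<in>removable \<Lambda>.
               delta_coeff (1 / box_weight q v x) k * S_ket q (\<Lambda> - {x}) M)))
       \<and> (\<forall>m::int. m > 0 \<longrightarrow> h_mod q v m (S_ket q \<Lambda>) =
            (\<lambda>M. v powi m / of_int m *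
               (power_sum (nat m) (col_spec q \<Lambda>) / (1 - q powi (- m))) * S_ket q \<Lambda> M))
       \<and> (\<forall>m::int. m < 0 \<longrightarrow> h_mod q v m (S_ket q \<Lambda>) =
            (\<lambda>M. - (v powi m / of_int m) *
               (power_sum (nat (- m)) (row_spec q \<Lambda>) / (1 - q powi (- m))) * S_ket q \<Lambda> M))
       \<and> l1_mod (S_ket q \<Lambda>) = (\<lambda>M. 0) \<and> l2_mod (S_ket q \<Lambda>) = S_ket q \<Lambda>"
proof -
  interpret nome q by unfold_locales (fact assms)+
  note L = assms(4)
  show ?thesis
    by (intro conjI allI impI ext)
      (simp_all only: x_plus_mod_S_ket[OF L] x_minus_mod_S_ket[OF L] h_mod_pos_S_ket[OF L]
        h_mod_neg_S_ket[OF L] l1_mod_def l2_mod_def mult_zero_left mult_1_left)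
qed

end
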